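(* Let $n,m\ge2$, let $q\in\mathbb{K}$ be a primitive $n$th root of unity, $p\in\mathbb{K}$ with $p^2=q$, and let $0\le a,b<n$ with $a\not\equiv b\pmod n$. Set $\lambda=q^{b^2-ab}$ and $\mu=p^{b^2-a^2}$, and let $(r_{ij})$ be the $m\times m$-matrix with $r_{ii}=1$, $r_{ij}=\lambda^{j-i-1}\mu$ for $i<j$, and $r_{ij}=r_{ji}^{-1}$ for $j<i$. Consider the quantum polynomial algebra $$A_{a,b}=\frac{\mathbb{K}\langle u_1,\ldots,u_m\rangle}{\langle u_iu_j-r_{ij}u_ju_i : i,j\rangle}.$$ Then $A_{a,b}$ is a left $H$-module algebra for the semisimple Hopf algebra $H=H_{n,m}=\mathbb{K}\mathbb{Z}_n^{\otimes m}\#_\gamma\Sigma_m$, where the $H$-action on the generators is given by $$x_i\cdot u_i=q^au_i,\qquad x_j\cdot u_i=q^bu_i\ \text{ for } i\ne j,$$ $$z_i\cdot u_i=q^{ab}u_{i+1},\qquad z_i\cdot u_{i+1}=u_i,\qquad z_i\cdot u_j=p^{b^2}u_j\ \text{ for } j\notin\{i,i+1\}.$$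
   Context: $\mathbb{K}$ is a field of characteristic zero. $H_{n,m}$ is the semisimple Hopf algebra of dimension $n^mm!$ generated as an algebra by $x_1,\dots,x_m,z_1,\dots,z_{m-1}$ with defining relations $x_i^n=1$, $x_ix_j=x_jx_i$, $z_kx_i=x_{s_k(i)}z_k$ where $s_k=(k,k+1)$, $z_kz_l=z_lz_k$ for $|k-l|>1$, $z_kz_{k+1}z_k=z_{k+1}z_kz_{k+1}$, $z_k^2=\frac1n\sum_{i,j=0}^{n-1}q^{-ij}x_k^ix_{k+1}^j$; the $x_i$ are group-like, $\Delta(z_k)=\big(\frac1n\sum_{i,j=0}^{n-1}q^{-ij}x_k^i\otimes x_{k+1}^j\big)(z_k\otimes z_k)$, $\epsilon(z_k)=1$, $S(z_k)=z_k$. *)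

theory Defs
  imports
    "HOL-Library.Poly_Mapping"
    "HOL-Combinatorics.Transposition"
    "HOL-Number_Theory.Cong"
    "HOL-Algebra.Algebraic_Closure_Type"
begin

section \<open>Associative unital algebras over a field\<close>

text \<open>
  An algebra over the field \<open>'k\<close> is carried by a record of type
  \<^typ>\<open>('k, 'a) module\<close>, which has a ring part and a scalar multiplication.  The library
  locale \<^locale>\<open>algebra\<close> only covers commutative algebras.
\<close>

locale assoc_algebra = module R M + M?: ring M for R (structure) and M (structure) +
  assumes smult_mult_left:
      "\<lbrakk>c \<in> carrier R; x \<in> carrier M; y \<in> carrier M\<rbrakk> \<Longrightarrow>
      (c \<odot>\<^bsub>M\<^esub> x) \<otimes>\<^bsub>M\<^esub> y = c \<odot>\<^bsub>M\<^esub> (x \<otimes>\<^bsub>M\<^esub> y)"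
    and smult_mult_right:
      "\<lbrakk>c \<in> carrier R; x \<in> carrier M; y \<in> carrier M\<rbrakk> \<Longrightarrow>
      x \<otimes>\<^bsub>M\<^esub> (c \<odot>\<^bsub>M\<^esub> y) = c \<odot>\<^bsub>M\<^esub> (x \<otimes>\<^bsub>M\<^esub> y)"

definition ground_algebra :: "('k::field, 'k) module"
  where "ground_algebra = ring.extend ring_of_type_algebra (module.fields (*))"

definition opposite_algebra :: "('k, 'a, 'more) module_scheme \<Rightarrow> ('k, 'a, 'more) module_scheme"
  where "opposite_algebra A = A\<lparr>monoid.mult := (\<lambda>x y. y \<otimes>\<^bsub>A\<^esub> x)\<rparr>"

definition quotient_algebra ::
    "('k, 'a, 'more) module_scheme \<Rightarrow> 'a set \<Rightarrow> ('k, 'a set) module"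
  where "quotient_algebra A I =
    ring.extend (A Quot I) (module.fields (\<lambda>c Y. \<Union>y\<in>Y. I +>\<^bsub>A\<^esub> (c \<odot>\<^bsub>A\<^esub> y)))"

text \<open>
  The algebra of a monoid: finite formal linear combinations of elements of the carrier, with the
  bilinear extension of the multiplication.
\<close>

definition monoid_algebra ::
    "('s, 'more) monoid_scheme \<Rightarrow> ('k::field, 's \<Rightarrow>\<^sub>0 'k) module"
  where "monoid_algebra S =
    \<lparr>carrier = {f. Poly_Mapping.keys f \<subseteq> carrier S},
     monoid.mult = (\<lambda>f g. \<Sum>s\<in>Poly_Mapping.keys f. \<Sum>t\<in>Poly_Mapping.keys g.
       Poly_Mapping.single (s \<otimes>\<^bsub>S\<^esub> t) (Poly_Mapping.lookup f s * Poly_Mapping.lookup g t)),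
     one = Poly_Mapping.single \<one>\<^bsub>S\<^esub> 1,
     zero = 0,
     add = (+),
     module.smult = (\<lambda>c f. Poly_Mapping.map ((*) c) f)\<rparr>"

definition linear_extension ::
    "('k::field, 'b, 'more) module_scheme \<Rightarrow> ('s \<Rightarrow> 'b) \<Rightarrow> ('s \<Rightarrow>\<^sub>0 'k) \<Rightarrow> 'b"
  where "linear_extension B \<phi> f =
    (\<Oplus>\<^bsub>B\<^esub> s \<in> Poly_Mapping.keys f. Poly_Mapping.lookup f s \<odot>\<^bsub>B\<^esub> \<phi> s)"


section \<open>Algebras given by generators and relations\<close>

definition free_algebra :: "'g set \<Rightarrow> ('k::field, 'g list \<Rightarrow>\<^sub>0 'k) module"
  where "free_algebra V = monoid_algebra \<lparr>carrier = lists V, monoid.mult = (@), one = []\<rparr>"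

definition free_var :: "'g \<Rightarrow> 'g list \<Rightarrow>\<^sub>0 'k::field"
  where "free_var g = Poly_Mapping.single [g] 1"

definition free_lift ::
    "('k::field, 'b, 'more) module_scheme \<Rightarrow> ('g \<Rightarrow> 'b) \<Rightarrow> ('g list \<Rightarrow>\<^sub>0 'k) \<Rightarrow> 'b"
  where "free_lift B \<phi> =
    linear_extension B (\<lambda>w. foldr (\<lambda>g y. \<phi> g \<otimes>\<^bsub>B\<^esub> y) w \<one>\<^bsub>B\<^esub>)"

definition presented_algebra ::
    "'g set \<Rightarrow> ('g list \<Rightarrow>\<^sub>0 'k) set \<Rightarrow> ('k::field, ('g list \<Rightarrow>\<^sub>0 'k) set) module"
  where "presented_algebra V rels = quotient_algebra (free_algebra V) (Idl\<^bsub>free_algebra V\<^esub> rels)"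

definition presented_gen ::
    "'g set \<Rightarrow> ('g list \<Rightarrow>\<^sub>0 'k) set \<Rightarrow> 'g \<Rightarrow> ('g list \<Rightarrow>\<^sub>0 'k::field) set"
  where "presented_gen V rels g = (Idl\<^bsub>free_algebra V\<^esub> rels) +>\<^bsub>free_algebra V\<^esub> free_var g"

text \<open>
  The algebra map from a presented algebra to \<open>B\<close> that sends every generator \<open>g\<close> to \<open>\<phi> g\<close>;
  meaningful if the relations hold in \<open>B\<close> for the elements \<open>\<phi> g\<close>, because only then is the image
  of a coset a singleton.
\<close>

definition presented_lift ::
    "('k::field, 'b, 'more) module_scheme \<Rightarrow> ('g \<Rightarrow> 'b) \<Rightarrow> ('g list \<Rightarrow>\<^sub>0 'k) set \<Rightarrow> 'b"
  where "presented_lift B \<phi> Y = the_elem (free_lift B \<phi> ` Y)"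


section \<open>Tensor products of algebras\<close>

text \<open>
  The tensor product is the space of formal linear combinations of pairs modulo bilinearity.  The
  set of bilinearity relations is stable, up to scalar factors, under multiplication by pairs
  (componentwise), so that its linear span is the ideal generated by it in the algebra of the
  multiplicative monoid of pairs.
\<close>

definition tensor_relations ::
    "('k::field, 'a, 'm) module_scheme \<Rightarrow> ('k, 'b, 'n) module_scheme \<Rightarrow> ('a \<times> 'b \<Rightarrow>\<^sub>0 'k) set"
  where "tensor_relations A B =
    {Poly_Mapping.single (a \<oplus>\<^bsub>A\<^esub> a', b) 1 - Poly_Mapping.single (a, b) 1
        - Poly_Mapping.single (a', b) 1 | a a' b.
      a \<in> carrier A \<and> a' \<in> carrier A \<and> b \<in> carrier B} \<union>
    {Poly_Mapping.single (a, b \<oplus>\<^bsub>B\<^esub> b') 1 - Poly_Mapping.single (a, b) 1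
        - Poly_Mapping.single (a, b') 1 | a b b'.
      a \<in> carrier A \<and> b \<in> carrier B \<and> b' \<in> carrier B} \<union>
    {Poly_Mapping.single (c \<odot>\<^bsub>A\<^esub> a, b) 1 - Poly_Mapping.single (a, b) c | c a b.
      a \<in> carrier A \<and> b \<in> carrier B} \<union>
    {Poly_Mapping.single (a, c \<odot>\<^bsub>B\<^esub> b) 1 - Poly_Mapping.single (a, b) c | c a b.
      a \<in> carrier A \<and> b \<in> carrier B}"

definition tensor_ideal ::
    "('k::field, 'a, 'm) module_scheme \<Rightarrow> ('k, 'b, 'n) module_scheme \<Rightarrow> ('a \<times> 'b \<Rightarrow>\<^sub>0 'k) set"
  where "tensor_ideal A B = Idl\<^bsub>monoid_algebra (A \<times>\<times> B)\<^esub> (tensor_relations A B)"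

definition tensor_algebra ::
    "('k::field, 'a, 'm) module_scheme \<Rightarrow> ('k, 'b, 'n) module_scheme \<Rightarrow>
      ('k, ('a \<times> 'b \<Rightarrow>\<^sub>0 'k) set) module"
  where "tensor_algebra A B = quotient_algebra (monoid_algebra (A \<times>\<times> B)) (tensor_ideal A B)"

definition pure_tensor ::
    "('k::field, 'a, 'm) module_scheme \<Rightarrow> ('k, 'b, 'n) module_scheme \<Rightarrow>
      'a \<Rightarrow> 'b \<Rightarrow> ('a \<times> 'b \<Rightarrow>\<^sub>0 'k) set"
  where "pure_tensor A B a b =
    tensor_ideal A B +>\<^bsub>monoid_algebra (A \<times>\<times> B)\<^esub> Poly_Mapping.single (a, b) 1"

text \<open>
  The linear map to \<open>C\<close> that sends every pure tensor \<open>a \<otimes> b\<close> to \<open>\<beta> a b\<close>, for a bilinear map \<open>\<beta>\<close>.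
\<close>

definition tensor_lift ::
    "('k::field, 'c, 'm) module_scheme \<Rightarrow> ('a \<Rightarrow> 'b \<Rightarrow> 'c) \<Rightarrow> ('a \<times> 'b \<Rightarrow>\<^sub>0 'k) set \<Rightarrow> 'c"
  where "tensor_lift C \<beta> Y = the_elem (linear_extension C (\<lambda>(a, b). \<beta> a b) ` Y)"


section \<open>Hopf algebra data and module algebras\<close>

record (overloaded) ('k::field, 'h) hopf_data = "('k, 'h) module" +
  comult :: "'h \<Rightarrow> ('h \<times> 'h \<Rightarrow>\<^sub>0 'k) set"
  counit :: "'h \<Rightarrow> 'k"
  antipode :: "'h \<Rightarrow> 'h"

text \<open>
  Condition \<open>act_mult\<close> is the usual \<open>h \<cdot> (x y) = \<Sum> (h\<^sub>1 \<cdot> x) (h\<^sub>2 \<cdot> y)\<close> with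
  \<open>\<Delta> h = \<Sum> h\<^sub>1 \<otimes> h\<^sub>2\<close>.
\<close>

locale left_module_algebra =
  H: assoc_algebra "ring_of_type_algebra :: 'k ring" H +
  A: assoc_algebra "ring_of_type_algebra :: 'k ring" A
  for H :: "('k::field, 'h) hopf_data" and A :: "('k, 'a) module" and act :: "'h \<Rightarrow> 'a \<Rightarrow> 'a" +
  assumes act_closed: "\<lbrakk>h \<in> carrier H; x \<in> carrier A\<rbrakk> \<Longrightarrow> act h x \<in> carrier A"
    and act_add_left: "\<lbrakk>h \<in> carrier H; h' \<in> carrier H; x \<in> carrier A\<rbrakk> \<Longrightarrow>
      act (h \<oplus>\<^bsub>H\<^esub> h') x = act h x \<oplus>\<^bsub>A\<^esub> act h' x"
    and act_smult_left: "\<lbrakk>h \<in> carrier H; x \<in> carrier A\<rbrakk> \<Longrightarrow>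
      act (c \<odot>\<^bsub>H\<^esub> h) x = c \<odot>\<^bsub>A\<^esub> act h x"
    and act_add_right: "\<lbrakk>h \<in> carrier H; x \<in> carrier A; y \<in> carrier A\<rbrakk> \<Longrightarrow>
      act h (x \<oplus>\<^bsub>A\<^esub> y) = act h x \<oplus>\<^bsub>A\<^esub> act h y"
    and act_smult_right: "\<lbrakk>h \<in> carrier H; x \<in> carrier A\<rbrakk> \<Longrightarrow>
      act h (c \<odot>\<^bsub>A\<^esub> x) = c \<odot>\<^bsub>A\<^esub> act h x"
    and act_assoc: "\<lbrakk>h \<in> carrier H; h' \<in> carrier H; x \<in> carrier A\<rbrakk> \<Longrightarrow>
      act (h \<otimes>\<^bsub>H\<^esub> h') x = act h (act h' x)"
    and act_unit: "x \<in> carrier A \<Longrightarrow> act \<one>\<^bsub>H\<^esub> x = x"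
    and act_mult: "\<lbrakk>h \<in> carrier H; x \<in> carrier A; y \<in> carrier A\<rbrakk> \<Longrightarrow>
      act h (x \<otimes>\<^bsub>A\<^esub> y) =
        tensor_lift A (\<lambda>h\<^sub>1 h\<^sub>2. act h\<^sub>1 x \<otimes>\<^bsub>A\<^esub> act h\<^sub>2 y) (comult H h)"
    and act_one: "h \<in> carrier H \<Longrightarrow> act h \<one>\<^bsub>A\<^esub> = counit H h \<odot>\<^bsub>A\<^esub> \<one>\<^bsub>A\<^esub>"


section \<open>The Hopf algebra \<open>H\<^sub>n\<^sub>,\<^sub>m\<close>\<close>

definition primitive_root_of_unity :: "nat \<Rightarrow> 'k::field \<Rightarrow> bool"
  where "primitive_root_of_unity n q \<longleftrightarrow> 0 < n \<and> q ^ n = 1 \<and> (\<forall>k. 0 < k \<and> k < n \<longrightarrow> q ^ k \<noteq> 1)"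

datatype hnm_letter = LX nat | LZ nat

definition hnm_letters :: "nat \<Rightarrow> hnm_letter set"
  where "hnm_letters m = LX ` {1..m} \<union> LZ ` {1..<m}"

text \<open>
  Used with \<open>f i j = x\<^sub>k\<^sup>i x\<^sub>k\<^sub>+\<^sub>1\<^sup>j\<close> for \<open>z\<^sub>k\<^sup>2\<close> and with \<open>f i j = x\<^sub>k\<^sup>i \<otimes> x\<^sub>k\<^sub>+\<^sub>1\<^sup>j\<close> for
  \<open>\<Delta>(z\<^sub>k)\<close>.
\<close>

definition twist_sum ::
    "nat \<Rightarrow> 'k::field \<Rightarrow> ('k, 'b, 'm) module_scheme \<Rightarrow> (nat \<Rightarrow> nat \<Rightarrow> 'b) \<Rightarrow> 'b"
  where "twist_sum n q B f = inverse (of_nat n) \<odot>\<^bsub>B\<^esub>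
    (\<Oplus>\<^bsub>B\<^esub> i \<in> {..<n}. \<Oplus>\<^bsub>B\<^esub> j \<in> {..<n}. inverse (q ^ (i * j)) \<odot>\<^bsub>B\<^esub> f i j)"

definition hnm_relations :: "nat \<Rightarrow> nat \<Rightarrow> 'k::field \<Rightarrow> (hnm_letter list \<Rightarrow>\<^sub>0 'k) set"
  where "hnm_relations n m q =
    (let F = free_algebra (hnm_letters m); x = (\<lambda>i. free_var (LX i)); z = (\<lambda>k. free_var (LZ k)) in
      {x i [^]\<^bsub>F\<^esub> n \<ominus>\<^bsub>F\<^esub> \<one>\<^bsub>F\<^esub> | i. i \<in> {1..m}} \<union>
      {x i \<otimes>\<^bsub>F\<^esub> x j \<ominus>\<^bsub>F\<^esub> x j \<otimes>\<^bsub>F\<^esub> x i | i j. i \<in> {1..m} \<and> j \<in> {1..m}} \<union>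
      {z k \<otimes>\<^bsub>F\<^esub> x i \<ominus>\<^bsub>F\<^esub> x (Transposition.transpose k (k + 1) i) \<otimes>\<^bsub>F\<^esub> z k | k i.
        k \<in> {1..<m} \<and> i \<in> {1..m}} \<union>
      {z k \<otimes>\<^bsub>F\<^esub> z l \<ominus>\<^bsub>F\<^esub> z l \<otimes>\<^bsub>F\<^esub> z k | k l.
        k \<in> {1..<m} \<and> l \<in> {1..<m} \<and> \<bar>int k - int l\<bar> > 1} \<union>
      {z k \<otimes>\<^bsub>F\<^esub> z (k + 1) \<otimes>\<^bsub>F\<^esub> z k \<ominus>\<^bsub>F\<^esub> z (k + 1) \<otimes>\<^bsub>F\<^esub> z k \<otimes>\<^bsub>F\<^esub> z (k + 1) | k.
        k \<in> {1..<m} \<and> k + 1 \<in> {1..<m}} \<union>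
      {z k [^]\<^bsub>F\<^esub> (2::nat)
          \<ominus>\<^bsub>F\<^esub> twist_sum n q F (\<lambda>i j. x k [^]\<^bsub>F\<^esub> i \<otimes>\<^bsub>F\<^esub> x (k + 1) [^]\<^bsub>F\<^esub> j) | k.
        k \<in> {1..<m}})"

definition hnm_algebra ::
    "nat \<Rightarrow> nat \<Rightarrow> 'k::field \<Rightarrow> ('k, (hnm_letter list \<Rightarrow>\<^sub>0 'k) set) module"
  where "hnm_algebra n m q = presented_algebra (hnm_letters m) (hnm_relations n m q)"

definition hnm_x :: "nat \<Rightarrow> nat \<Rightarrow> 'k::field \<Rightarrow> nat \<Rightarrow> (hnm_letter list \<Rightarrow>\<^sub>0 'k) set"
  where "hnm_x n m q i = presented_gen (hnm_letters m) (hnm_relations n m q) (LX i)"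

definition hnm_z :: "nat \<Rightarrow> nat \<Rightarrow> 'k::field \<Rightarrow> nat \<Rightarrow> (hnm_letter list \<Rightarrow>\<^sub>0 'k) set"
  where "hnm_z n m q k = presented_gen (hnm_letters m) (hnm_relations n m q) (LZ k)"

text \<open>\<open>\<Delta>(x\<^sub>i) = x\<^sub>i \<otimes> x\<^sub>i\<close> and
  \<open>\<Delta>(z\<^sub>k) = (1/n \<Sum> q\<^sup>-\<^sup>i\<^sup>j x\<^sub>k\<^sup>i \<otimes> x\<^sub>k\<^sub>+\<^sub>1\<^sup>j) (z\<^sub>k \<otimes> z\<^sub>k)\<close>\<close>

fun hnm_comult_gen ::
    "nat \<Rightarrow> nat \<Rightarrow> 'k::field \<Rightarrow> hnm_letter \<Rightarrow>
      ((hnm_letter list \<Rightarrow>\<^sub>0 'k) set \<times> (hnm_letter list \<Rightarrow>\<^sub>0 'k) set \<Rightarrow>\<^sub>0 'k) set"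
  where
    "hnm_comult_gen n m q (LX i) =
      (let P = hnm_algebra n m q in pure_tensor P P (hnm_x n m q i) (hnm_x n m q i))"
  | "hnm_comult_gen n m q (LZ k) =
      (let P = hnm_algebra n m q; T = tensor_algebra P P in
        twist_sum n q T (\<lambda>i j.
          pure_tensor P P (hnm_x n m q k [^]\<^bsub>P\<^esub> i) (hnm_x n m q (k + 1) [^]\<^bsub>P\<^esub> j))
        \<otimes>\<^bsub>T\<^esub> pure_tensor P P (hnm_z n m q k) (hnm_z n m q k))"

text \<open>The antipode inverts the group-like elements \<open>x\<^sub>i\<close>, and \<open>x\<^sub>i\<^sup>-\<^sup>1 = x\<^sub>i\<^sup>n\<^sup>-\<^sup>1\<close>.\<close>

fun hnm_antipode_gen ::
    "nat \<Rightarrow> nat \<Rightarrow> 'k::field \<Rightarrow> hnm_letter \<Rightarrow> (hnm_letter list \<Rightarrow>\<^sub>0 'k) set"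
  where
    "hnm_antipode_gen n m q (LX i) = hnm_x n m q i [^]\<^bsub>hnm_algebra n m q\<^esub> (n - 1)"
  | "hnm_antipode_gen n m q (LZ k) = hnm_z n m q k"

definition hnm ::
    "nat \<Rightarrow> nat \<Rightarrow> 'k::field \<Rightarrow> ('k, (hnm_letter list \<Rightarrow>\<^sub>0 'k) set) hopf_data"
  where "hnm n m q = (let P = hnm_algebra n m q in
    module.extend P (hopf_data.fields
      (presented_lift (tensor_algebra P P) (hnm_comult_gen n m q))
      (presented_lift ground_algebra (\<lambda>_. 1))
      (presented_lift (opposite_algebra P) (hnm_antipode_gen n m q))))"


section \<open>Quantum polynomial algebras\<close>

definition quantum_relations ::
    "nat \<Rightarrow> (nat \<Rightarrow> nat \<Rightarrow> 'k::field) \<Rightarrow> (nat list \<Rightarrow>\<^sub>0 'k) set"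
  where "quantum_relations m r =
    (let F = free_algebra {1..m}; u = free_var in
      {u i \<otimes>\<^bsub>F\<^esub> u j \<ominus>\<^bsub>F\<^esub> r i j \<odot>\<^bsub>F\<^esub> (u j \<otimes>\<^bsub>F\<^esub> u i) | i j. i \<in> {1..m} \<and> j \<in> {1..m}})"

definition quantum_polynomials ::
    "nat \<Rightarrow> (nat \<Rightarrow> nat \<Rightarrow> 'k::field) \<Rightarrow> ('k, (nat list \<Rightarrow>\<^sub>0 'k) set) module"
  where "quantum_polynomials m r = presented_algebra {1..m} (quantum_relations m r)"

definition quantum_var ::
    "nat \<Rightarrow> (nat \<Rightarrow> nat \<Rightarrow> 'k::field) \<Rightarrow> nat \<Rightarrow> (nat list \<Rightarrow>\<^sub>0 'k) set"
  where "quantum_var m r = presented_gen {1..m} (quantum_relations m r)"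

definition quantum_matrix :: "'k::field \<Rightarrow> 'k \<Rightarrow> nat \<Rightarrow> nat \<Rightarrow> 'k"
  where "quantum_matrix lam mu i j =
    (if i = j then 1
     else if i < j then lam ^ (j - i - 1) * mu
     else inverse (lam ^ (i - j - 1) * mu))"

end

theory Submission
  imports Defs
begin

text \<open>
  Both algebras are spanned by words in their generators.  On a word in the \<open>u\<^sub>i\<close>, each generator of
  \<open>H\<^sub>n\<^sub>,\<^sub>m\<close> acts monomially: \<open>x\<^sub>i\<close> by a power of \<open>q\<close> that is additive in the letters, and \<open>z\<^sub>k\<close> by the
  transposition \<open>s\<^sub>k\<close> of the letters times a power of \<open>p\<close> whose exponent is additive up to a bilinear
  term in the weights, because \<open>1/n \<Sum> q\<^sup>-\<^sup>i\<^sup>j x\<^sub>k\<^sup>i \<otimes> x\<^sub>k\<^sub>+\<^sub>1\<^sup>j\<close> acts on weight vectors as a power of \<open>q\<close>.  The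
  relations of \<open>H\<^sub>n\<^sub>,\<^sub>m\<close> become identities between exponents, already on the free algebra; the choice
  of \<open>\<lambda>\<close> and \<open>\<mu>\<close> is what makes these operators descend to the quantum polynomials.

  The comultiplication exists because the twist is bimultiplicative in commuting elements of order
  \<open>n\<close> and is moved by the \<open>z\<^sub>k\<close> as its indices are.  The module algebra axiom for products is
  stable under products of elements of \<open>H\<^sub>n\<^sub>,\<^sub>m\<close>, hence only has to be checked on generators and
  words.
\<close>

section \<open>Algebras over a field and their linear maps\<close>

text \<open>Origin of the constants: the relation for \<open>z_k^2\<close> makes its square multiply
  a weight vector by \<open>q\<close> to the product of its weights for \<open>k\<close> and
  \<open>k + 1\<close>. On one letter this product is \<open>a * b\<close> if the letter is
  \<open>u_k\<close> or \<open>u_(k+1)\<close>, and \<open>b^2\<close> otherwise. Hence a square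
  root \<open>p\<close> of \<open>q\<close>, the factor \<open>p^(b^2)\<close>, and the splitting of
  \<open>q^(a * b)\<close> over the two exchanged letters. Applying \<open>z_k\<close> to
  \<open>u_i u_j = r_ij u_j u_i\<close> compares \<open>r_ij\<close> with the entry at the exchanged
  indices: the pair \<open>k\<close>, \<open>k + 1\<close> asks for
  \<open>mu^2 = q^(b^2 - a^2)\<close>, and moving just one index by one place asks for the factor
  \<open>q^(b^2 - a * b)\<close>, which is \<open>lam\<close>.

  The obstacle is well-definedness: elements of the presented and tensor algebras are cosets, and
  maps are read off from representatives. Both are quotients of monoid algebras, of words or of
  pairs, so one universal property for such quotients serves them all. The action is an algebra map
  from the presented algebra to the endomorphisms of the quantum polynomials; this gives all axioms
  of a module, and only those on products and on the unit remain.\<close>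

locale k_algebra = assoc_algebra "ring_of_type_algebra :: 'k ring" A
  for A :: "('k::field, 'a, 'more) module_scheme" (structure)

lemma scalar_ring_simps [simp]:
  "carrier ring_of_type_algebra = UNIV"
  "c \<oplus>\<^bsub>ring_of_type_algebra\<^esub> d = c + d"
  "c \<otimes>\<^bsub>ring_of_type_algebra\<^esub> d = c * d"
  "\<one>\<^bsub>ring_of_type_algebra\<^esub> = 1"
  "\<zero>\<^bsub>ring_of_type_algebra\<^esub> = 0"
  by (simp_all add: ring_of_type_algebra_def)

lemma k_algebraI:
  fixes A :: "('k::field, 'a, 'more) module_scheme" (structure)
  assumes "ring A"
    and "\<And>c x. x \<in> carrier A \<Longrightarrow> c \<odot> x \<in> carrier A"
    and "\<And>c d x. x \<in> carrier A \<Longrightarrow> (c + d) \<odot> x = c \<odot> x \<oplus> d \<odot> x"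
    and "\<And>c x y. \<lbrakk>x \<in> carrier A; y \<in> carrier A\<rbrakk> \<Longrightarrow> c \<odot> (x \<oplus> y) = c \<odot> x \<oplus> c \<odot> y"
    and "\<And>c d x. x \<in> carrier A \<Longrightarrow> (c * d) \<odot> x = c \<odot> (d \<odot> x)"
    and "\<And>x. x \<in> carrier A \<Longrightarrow> 1 \<odot> x = x"
    and "\<And>c x y. \<lbrakk>x \<in> carrier A; y \<in> carrier A\<rbrakk> \<Longrightarrow> (c \<odot> x) \<otimes> y = c \<odot> (x \<otimes> y)"
    and "\<And>c x y. \<lbrakk>x \<in> carrier A; y \<in> carrier A\<rbrakk> \<Longrightarrow> x \<otimes> (c \<odot> y) = c \<odot> (x \<otimes> y)"
  shows "k_algebra A"
proof -
  interpret A: ring A by fact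
  have "module (ring_of_type_algebra :: 'k ring) A"
    by (rule moduleI) (use assms in \<open>auto intro: cring_from_type_algebra A.abelian_group_axioms\<close>)
  then show ?thesis
    using assms by (auto simp: k_algebra_def assoc_algebra_def assoc_algebra_axioms_def)
qed

text \<open>Records of different extensions of the ring type cannot be equated, so the ring
  structure is transported component by component, for instance from \<open>A Quot I\<close> to
  \<open>quotient_algebra A I\<close>.\<close>

lemma ring_cong:
  assumes "ring A" and "carrier B = carrier A" "monoid.mult B = monoid.mult A"
    "one B = one A" "zero B = zero A" "add B = add A"
  shows "ring B"
proof -
  interpret A: ring A by fact
  show ?thesis
  proof (rule ringI)
    show "abelian_group B"
    proof (rule abelian_groupI, goal_cases)
      case (6 x)
      then show ?case using A.l_neg[of x] A.a_inv_closed[of x] assms(2-) by auto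
    qed (use assms in \<open>auto simp: A.a_assoc intro: A.a_comm\<close>)
    show "Group.monoid B"
      by (rule monoidI) (use assms in \<open>auto simp: A.m_assoc\<close>)
  qed (use assms in \<open>auto simp: A.l_distr A.r_distr\<close>)
qed

context k_algebra
begin

lemma smult_closed' [simp, intro]: "x \<in> carrier A \<Longrightarrow> c \<odot> x \<in> carrier A"
  by simp

lemma smult_add_left: "x \<in> carrier A \<Longrightarrow> (c + d) \<odot> x = c \<odot> x \<oplus> d \<odot> x"
  using smult_l_distr[of c d x] by simp

lemma smult_add_right: "\<lbrakk>x \<in> carrier A; y \<in> carrier A\<rbrakk> \<Longrightarrow> c \<odot> (x \<oplus> y) = c \<odot> x \<oplus> c \<odot> y"
  using smult_r_distr[of c x y] by simp

lemma smult_smult [simp]: "x \<in> carrier A \<Longrightarrow> c \<odot> (d \<odot> x) = (c * d) \<odot> x"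
  using smult_assoc1[of c d x] by simp

lemma smult_1 [simp]: "x \<in> carrier A \<Longrightarrow> 1 \<odot> x = x"
  using smult_one[of x] by simp

lemma smult_0 [simp]: "x \<in> carrier A \<Longrightarrow> 0 \<odot> x = \<zero>"
  using smult_l_null[of x] by simp

lemma smult_zero [simp]: "c \<odot> \<zero> = \<zero>"
  using smult_r_null[of c] by simp

lemma smult_mult [simp]:
  "\<lbrakk>x \<in> carrier A; y \<in> carrier A\<rbrakk> \<Longrightarrow> (c \<odot> x) \<otimes> y = c \<odot> (x \<otimes> y)"
  "\<lbrakk>x \<in> carrier A; y \<in> carrier A\<rbrakk> \<Longrightarrow> x \<otimes> (c \<odot> y) = c \<odot> (x \<otimes> y)"
  using smult_mult_left[of c x y] smult_mult_right[of c x y] by simp_all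

lemma smult_minus: "x \<in> carrier A \<Longrightarrow> (- c) \<odot> x = \<ominus> (c \<odot> x)"
  using smult_add_left[of x c "-c"] by (metis smult_0 add.left_inverse smult_add_left M.add.m_comm smult_closed' M.add.inv_equality a_inv_def)

lemma smult_finsum: "f \<in> I \<rightarrow> carrier A \<Longrightarrow> c \<odot> (\<Oplus>i\<in>I. f i) = (\<Oplus>i\<in>I. c \<odot> f i)"
proof (induct I rule: infinite_finite_induct)
  case (insert i I)
  then show ?case by (simp add: smult_add_right Pi_def)
qed simp_all

lemma finsum_smult: "finite I \<Longrightarrow> x \<in> carrier A \<Longrightarrow> (\<Oplus>i\<in>I. c i \<odot> x) = sum c I \<odot> x"
  by (induct I rule: finite_induct) (simp_all add: smult_add_left Pi_def)

text \<open>Serves for \<open>hnm\<close>, whose record extends that of \<open>hnm_algebra\<close>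
  by the Hopf data and leaves the algebra unchanged.\<close>

lemma cong:
  assumes "carrier B = carrier A" "monoid.mult B = monoid.mult A" "one B = one A"
    "zero B = zero A" "add B = add A" "module.smult B = module.smult A"
  shows "k_algebra B"
  by (rule k_algebraI[OF ring_cong[OF M.ring_axioms]])
     (use assms in \<open>auto simp: smult_add_left smult_add_right\<close>)

end

locale linear_map = A: k_algebra A + B: k_algebra B
  for A :: "('k::field, 'a, 'm) module_scheme" and B :: "('k, 'b, 'n) module_scheme"
    and f :: "'a \<Rightarrow> 'b" +
  assumes closed [simp, intro]: "x \<in> carrier A \<Longrightarrow> f x \<in> carrier B"
    and add [simp]: "\<lbrakk>x \<in> carrier A; y \<in> carrier A\<rbrakk> \<Longrightarrow> f (x \<oplus>\<^bsub>A\<^esub> y) = f x \<oplus>\<^bsub>B\<^esub> f y"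
    and smult [simp]: "x \<in> carrier A \<Longrightarrow> f (c \<odot>\<^bsub>A\<^esub> x) = c \<odot>\<^bsub>B\<^esub> f x"
begin

lemma zero [simp]: "f \<zero>\<^bsub>A\<^esub> = \<zero>\<^bsub>B\<^esub>"
  using smult[of "\<zero>\<^bsub>A\<^esub>" 0] by simp

lemma minus [simp]: "x \<in> carrier A \<Longrightarrow> f (\<ominus>\<^bsub>A\<^esub> x) = \<ominus>\<^bsub>B\<^esub> f x"
  using smult[of x "-1"] by (simp add: A.smult_minus B.smult_minus del: smult)

lemma diff [simp]:
  "\<lbrakk>x \<in> carrier A; y \<in> carrier A\<rbrakk> \<Longrightarrow> f (x \<ominus>\<^bsub>A\<^esub> y) = f x \<ominus>\<^bsub>B\<^esub> f y"
  by (simp add: a_minus_def)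

lemma finsum: "g \<in> I \<rightarrow> carrier A \<Longrightarrow> f (\<Oplus>\<^bsub>A\<^esub>i\<in>I. g i) = (\<Oplus>\<^bsub>B\<^esub>i\<in>I. f (g i))"
proof (induct I rule: infinite_finite_induct)
  case (insert i I)
  then show ?case by (simp add: Pi_def)
qed simp_all

end

locale algebra_hom = linear_map +
  assumes mult [simp]: "\<lbrakk>x \<in> carrier A; y \<in> carrier A\<rbrakk> \<Longrightarrow> f (x \<otimes>\<^bsub>A\<^esub> y) = f x \<otimes>\<^bsub>B\<^esub> f y"
    and one [simp]: "f \<one>\<^bsub>A\<^esub> = \<one>\<^bsub>B\<^esub>"
begin

lemma pow [simp]: "x \<in> carrier A \<Longrightarrow> f (x [^]\<^bsub>A\<^esub> (i::nat)) = f x [^]\<^bsub>B\<^esub> i"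
  by (induct i) simp_all

end

lemma (in k_algebra) linear_mult_left: "a \<in> carrier A \<Longrightarrow> linear_map A A (\<lambda>x. a \<otimes> x)"
  by unfold_locales (simp_all add: M.r_distr)

lemma (in k_algebra) linear_mult_right: "a \<in> carrier A \<Longrightarrow> linear_map A A (\<lambda>x. x \<otimes> a)"
  by unfold_locales (simp_all add: M.l_distr)

lemma linear_map_comp:
  assumes "linear_map A B f" and "linear_map B C g"
  shows "linear_map A C (\<lambda>x. g (f x))"
proof -
  interpret f: linear_map A B f by fact
  interpret g: linear_map B C g by fact
  show ?thesis by unfold_locales simp_all
qed

lemma (in k_algebra) twist_sum_closed [simp]:
  assumes "\<And>i j. g i j \<in> carrier A"
  shows "twist_sum n q A g \<in> carrier A"
  using assms by (simp add: twist_sum_def)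

lemma (in linear_map) twist_sum:
  assumes "\<And>i j. g i j \<in> carrier A"
  shows "f (twist_sum n q A g) = twist_sum n q B (\<lambda>i j. f (g i j))"
  using assms by (simp add: twist_sum_def finsum)

section \<open>Monoid algebras\<close>

lemma lookup_scale: "Poly_Mapping.lookup (Poly_Mapping.map ((*) c) f) s = c * Poly_Mapping.lookup f s"
  for c :: "'k::field"
  by (simp add: Poly_Mapping.map.rep_eq when_def)

lemma map_scale_single [simp]:
  "Poly_Mapping.map ((*) c) (Poly_Mapping.single s d) = Poly_Mapping.single s (c * d)"
  for c :: "'k::field"
  by (rule poly_mapping_eqI) (simp add: lookup_scale lookup_single when_def)

lemma keys_scale: "Poly_Mapping.keys (Poly_Mapping.map ((*) c) f) \<subseteq> Poly_Mapping.keys f"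
  for c :: "'k::field"
  by (auto simp: in_keys_iff lookup_scale)

text \<open>One key of the support is peeled off at a time. The bound \<open>U\<close> keeps every
  stage inside the carrier, which the step may therefore assume.\<close>

lemma poly_mapping_single_induct [consumes 1, case_names zero add]:
  fixes f :: "'s \<Rightarrow>\<^sub>0 'k::ab_group_add"
  assumes "Poly_Mapping.keys f \<subseteq> U"
    and "P 0"
    and step: "\<And>s c f. \<lbrakk>s \<in> U; Poly_Mapping.keys f \<subseteq> U; P f\<rbrakk> \<Longrightarrow> P (Poly_Mapping.single s c + f)"
  shows "P f"
  using assms(1)
proof (induct "card (Poly_Mapping.keys f)" arbitrary: f)
  case 0
  then show ?case using assms(2) by simp
next
  case (Suc n)
  then obtain s where s: "s \<in> Poly_Mapping.keys f" by fastforce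
  define g where "g = f - Poly_Mapping.single s (Poly_Mapping.lookup f s)"
  have keys: "Poly_Mapping.keys g = Poly_Mapping.keys f - {s}"
    by (auto simp: g_def in_keys_iff lookup_minus lookup_single when_def split: if_splits)
  have "P g"
    using Suc s by (intro Suc(1)) (auto simp: keys)
  then have "P (Poly_Mapping.single s (Poly_Mapping.lookup f s) + g)"
    using Suc(3) s keys by (intro step) auto
  then show ?case by (simp add: g_def)
qed

text \<open>The product of \<open>monoid_algebra\<close> taken out of its record, so that its
  additivity can be proved for all finitely supported functions, free of carrier conditions.\<close>

definition monoid_conv ::
    "('s, 'm) monoid_scheme \<Rightarrow> ('s \<Rightarrow>\<^sub>0 'k::field) \<Rightarrow> ('s \<Rightarrow>\<^sub>0 'k) \<Rightarrow> 's \<Rightarrow>\<^sub>0 'k"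
  where "monoid_conv S f g = (\<Sum>s\<in>Poly_Mapping.keys f. \<Sum>t\<in>Poly_Mapping.keys g.
    Poly_Mapping.single (s \<otimes>\<^bsub>S\<^esub> t) (Poly_Mapping.lookup f s * Poly_Mapping.lookup g t))"

text \<open>Summation may run over any finite sets containing the supports. This is what additivity
  rests on, because cancellation can make the support of a sum smaller than the union of the
  supports.\<close>

lemma monoid_conv_supset:
  assumes "finite K" "finite L" "Poly_Mapping.keys f \<subseteq> K" "Poly_Mapping.keys g \<subseteq> L"
  shows "monoid_conv S f g = (\<Sum>s\<in>K. \<Sum>t\<in>L.
    Poly_Mapping.single (s \<otimes>\<^bsub>S\<^esub> t) (Poly_Mapping.lookup f s * Poly_Mapping.lookup g t))"
proof -
  have "(\<Sum>t\<in>Poly_Mapping.keys g. Poly_Mapping.single (s \<otimes>\<^bsub>S\<^esub> t) (Poly_Mapping.lookup f s * Poly_Mapping.lookup g t))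
      = (\<Sum>t\<in>L. Poly_Mapping.single (s \<otimes>\<^bsub>S\<^esub> t) (Poly_Mapping.lookup f s * Poly_Mapping.lookup g t))" for s
    by (rule sum.mono_neutral_left) (use assms in \<open>auto simp: in_keys_iff\<close>)
  then show ?thesis
    unfolding monoid_conv_def
    by (simp only:) (rule sum.mono_neutral_left, use assms in \<open>auto simp: in_keys_iff\<close>)
qed

lemma monoid_conv_add_left: "monoid_conv S (f + f') g = monoid_conv S f g + monoid_conv S f' g"
proof -
  let ?K = "Poly_Mapping.keys f \<union> Poly_Mapping.keys f'" and ?L = "Poly_Mapping.keys g"
  have "Poly_Mapping.keys (f + f') \<subseteq> ?K" by (rule keys_add)
  then show ?thesis
    by (simp add: monoid_conv_supset[of ?K ?L] lookup_add distrib_right single_add sum.distrib)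
qed

lemma monoid_conv_add_right: "monoid_conv S f (g + g') = monoid_conv S f g + monoid_conv S f g'"
proof -
  let ?K = "Poly_Mapping.keys g \<union> Poly_Mapping.keys g'" and ?L = "Poly_Mapping.keys f"
  have "Poly_Mapping.keys (g + g') \<subseteq> ?K" by (rule keys_add)
  then show ?thesis
    by (simp add: monoid_conv_supset[of ?L ?K] lookup_add distrib_left single_add sum.distrib)
qed

lemma monoid_conv_zero [simp]: "monoid_conv S 0 g = 0" "monoid_conv S f 0 = 0"
  by (simp_all add: monoid_conv_def)

lemma monoid_conv_single [simp]:
  "monoid_conv S (Poly_Mapping.single s c) (Poly_Mapping.single t d)
    = Poly_Mapping.single (s \<otimes>\<^bsub>S\<^esub> t) (c * d)"
  by (simp add: monoid_conv_supset[of "{s}" "{t}"])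

lemma map_scale_add:
  "Poly_Mapping.map ((*) c) (f + g) = Poly_Mapping.map ((*) c) f + Poly_Mapping.map ((*) c) g"
  for c :: "'k::field"
  by (rule poly_mapping_eqI) (simp add: lookup_scale lookup_add distrib_left)

lemma map_scale_zero [simp]: "Poly_Mapping.map ((*) c) 0 = 0" for c :: "'k::field"
  by (rule poly_mapping_eqI) (simp add: lookup_scale)

lemma monoid_algebra_simps:
  "carrier (monoid_algebra S) = {f. Poly_Mapping.keys f \<subseteq> carrier S}"
  "f \<otimes>\<^bsub>monoid_algebra S\<^esub> g = monoid_conv S f g"
  "\<one>\<^bsub>monoid_algebra S\<^esub> = Poly_Mapping.single \<one>\<^bsub>S\<^esub> 1"
  "\<zero>\<^bsub>monoid_algebra S\<^esub> = 0"
  "f \<oplus>\<^bsub>monoid_algebra S\<^esub> g = f + g"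
  "c \<odot>\<^bsub>monoid_algebra S\<^esub> f = Poly_Mapping.map ((*) c) f"
  by (simp_all add: monoid_algebra_def monoid_conv_def)

text \<open>The laws on products are additive in every element involved, so induction on the
  supports brings them down to single basis elements, where they are laws of the monoid and of the
  field.\<close>

lemma (in Group.monoid) k_algebra_monoid_algebra:
  "k_algebra (monoid_algebra G :: ('k::field, 'a \<Rightarrow>\<^sub>0 'k) module)"
proof (rule k_algebraI[OF ringI])
  let ?M = "monoid_algebra G :: ('k::field, 'a \<Rightarrow>\<^sub>0 'k) module"
  have conv_closed: "Poly_Mapping.keys (monoid_conv G f g) \<subseteq> carrier G"
    if "Poly_Mapping.keys f \<subseteq> carrier G" "Poly_Mapping.keys g \<subseteq> carrier G" for f g :: "'a \<Rightarrow>\<^sub>0 'k"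
    using that
  proof (induct f rule: poly_mapping_single_induct)
    case (add s c f)
    have "Poly_Mapping.keys (monoid_conv G (Poly_Mapping.single s c) g) \<subseteq> carrier G"
      using add(4)
    proof (induct g rule: poly_mapping_single_induct)
      case (add t d g)
      have "Poly_Mapping.keys (Poly_Mapping.single (s \<otimes> t) (c * d) + monoid_conv G (Poly_Mapping.single s c) g)
        \<subseteq> Poly_Mapping.keys (Poly_Mapping.single (s \<otimes> t) (c * d)) \<union> Poly_Mapping.keys (monoid_conv G (Poly_Mapping.single s c) g)"
        by (rule keys_add)
      then show ?case
        using add \<open>s \<in> carrier G\<close> by (auto simp: monoid_conv_add_right split: if_splits)
    qed simp
    moreover have "Poly_Mapping.keys (monoid_conv G (Poly_Mapping.single s c) g + monoid_conv G f g)
        \<subseteq> Poly_Mapping.keys (monoid_conv G (Poly_Mapping.single s c) g) \<union> Poly_Mapping.keys (monoid_conv G f g)"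
      by (rule keys_add)
    ultimately show ?case
      using add by (auto simp: monoid_conv_add_left)
  qed simp
  show "abelian_group ?M"
  proof (rule abelian_groupI, goal_cases)
    case (6 x)
    then show ?case
      by (intro bexI[of _ "-x"]) (simp_all add: monoid_algebra_simps keys_def)
  qed (use keys_add in \<open>force simp: monoid_algebra_simps algebra_simps\<close>)+
  show "Group.monoid ?M"
  proof (rule monoidI, goal_cases)
    case (3 x y z)
    from 3 have "monoid_conv G (monoid_conv G x y) z = monoid_conv G x (monoid_conv G y z)"
      unfolding monoid_algebra_simps mem_Collect_eq
    proof (induct x rule: poly_mapping_single_induct)
      case (add s c f)
      have "monoid_conv G (monoid_conv G (Poly_Mapping.single s c) y) z
          = monoid_conv G (Poly_Mapping.single s c) (monoid_conv G y z)"
        using add(4)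
      proof (induct y rule: poly_mapping_single_induct)
        case (add t d y)
        have "monoid_conv G (Poly_Mapping.single (s \<otimes> t) (c * d)) z
          = monoid_conv G (Poly_Mapping.single s c) (monoid_conv G (Poly_Mapping.single t d) z)"
          using \<open>Poly_Mapping.keys z \<subseteq> carrier G\<close>
          by (induct z rule: poly_mapping_single_induct)
             (use \<open>s \<in> carrier G\<close> \<open>t \<in> carrier G\<close> in \<open>auto simp: monoid_conv_add_right m_assoc mult.assoc\<close>)
        then show ?case
          using add by (simp add: monoid_conv_add_left monoid_conv_add_right)
      qed simp
      with add show ?case by (simp add: monoid_conv_add_left)
    qed simp
    then show ?case by (simp add: monoid_algebra_simps)
  next
    case (4 x)
    then show ?case
      unfolding monoid_algebra_simps mem_Collect_eq
      by (induct x rule: poly_mapping_single_induct) (auto simp: monoid_conv_add_right)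
  next
    case (5 x)
    then show ?case
      unfolding monoid_algebra_simps mem_Collect_eq
      by (induct x rule: poly_mapping_single_induct) (auto simp: monoid_conv_add_left)
  qed (auto simp: monoid_algebra_simps dest: subsetD[OF conv_closed])
  fix c d :: 'k and x y :: "'a \<Rightarrow>\<^sub>0 'k"
  assume x: "x \<in> carrier ?M" and y: "y \<in> carrier ?M"
  show "c \<odot>\<^bsub>?M\<^esub> x \<in> carrier ?M"
    using x keys_scale[of c x] by (auto simp: monoid_algebra_simps)
  show "(c \<odot>\<^bsub>?M\<^esub> x) \<otimes>\<^bsub>?M\<^esub> y = c \<odot>\<^bsub>?M\<^esub> (x \<otimes>\<^bsub>?M\<^esub> y)"
    using x y unfolding monoid_algebra_simps mem_Collect_eq
  proof (induct x rule: poly_mapping_single_induct)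
    case (add s a f)
    have "monoid_conv G (Poly_Mapping.single s (c * a)) y
        = Poly_Mapping.map ((*) c) (monoid_conv G (Poly_Mapping.single s a) y)"
      using add(4)
      by (induct y rule: poly_mapping_single_induct)
         (auto simp: monoid_conv_add_right map_scale_add mult.assoc)
    with add show ?case by (simp add: map_scale_add monoid_conv_add_left)
  qed simp
  show "x \<otimes>\<^bsub>?M\<^esub> (c \<odot>\<^bsub>?M\<^esub> y) = c \<odot>\<^bsub>?M\<^esub> (x \<otimes>\<^bsub>?M\<^esub> y)"
    using x y unfolding monoid_algebra_simps mem_Collect_eq
  proof (induct x rule: poly_mapping_single_induct)
    case (add s a f)
    have "monoid_conv G (Poly_Mapping.single s a) (Poly_Mapping.map ((*) c) y)
        = Poly_Mapping.map ((*) c) (monoid_conv G (Poly_Mapping.single s a) y)"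
      using add(4)
      by (induct y rule: poly_mapping_single_induct)
         (auto simp: monoid_conv_add_right map_scale_add mult.left_commute)
    with add show ?case by (simp add: map_scale_add monoid_conv_add_left)
  qed simp
qed (auto simp: monoid_algebra_simps monoid_conv_add_left monoid_conv_add_right map_scale_add
      lookup_scale lookup_add algebra_simps intro!: poly_mapping_eqI)

subsection \<open>Linear extensions of maps on the basis\<close>

context k_algebra
begin

lemma linear_extension_supset:
  assumes "finite K" "Poly_Mapping.keys f \<subseteq> K" "\<phi> \<in> K \<rightarrow> carrier A"
  shows "linear_extension A \<phi> f = (\<Oplus>s\<in>K. Poly_Mapping.lookup f s \<odot> \<phi> s)"
  unfolding linear_extension_def
  by (rule M.add.finprod_mono_neutral_cong_left)
     (use assms in \<open>auto simp: in_keys_iff Pi_def\<close>)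

lemma linear_extension_closed:
  assumes "Poly_Mapping.keys f \<subseteq> U" "\<phi> \<in> U \<rightarrow> carrier A"
  shows "linear_extension A \<phi> f \<in> carrier A"
  unfolding linear_extension_def by (rule M.finsum_closed) (use assms in auto)

lemma linear_extension_add:
  assumes "Poly_Mapping.keys f \<subseteq> U" "Poly_Mapping.keys g \<subseteq> U" "\<phi> \<in> U \<rightarrow> carrier A"
  shows "linear_extension A \<phi> (f + g) = linear_extension A \<phi> f \<oplus> linear_extension A \<phi> g"
proof -
  let ?K = "Poly_Mapping.keys f \<union> Poly_Mapping.keys g"
  have *: "Poly_Mapping.keys (f + g) \<subseteq> ?K" by (rule keys_add)
  have \<phi>: "\<phi> \<in> ?K \<rightarrow> carrier A" using assms by auto
  then have "(\<lambda>s. Poly_Mapping.lookup h s \<odot> \<phi> s) \<in> ?K \<rightarrow> carrier A" for h :: "'b \<Rightarrow>\<^sub>0 'k"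
    by (auto simp: Pi_def)
  moreover have "(\<Oplus>s\<in>?K. Poly_Mapping.lookup (f + g) s \<odot> \<phi> s)
      = (\<Oplus>s\<in>?K. Poly_Mapping.lookup f s \<odot> \<phi> s \<oplus> Poly_Mapping.lookup g s \<odot> \<phi> s)"
    by (rule M.finsum_cong') (use \<phi> in \<open>auto simp: lookup_add smult_add_left Pi_def\<close>)
  moreover have "linear_extension A \<phi> f = (\<Oplus>s\<in>?K. Poly_Mapping.lookup f s \<odot> \<phi> s)"
      "linear_extension A \<phi> g = (\<Oplus>s\<in>?K. Poly_Mapping.lookup g s \<odot> \<phi> s)"
    by (auto intro!: linear_extension_supset[OF _ _ \<phi>])
  ultimately show ?thesis
    by (simp add: linear_extension_supset[OF _ * \<phi>] M.finsum_addf)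
qed

lemma linear_extension_scale:
  assumes "Poly_Mapping.keys f \<subseteq> U" "\<phi> \<in> U \<rightarrow> carrier A"
  shows "linear_extension A \<phi> (Poly_Mapping.map ((*) c) f) = c \<odot> linear_extension A \<phi> f"
proof -
  let ?K = "Poly_Mapping.keys f"
  have \<phi>: "\<phi> \<in> ?K \<rightarrow> carrier A" using assms by auto
  have "(\<Oplus>s\<in>?K. Poly_Mapping.lookup (Poly_Mapping.map ((*) c) f) s \<odot> \<phi> s)
      = (\<Oplus>s\<in>?K. c \<odot> (Poly_Mapping.lookup f s \<odot> \<phi> s))"
    by (rule M.finsum_cong') (use \<phi> in \<open>auto simp: lookup_scale Pi_def\<close>)
  also have "\<dots> = c \<odot> (\<Oplus>s\<in>?K. Poly_Mapping.lookup f s \<odot> \<phi> s)"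
    by (rule smult_finsum[symmetric]) (use \<phi> in auto)
  finally show ?thesis
    by (simp add: linear_extension_supset[OF _ keys_scale \<phi>] linear_extension_supset[of ?K f] \<phi>)
qed

lemma linear_extension_single:
  "\<phi> s \<in> carrier A \<Longrightarrow> linear_extension A \<phi> (Poly_Mapping.single s c) = c \<odot> \<phi> s"
  by (subst linear_extension_supset[of "{s}"]) auto

end

text \<open>The common setting of free algebras, where \<open>S\<close> consists of words, and of
  tensor products, where \<open>S\<close> consists of pairs.\<close>

locale monoid_algebra_over = S: Group.monoid S for S :: "('s, 'm) monoid_scheme" +
  fixes M :: "('k::field, 's \<Rightarrow>\<^sub>0 'k) module"
  defines "M \<equiv> monoid_algebra S"
begin

sublocale M: k_algebra M
  unfolding M_def by (rule S.k_algebra_monoid_algebra)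

lemma single_closed [simp, intro]: "s \<in> carrier S \<Longrightarrow> Poly_Mapping.single s c \<in> carrier M"
  by (auto simp: M_def monoid_algebra_simps)

lemma single_mult [simp]:
  "Poly_Mapping.single s c \<otimes>\<^bsub>M\<^esub> Poly_Mapping.single t d = Poly_Mapping.single (s \<otimes>\<^bsub>S\<^esub> t) (c * d)"
  by (simp add: M_def monoid_algebra_simps)

lemma one_eq: "\<one>\<^bsub>M\<^esub> = Poly_Mapping.single \<one>\<^bsub>S\<^esub> 1"
  by (simp add: M_def monoid_algebra_simps)

lemma single_smult [simp]: "c \<odot>\<^bsub>M\<^esub> Poly_Mapping.single s d = Poly_Mapping.single s (c * d)"
  by (simp add: M_def monoid_algebra_simps)

lemma add_eq: "f \<oplus>\<^bsub>M\<^esub> g = f + g"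
  by (simp add: M_def monoid_algebra_simps)

lemma diff_eq: "\<lbrakk>f \<in> carrier M; g \<in> carrier M\<rbrakk> \<Longrightarrow> f \<ominus>\<^bsub>M\<^esub> g = f - g"
  using M.add.inv_solve_right[of "f - g" f g]
  by (simp add: a_minus_def) (metis M.M.add.inv_closed M.M.add.m_closed M.M.minus_add M.M.r_neg2 add_diff_cancel_left' add_eq M.M.a_comm M.M.add.inv_inv)

lemma induct [consumes 1, case_names zero add]:
  assumes "f \<in> carrier M" and "P \<zero>\<^bsub>M\<^esub>"
    and step: "\<And>s c f. \<lbrakk>s \<in> carrier S; f \<in> carrier M; P f\<rbrakk> \<Longrightarrow> P (Poly_Mapping.single s c \<oplus>\<^bsub>M\<^esub> f)"
  shows "P f"
  using assms unfolding M_def monoid_algebra_simps mem_Collect_eq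
  by (rule poly_mapping_single_induct)

lemma linear_extension:
  assumes "k_algebra B" and \<phi>: "\<phi> \<in> carrier S \<rightarrow> carrier B"
  shows "linear_map M B (linear_extension B \<phi>)"
proof -
  interpret B: k_algebra B by fact
  show ?thesis
    by unfold_locales
       (auto simp: M_def monoid_algebra_simps \<phi> B.linear_extension_add[of _ "carrier S"]
          B.linear_extension_scale[of _ "carrier S"] B.linear_extension_closed[of _ "carrier S"])
qed

lemma hom_extension:
  assumes "k_algebra B" and \<phi>: "\<phi> \<in> carrier S \<rightarrow> carrier B"
    and mult: "\<And>s t. \<lbrakk>s \<in> carrier S; t \<in> carrier S\<rbrakk> \<Longrightarrow> \<phi> (s \<otimes>\<^bsub>S\<^esub> t) = \<phi> s \<otimes>\<^bsub>B\<^esub> \<phi> t"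
    and one: "\<phi> \<one>\<^bsub>S\<^esub> = \<one>\<^bsub>B\<^esub>"
  shows "algebra_hom M B (linear_extension B \<phi>)"
proof (intro algebra_hom.intro algebra_hom_axioms.intro)
  show lin: "linear_map M B (linear_extension B \<phi>)"
    using assms(1) \<phi> by (rule linear_extension)
  interpret l: linear_map M B "linear_extension B \<phi>" by (rule lin)
  note \<phi> = \<phi>[THEN funcset_mem]
  have single: "linear_extension B \<phi> (Poly_Mapping.single s c) = c \<odot>\<^bsub>B\<^esub> \<phi> s" if "s \<in> carrier S" for s c
    using that by (intro l.B.linear_extension_single \<phi>)
  show "linear_extension B \<phi> \<one>\<^bsub>M\<^esub> = \<one>\<^bsub>B\<^esub>"
    by (simp add: one_eq single one)
  fix x y
  assume "x \<in> carrier M" and y: "y \<in> carrier M"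
  then show "linear_extension B \<phi> (x \<otimes>\<^bsub>M\<^esub> y) = linear_extension B \<phi> x \<otimes>\<^bsub>B\<^esub> linear_extension B \<phi> y"
  proof (induct x rule: induct)
    case (add s c x)
    have "linear_extension B \<phi> (Poly_Mapping.single s c \<otimes>\<^bsub>M\<^esub> y) = (c \<odot>\<^bsub>B\<^esub> \<phi> s) \<otimes>\<^bsub>B\<^esub> linear_extension B \<phi> y"
      using y
    proof (induct y rule: induct)
      case (add t d y)
      then show ?case
        using \<open>s \<in> carrier S\<close>
        by (simp add: M.M.r_distr l.B.M.r_distr single mult \<phi> l.B.smult_add_right mult.commute)
    qed (simp add: \<open>s \<in> carrier S\<close> \<phi>)
    with add show ?case
      using y by (simp add: M.M.l_distr l.B.M.l_distr single \<phi>)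
  qed (use y in simp)
qed

end

section \<open>Quotients of monoid algebras\<close>

lemma quotient_algebra_simps:
  "carrier (quotient_algebra A I) = carrier (A Quot I)"
  "monoid.mult (quotient_algebra A I) = monoid.mult (A Quot I)"
  "one (quotient_algebra A I) = one (A Quot I)"
  "zero (quotient_algebra A I) = zero (A Quot I)"
  "add (quotient_algebra A I) = add (A Quot I)"
  "module.smult (quotient_algebra A I) = (\<lambda>c Y. \<Union>y\<in>Y. I +>\<^bsub>A\<^esub> (c \<odot>\<^bsub>A\<^esub> y))"
  by (simp_all add: quotient_algebra_def ring.extend_def module.fields_def)

lemma algebra_homI:
  assumes "linear_map A B f"
    and "\<And>x y. \<lbrakk>x \<in> carrier A; y \<in> carrier A\<rbrakk> \<Longrightarrow> f (x \<otimes>\<^bsub>A\<^esub> y) = f x \<otimes>\<^bsub>B\<^esub> f y"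
    and "f \<one>\<^bsub>A\<^esub> = \<one>\<^bsub>B\<^esub>"
  shows "algebra_hom A B f"
  using assms by (simp add: algebra_hom_def algebra_hom_axioms_def)

text \<open>That the quotient is an algebra over the field is contained in the first conclusion,
  since \<open>algebra_hom\<close> includes \<open>k_algebra\<close> of its target. Every law is
  checked on representatives.\<close>

lemma (in k_algebra) quotient_hom:
  assumes "ideal I A"
  shows "algebra_hom A (quotient_algebra A I) (\<lambda>x. I +> x)"
    and "Y \<in> carrier (quotient_algebra A I) \<Longrightarrow> \<exists>x\<in>carrier A. Y = I +> x"
proof -
  interpret I: ideal I A by fact
  let ?Q = "quotient_algebra A I"
  have surj: "\<exists>x\<in>carrier A. Y = I +> x" if "Y \<in> carrier ?Q" for Y
    using that by (auto simp: quotient_algebra_simps FactRing_simps)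
  then show "Y \<in> carrier ?Q \<Longrightarrow> \<exists>x\<in>carrier A. Y = I +> x" .
  have closed: "I +> x \<in> carrier ?Q" if "x \<in> carrier A" for x
    using that by (auto simp: quotient_algebra_simps FactRing_simps)
  have smult: "c \<odot>\<^bsub>?Q\<^esub> (I +> x) = I +> (c \<odot> x)" if x: "x \<in> carrier A" for c x
  proof -
    have "I +> (c \<odot> y) = I +> (c \<odot> x)" if y: "y \<in> I +> x" for y
    proof -
      from y obtain h where h: "h \<in> I" "y = h \<oplus> x"
        by (auto simp: a_r_coset_def')
      then have hA: "h \<in> carrier A" by (simp add: I.Icarr)
      \<comment> \<open>An ideal is stable under ring multiplication; stability under scalars
        follows by letting \<open>c\<close> act as multiplication by \<open>c\<close> times the
        unit. So the union defining the scalar multiplication of the quotient collapses to a single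
        coset.\<close>
      have "(c \<odot> \<one>) \<otimes> h \<in> I" using h by (intro I.I_l_closed) simp_all
      then have "c \<odot> h \<in> I" using hA by simp
      moreover have "c \<odot> y = c \<odot> h \<oplus> c \<odot> x" using h hA x by (simp add: smult_add_right)
      ultimately have "c \<odot> y \<in> I +> (c \<odot> x)" by (auto simp: a_r_coset_def')
      then show ?thesis
        using x M.a_repr_independence[OF _ _ I.a_subgroup, of "c \<odot> y" "c \<odot> x"] by simp
    qed
    moreover have "x \<in> I +> x" using x by (rule I.a_rcos_self)
    ultimately show ?thesis unfolding quotient_algebra_simps by blast
  qed
  have ring: "ring ?Q"
    by (rule ring_cong[OF I.quotient_is_ring]) (simp_all add: quotient_algebra_simps)
  have add: "I +> (x \<oplus> y) = (I +> x) \<oplus>\<^bsub>?Q\<^esub> (I +> y)" if "x \<in> carrier A" "y \<in> carrier A" for x y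
    using that ring_hom_add[OF I.rcos_ring_hom] by (simp add: quotient_algebra_simps)
  have mult: "I +> (x \<otimes> y) = (I +> x) \<otimes>\<^bsub>?Q\<^esub> (I +> y)" if "x \<in> carrier A" "y \<in> carrier A" for x y
    using that ring_hom_mult[OF I.rcos_ring_hom] by (simp add: quotient_algebra_simps)
  have one: "I +> \<one> = \<one>\<^bsub>?Q\<^esub>"
    using ring_hom_one[OF I.rcos_ring_hom] by (simp add: quotient_algebra_simps)
  have "k_algebra ?Q"
  proof (rule k_algebraI[OF ring], goal_cases)
    case (1 c x)
    then obtain x' where "x' \<in> carrier A" "x = I +> x'" using surj by blast
    then show ?case by (simp add: smult closed)
  next
    case (2 c d x)
    then obtain x' where "x' \<in> carrier A" "x = I +> x'" using surj by blast
    then show ?case by (simp add: smult add[symmetric] smult_add_left)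
  next
    case (3 c x y)
    then obtain x' y' where "x' \<in> carrier A" "x = I +> x'" "y' \<in> carrier A" "y = I +> y'"
      using surj by metis
    then show ?case by (simp add: smult add[symmetric] smult_add_right)
  next
    case (4 c d x)
    then obtain x' where "x' \<in> carrier A" "x = I +> x'" using surj by blast
    then show ?case by (simp add: smult)
  next
    case (5 x)
    then obtain x' where "x' \<in> carrier A" "x = I +> x'" using surj by blast
    then show ?case by (simp add: smult)
  next
    case (6 c x y)
    then obtain x' y' where "x' \<in> carrier A" "x = I +> x'" "y' \<in> carrier A" "y = I +> y'"
      using surj by metis
    then show ?case by (simp add: smult mult[symmetric])
  next
    case (7 c x y)
    then obtain x' y' where "x' \<in> carrier A" "x = I +> x'" "y' \<in> carrier A" "y = I +> y'"
      using surj by metis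
    then show ?case by (simp add: smult mult[symmetric])
  qed
  then interpret Q: k_algebra ?Q .
  show "algebra_hom A ?Q (\<lambda>x. I +> x)"
    by unfold_locales (simp_all add: closed smult add mult one)
qed

locale monoid_algebra_quotient = monoid_algebra_over S M
  for S :: "('s, 'm) monoid_scheme" and M :: "('k::field, 's \<Rightarrow>\<^sub>0 'k) module" +
  fixes R :: "('s \<Rightarrow>\<^sub>0 'k) set" and Q :: "('k, ('s \<Rightarrow>\<^sub>0 'k) set) module"
    and cls :: "'s \<Rightarrow> ('s \<Rightarrow>\<^sub>0 'k) set"
  assumes R_subset: "R \<subseteq> carrier M"
  defines "Q \<equiv> quotient_algebra M (Idl\<^bsub>M\<^esub> R)"
    and "cls \<equiv> (\<lambda>s. Idl\<^bsub>M\<^esub> R +>\<^bsub>M\<^esub> Poly_Mapping.single s 1)"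
begin

abbreviation "I \<equiv> Idl\<^bsub>M\<^esub> R"
abbreviation "proj x \<equiv> I +>\<^bsub>M\<^esub> x"

sublocale I: ideal I M
  using R_subset by (rule M.M.genideal_ideal)

sublocale Q: k_algebra Q
  unfolding Q_def
  using algebra_hom.axioms(1)[OF M.quotient_hom(1)[OF I.is_ideal], THEN linear_map.axioms(2)] .

sublocale proj: algebra_hom M Q proj
  unfolding Q_def by (rule M.quotient_hom) (rule I.is_ideal)

lemma proj_surj: "Y \<in> carrier Q \<Longrightarrow> \<exists>x\<in>carrier M. Y = proj x"
  unfolding Q_def by (rule M.quotient_hom) (rule I.is_ideal)

lemma cls_closed [simp, intro]: "s \<in> carrier S \<Longrightarrow> cls s \<in> carrier Q"
  unfolding cls_def by auto

lemma proj_single: "s \<in> carrier S \<Longrightarrow> proj (Poly_Mapping.single s c) = c \<odot>\<^bsub>Q\<^esub> cls s"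
  unfolding cls_def using proj.smult[of "Poly_Mapping.single s 1" c] by simp

lemma cls_mult: "\<lbrakk>s \<in> carrier S; t \<in> carrier S\<rbrakk> \<Longrightarrow> cls s \<otimes>\<^bsub>Q\<^esub> cls t = cls (s \<otimes>\<^bsub>S\<^esub> t)"
  unfolding cls_def using proj.mult[of "Poly_Mapping.single s 1" "Poly_Mapping.single t 1"] by simp

lemma cls_one: "\<one>\<^bsub>Q\<^esub> = cls \<one>\<^bsub>S\<^esub>"
  unfolding cls_def using proj.one by (simp add: one_eq)

lemma proj_ideal: "f \<in> I \<Longrightarrow> proj f = \<zero>\<^bsub>Q\<^esub>"
  unfolding Q_def quotient_algebra_simps FactRing_def ring.simps
  by (rule M.M.a_coset_join2[OF I.Icarr I.a_subgroup])

lemma proj_eqI: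
  assumes "f \<in> carrier M" "g \<in> carrier M" "f - g \<in> R"
  shows "proj f = proj g"
proof -
  have "f \<ominus>\<^bsub>M\<^esub> g \<in> I"
    using assms M.M.genideal_self[OF R_subset] by (auto simp: diff_eq)
  then have "proj f \<ominus>\<^bsub>Q\<^esub> proj g = \<zero>\<^bsub>Q\<^esub>"
    unfolding proj.diff[OF assms(1,2), symmetric] by (rule proj_ideal)
  then show ?thesis
    using assms by (simp add: Q.M.r_right_minus_eq)
qed

lemma quotient_induct [consumes 1, case_names zero add]:
  assumes "Y \<in> carrier Q" and "P \<zero>\<^bsub>Q\<^esub>"
    and step: "\<And>s c Y. \<lbrakk>s \<in> carrier S; Y \<in> carrier Q; P Y\<rbrakk> \<Longrightarrow> P (c \<odot>\<^bsub>Q\<^esub> cls s \<oplus>\<^bsub>Q\<^esub> Y)"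
  shows "P Y"
proof -
  obtain x where x: "x \<in> carrier M" "Y = proj x"
    using assms(1) proj_surj by blast
  from x(1) have "P (proj x)"
    by (induct x rule: induct) (use assms(2) step in \<open>simp_all add: proj_single\<close>)
  with x(2) show ?thesis by simp
qed

text \<open>The classes of basis elements span the quotient. Identities between operators on quantum
  polynomials are thereby reduced to words.\<close>

lemma quotient_linear_map_eqI:
  assumes "linear_map Q B f" "linear_map Q B g"
    and "\<And>s. s \<in> carrier S \<Longrightarrow> f (cls s) = g (cls s)"
    and "x \<in> carrier Q"
  shows "f x = g x"
proof -
  interpret f: linear_map Q B f by fact
  interpret g: linear_map Q B g by fact
  show ?thesis
    using assms(4) by (induct x rule: quotient_induct) (simp_all add: assms(3))
qed

end

text \<open>Here \<phi> is an arbitrary map on the basis, multiplicative or not: the lift is also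
  applied to bilinear maps on tensor products and to monomial operators on quantum polynomials. The
  price is that each relation has to be killed between any two basis elements.\<close>

locale monoid_algebra_quotient_lift = monoid_algebra_quotient S M R Q cls + B: k_algebra B
  for S :: "('s, 'm) monoid_scheme" and M :: "('k::field, 's \<Rightarrow>\<^sub>0 'k) module"
    and R Q cls and B :: "('k, 'b, 'n) module_scheme" +
  fixes \<phi> :: "'s \<Rightarrow> 'b"
  assumes \<phi>_closed: "\<phi> \<in> carrier S \<rightarrow> carrier B"
    and kills: "\<lbrakk>s \<in> carrier S; t \<in> carrier S; \<rho> \<in> R\<rbrakk> \<Longrightarrow> linear_extension B \<phi>
      (Poly_Mapping.single s 1 \<otimes>\<^bsub>M\<^esub> \<rho> \<otimes>\<^bsub>M\<^esub> Poly_Mapping.single t 1) = \<zero>\<^bsub>B\<^esub>"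
begin

definition "lift Y = the_elem (linear_extension B \<phi> ` Y)"

sublocale ext: linear_map M B "linear_extension B \<phi>"
  by (rule linear_extension) (rule B.k_algebra_axioms, rule \<phi>_closed)

lemma ext_single: "s \<in> carrier S \<Longrightarrow> linear_extension B \<phi> (Poly_Mapping.single s c) = c \<odot>\<^bsub>B\<^esub> \<phi> s"
  using \<phi>_closed by (intro B.linear_extension_single) auto

text \<open>
  The kernel of a linear extension need not be an ideal, but the largest ideal contained in it is
  determined by products with basis elements on both sides.
\<close>

lemma kills_ideal:
  assumes "f \<in> I"
  shows "linear_extension B \<phi> f = \<zero>\<^bsub>B\<^esub>"
proof -
  let ?J = "{f \<in> carrier M. \<forall>g\<in>carrier M. \<forall>h\<in>carrier M.
    linear_extension B \<phi> (g \<otimes>\<^bsub>M\<^esub> f \<otimes>\<^bsub>M\<^esub> h) = \<zero>\<^bsub>B\<^esub>}"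
  have neg: "\<ominus>\<^bsub>M\<^esub> a \<in> ?J" if "a \<in> ?J" for a
    using that by (simp add: M.M.l_minus M.M.r_minus)
  have add: "a \<oplus>\<^bsub>M\<^esub> b \<in> ?J" if "a \<in> ?J" "b \<in> ?J" for a b
    using that by (simp add: M.M.l_distr M.M.r_distr)
  have "ideal ?J M"
  proof (rule idealI[OF M.M.ring_axioms])
    show "subgroup ?J (add_monoid M)"
    proof (rule M.M.add.subgroupI)
      have "\<zero>\<^bsub>M\<^esub> \<in> ?J" by simp
      then show "?J \<noteq> {}" by blast
    qed (use neg add in \<open>simp_all only: a_inv_def, auto\<close>)
  next
    fix a x
    assume ax: "a \<in> ?J" "x \<in> carrier M"
    have "linear_extension B \<phi> (g \<otimes>\<^bsub>M\<^esub> (x \<otimes>\<^bsub>M\<^esub> a) \<otimes>\<^bsub>M\<^esub> h) = \<zero>\<^bsub>B\<^esub>"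
      if "g \<in> carrier M" "h \<in> carrier M" for g h
    proof -
      have "g \<otimes>\<^bsub>M\<^esub> (x \<otimes>\<^bsub>M\<^esub> a) \<otimes>\<^bsub>M\<^esub> h = (g \<otimes>\<^bsub>M\<^esub> x) \<otimes>\<^bsub>M\<^esub> a \<otimes>\<^bsub>M\<^esub> h"
        using ax that by (simp add: M.M.m_assoc)
      then show ?thesis using ax that by simp
    qed
    then show "x \<otimes>\<^bsub>M\<^esub> a \<in> ?J" using ax by simp
    have "linear_extension B \<phi> (g \<otimes>\<^bsub>M\<^esub> (a \<otimes>\<^bsub>M\<^esub> x) \<otimes>\<^bsub>M\<^esub> h) = \<zero>\<^bsub>B\<^esub>"
      if "g \<in> carrier M" "h \<in> carrier M" for g h
    proof -
      have "g \<otimes>\<^bsub>M\<^esub> (a \<otimes>\<^bsub>M\<^esub> x) \<otimes>\<^bsub>M\<^esub> h = g \<otimes>\<^bsub>M\<^esub> a \<otimes>\<^bsub>M\<^esub> (x \<otimes>\<^bsub>M\<^esub> h)"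
        using ax that by (simp add: M.M.m_assoc)
      then show ?thesis using ax that by simp
    qed
    then show "a \<otimes>\<^bsub>M\<^esub> x \<in> ?J" using ax by simp
  qed
  moreover have "R \<subseteq> ?J"
  proof
    fix \<rho> assume \<rho>: "\<rho> \<in> R"
    then have \<rho>M: "\<rho> \<in> carrier M" using R_subset by blast
    have "linear_extension B \<phi> (g \<otimes>\<^bsub>M\<^esub> \<rho> \<otimes>\<^bsub>M\<^esub> h) = \<zero>\<^bsub>B\<^esub>"
      if g: "g \<in> carrier M" and h: "h \<in> carrier M" for g h
      using g
    proof (induct g rule: induct)
      case (add s c g)
      have "linear_extension B \<phi> (Poly_Mapping.single s 1 \<otimes>\<^bsub>M\<^esub> \<rho> \<otimes>\<^bsub>M\<^esub> h) = \<zero>\<^bsub>B\<^esub>"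
        using h
      proof (induct h rule: induct)
        case (add t d h)
        have "linear_extension B \<phi> (Poly_Mapping.single s 1 \<otimes>\<^bsub>M\<^esub> \<rho> \<otimes>\<^bsub>M\<^esub> (d \<odot>\<^bsub>M\<^esub> Poly_Mapping.single t 1)) = \<zero>\<^bsub>B\<^esub>"
          using add \<open>s \<in> carrier S\<close> \<rho> \<rho>M
          by (simp add: kills del: single_smult)
        then show ?case
          using add \<open>s \<in> carrier S\<close> \<rho>M by (simp add: M.M.r_distr)
      qed (simp add: \<open>s \<in> carrier S\<close> \<rho>M)
      then have "linear_extension B \<phi> ((c \<odot>\<^bsub>M\<^esub> Poly_Mapping.single s 1) \<otimes>\<^bsub>M\<^esub> \<rho> \<otimes>\<^bsub>M\<^esub> h) = \<zero>\<^bsub>B\<^esub>"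
        using add \<rho>M h by (simp del: single_smult)
      then show ?case
        using add h \<rho>M by (simp add: M.M.l_distr)
    qed (simp add: \<rho>M h)
    then show "\<rho> \<in> ?J" using \<rho>M by simp
  qed
  ultimately have "I \<subseteq> ?J" by (rule M.M.genideal_minimal)
  then have f: "f \<in> carrier M" "linear_extension B \<phi> (\<one>\<^bsub>M\<^esub> \<otimes>\<^bsub>M\<^esub> f \<otimes>\<^bsub>M\<^esub> \<one>\<^bsub>M\<^esub>) = \<zero>\<^bsub>B\<^esub>"
    using assms by blast+
  then show ?thesis by simp
qed

text \<open>Representatives of one coset differ by an element of \<open>I\<close>, which the
  extension kills. The image of the coset is thus a singleton, and \<open>the_elem\<close> picks its
  member.\<close>

lemma lift_proj: "x \<in> carrier M \<Longrightarrow> lift (proj x) = linear_extension B \<phi> x"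
proof -
  assume x: "x \<in> carrier M"
  have "linear_extension B \<phi> y = linear_extension B \<phi> x" if "y \<in> proj x" for y
  proof -
    from that obtain h where h: "h \<in> I" "y = h \<oplus>\<^bsub>M\<^esub> x" by (auto simp: a_r_coset_def')
    then show ?thesis using x by (simp add: I.Icarr kills_ideal)
  qed
  then have "linear_extension B \<phi> ` proj x = {linear_extension B \<phi> x}"
    using I.a_rcos_self[OF x] by blast
  then show ?thesis by (simp add: lift_def)
qed

lemma linear_lift: "linear_map Q B lift"
proof (intro linear_map.intro linear_map_axioms.intro Q.k_algebra_axioms B.k_algebra_axioms)
  fix x c
  assume "x \<in> carrier Q"
  then obtain x' where x': "x' \<in> carrier M" "x = proj x'" using proj_surj by blast
  show "lift x \<in> carrier B"
    unfolding x'(2) lift_proj[OF x'(1)] using x'(1) by (rule ext.closed)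
  have "lift (c \<odot>\<^bsub>Q\<^esub> x) = linear_extension B \<phi> (c \<odot>\<^bsub>M\<^esub> x')"
    unfolding x'(2) proj.smult[OF x'(1), symmetric] by (rule lift_proj) (simp add: x'(1))
  then show "lift (c \<odot>\<^bsub>Q\<^esub> x) = c \<odot>\<^bsub>B\<^esub> lift x"
    unfolding x'(2) lift_proj[OF x'(1)] ext.smult[OF x'(1)] .
next
  fix x y
  assume "x \<in> carrier Q" "y \<in> carrier Q"
  then obtain x' y' where x': "x' \<in> carrier M" "x = proj x'" and y': "y' \<in> carrier M" "y = proj y'"
    using proj_surj by blast
  have "lift (x \<oplus>\<^bsub>Q\<^esub> y) = linear_extension B \<phi> (x' \<oplus>\<^bsub>M\<^esub> y')"
    unfolding x'(2) y'(2) proj.add[OF x'(1) y'(1), symmetric] by (rule lift_proj) (simp add: x'(1) y'(1))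
  then show "lift (x \<oplus>\<^bsub>Q\<^esub> y) = lift x \<oplus>\<^bsub>B\<^esub> lift y"
    unfolding x'(2) y'(2) lift_proj[OF x'(1)] lift_proj[OF y'(1)] ext.add[OF x'(1) y'(1)] .
qed

lemma lift_cls: "s \<in> carrier S \<Longrightarrow> lift (cls s) = \<phi> s"
  by (simp add: cls_def lift_proj ext_single \<phi>_closed[THEN funcset_mem])

lemma hom_lift:
  assumes mult: "\<And>s t. \<lbrakk>s \<in> carrier S; t \<in> carrier S\<rbrakk> \<Longrightarrow> \<phi> (s \<otimes>\<^bsub>S\<^esub> t) = \<phi> s \<otimes>\<^bsub>B\<^esub> \<phi> t"
    and one: "\<phi> \<one>\<^bsub>S\<^esub> = \<one>\<^bsub>B\<^esub>"
  shows "algebra_hom Q B lift"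
proof (rule algebra_homI[OF linear_lift])
  interpret e: algebra_hom M B "linear_extension B \<phi>"
    by (rule hom_extension[OF B.k_algebra_axioms \<phi>_closed mult one])
  show "lift \<one>\<^bsub>Q\<^esub> = \<one>\<^bsub>B\<^esub>"
    using lift_cls[OF S.one_closed] by (simp add: cls_one one)
  fix x y
  assume "x \<in> carrier Q" "y \<in> carrier Q"
  then obtain x' y' where x': "x' \<in> carrier M" "x = proj x'" and y': "y' \<in> carrier M" "y = proj y'"
    using proj_surj by blast
  have "lift (x \<otimes>\<^bsub>Q\<^esub> y) = linear_extension B \<phi> (x' \<otimes>\<^bsub>M\<^esub> y')"
    unfolding x'(2) y'(2) proj.mult[OF x'(1) y'(1), symmetric] by (rule lift_proj) (simp add: x'(1) y'(1))
  then show "lift (x \<otimes>\<^bsub>Q\<^esub> y) = lift x \<otimes>\<^bsub>B\<^esub> lift y"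
    unfolding x'(2) y'(2) lift_proj[OF x'(1)] lift_proj[OF y'(1)] e.mult[OF x'(1) y'(1)] .
qed

end

section \<open>Presented algebras\<close>

abbreviation word_monoid :: "'g set \<Rightarrow> 'g list monoid"
  where "word_monoid V \<equiv> \<lparr>carrier = lists V, monoid.mult = (@), one = []\<rparr>"

lemma monoid_word_monoid: "Group.monoid (word_monoid V)"
  by unfold_locales auto

locale presentation =
  fixes V :: "'g set" and rels :: "('g list \<Rightarrow>\<^sub>0 'k::field) set"
  assumes rels: "rels \<subseteq> carrier (free_algebra V)"
begin

sublocale S: Group.monoid "word_monoid V"
  by (rule monoid_word_monoid)

abbreviation "word w \<equiv> Idl\<^bsub>free_algebra V\<^esub> rels +>\<^bsub>free_algebra V\<^esub> Poly_Mapping.single w 1"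

sublocale monoid_algebra_quotient "word_monoid V" "free_algebra V" rels "presented_algebra V rels" word
  rewrites "carrier (word_monoid V) = lists V"
    and "s \<otimes>\<^bsub>word_monoid V\<^esub> t = s @ t"
    and "\<one>\<^bsub>word_monoid V\<^esub> = []"
  by unfold_locales (simp_all add: free_algebra_def presented_algebra_def rels[unfolded free_algebra_def])

abbreviation "gen \<equiv> presented_gen V rels"

lemma gen_eq: "gen g = word [g]"
  by (simp add: presented_gen_def free_var_def)

lemma gen_closed [simp, intro]: "g \<in> V \<Longrightarrow> gen g \<in> carrier (presented_algebra V rels)"
  by (simp add: gen_eq)

lemma word_Cons: "\<lbrakk>g \<in> V; w \<in> lists V\<rbrakk> \<Longrightarrow> word (g # w) = gen g \<otimes>\<^bsub>presented_algebra V rels\<^esub> word w"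
  using cls_mult[of "[g]" w] by (simp add: gen_eq)

end

context k_algebra
begin

definition "word_prod \<phi> w = foldr (\<lambda>g y. \<phi> g \<otimes> y) w \<one>"

lemma word_prod_simps [simp]:
  "word_prod \<phi> [] = \<one>"
  "word_prod \<phi> (g # w) = \<phi> g \<otimes> word_prod \<phi> w"
  by (simp_all add: word_prod_def)

lemma free_lift_eq: "free_lift A \<phi> = linear_extension A (word_prod \<phi>)"
  by (simp add: free_lift_def word_prod_def[abs_def])

context
  fixes V :: "'g set" and \<phi> :: "'g \<Rightarrow> 'a"
  assumes \<phi>: "\<And>g. g \<in> V \<Longrightarrow> \<phi> g \<in> carrier A"
begin

lemma word_prod_closed [simp, intro]: "w \<in> lists V \<Longrightarrow> word_prod \<phi> w \<in> carrier A"
  by (induct w) (auto simp: \<phi>)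

lemma word_prod_append:
  "\<lbrakk>v \<in> lists V; w \<in> lists V\<rbrakk> \<Longrightarrow> word_prod \<phi> (v @ w) = word_prod \<phi> v \<otimes> word_prod \<phi> w"
  by (induct v) (auto simp: \<phi> M.m_assoc)

text \<open>The free algebra is regarded as presented by no relations, which gives access to
  \<open>hom_extension\<close>.\<close>

interpretation free: presentation V "{} :: ('g list \<Rightarrow>\<^sub>0 'k) set"
  by unfold_locales simp

lemma free_lift_hom: "algebra_hom (free_algebra V) A (free_lift A \<phi>)"
  unfolding free_lift_eq
  by (rule free.hom_extension) (auto simp: word_prod_append k_algebra_axioms)

lemma free_lift_var: "g \<in> V \<Longrightarrow> free_lift A \<phi> (free_var g) = \<phi> g"
  by (simp add: free_lift_eq free_var_def linear_extension_single \<phi>)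

text \<open>The extension to the free algebra is multiplicative, so a relation sent to zero is still
  sent to zero when multiplied by words on both sides.\<close>

lemma presented_lift:
  assumes rels: "rels \<subseteq> carrier (free_algebra V)"
    and kills: "\<And>\<rho>. \<rho> \<in> rels \<Longrightarrow> free_lift A \<phi> \<rho> = \<zero>"
  shows presented_lift_hom: "algebra_hom (presented_algebra V rels) A (presented_lift A \<phi>)"
    and presented_lift_gen: "g \<in> V \<Longrightarrow> presented_lift A \<phi> (presented_gen V rels g) = \<phi> g"
proof -
  interpret presentation V rels by unfold_locales (rule rels)
  interpret free: algebra_hom "free_algebra V" A "free_lift A \<phi>" by (rule free_lift_hom)
  interpret l: monoid_algebra_quotient_lift "word_monoid V" "free_algebra V" rels "presented_algebra V rels" word A "word_prod \<phi>"
  proof unfold_locales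
    show "word_prod \<phi> \<in> carrier (word_monoid V) \<rightarrow> carrier A" by auto
    fix s t \<rho>
    assume st: "s \<in> carrier (word_monoid V)" "t \<in> carrier (word_monoid V)" and \<rho>: "\<rho> \<in> rels"
    have \<rho>F: "\<rho> \<in> carrier (free_algebra V)" using \<rho> rels by blast
    have single: "Poly_Mapping.single w (1::'k) \<in> carrier (free_algebra V)" if "w \<in> lists V" for w
      using that by simp
    show "linear_extension A (word_prod \<phi>)
        (Poly_Mapping.single s 1 \<otimes>\<^bsub>monoid_algebra (word_monoid V)\<^esub> \<rho>
          \<otimes>\<^bsub>monoid_algebra (word_monoid V)\<^esub> Poly_Mapping.single t 1) = \<zero>"
      unfolding free_lift_eq[symmetric] free_algebra_def[symmetric] using st single \<rho>F by (simp add: kills[OF \<rho>])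
  qed
  have lift: "presented_lift A \<phi> = l.lift"
    by (auto simp: l.lift_def presented_lift_def free_lift_eq)
  show "algebra_hom (presented_algebra V rels) A (presented_lift A \<phi>)"
    unfolding lift by (rule l.hom_lift) (auto simp: word_prod_append)
  show "g \<in> V \<Longrightarrow> presented_lift A \<phi> (presented_gen V rels g) = \<phi> g"
    unfolding lift by (simp add: gen_eq l.lift_cls \<phi>)
qed

end

end

section \<open>Tensor products\<close>

definition bilinear_map ::
    "('k::field, 'a, 'm) module_scheme \<Rightarrow> ('k, 'b, 'n) module_scheme \<Rightarrow>
      ('k, 'c, 'o) module_scheme \<Rightarrow> ('a \<Rightarrow> 'b \<Rightarrow> 'c) \<Rightarrow> bool"
  where "bilinear_map A B C \<beta> \<longleftrightarrow>
    (\<forall>a\<in>carrier A. linear_map B C (\<beta> a)) \<and> (\<forall>b\<in>carrier B. linear_map A C (\<lambda>a. \<beta> a b))"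

locale tensor_product = A: k_algebra A + B: k_algebra B
  for A :: "('k::field, 'a, 'm) module_scheme" and B :: "('k, 'b, 'n) module_scheme"
begin

sublocale S: Group.monoid "A \<times>\<times> B"
  by (rule DirProd_monoid[OF A.M.monoid_axioms B.M.monoid_axioms])

sublocale M: monoid_algebra_over "A \<times>\<times> B" "monoid_algebra (A \<times>\<times> B) :: ('k, 'a \<times> 'b \<Rightarrow>\<^sub>0 'k) module"
  by unfold_locales simp

lemma tensor_relations_subset:
  "tensor_relations A B \<subseteq> carrier (monoid_algebra (A \<times>\<times> B))"
proof -
  have diff: "f - g \<in> carrier (monoid_algebra (A \<times>\<times> B))"
    if "f \<in> carrier (monoid_algebra (A \<times>\<times> B))" "g \<in> carrier (monoid_algebra (A \<times>\<times> B))"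
    for f g :: "'a \<times> 'b \<Rightarrow>\<^sub>0 'k"
    using that M.M.M.minus_closed[of f g] by (simp add: M.diff_eq)
  show ?thesis
    unfolding tensor_relations_def by (auto intro!: diff M.single_closed)
qed

abbreviation "T \<equiv> tensor_algebra A B"
abbreviation "pure \<equiv> pure_tensor A B"

sublocale monoid_algebra_quotient "A \<times>\<times> B" "monoid_algebra (A \<times>\<times> B)" "tensor_relations A B"
    T "\<lambda>(a, b). pure a b"
proof unfold_locales
  show "(\<lambda>(a, b). pure a b) \<equiv>
      \<lambda>s. Idl\<^bsub>monoid_algebra (A \<times>\<times> B)\<^esub> tensor_relations A B +>\<^bsub>monoid_algebra (A \<times>\<times> B)\<^esub> Poly_Mapping.single s 1"
    by (rule eq_reflection) (auto simp: pure_tensor_def tensor_ideal_def)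
qed (simp_all add: tensor_relations_subset tensor_algebra_def tensor_ideal_def)

lemma pure_closed [simp, intro]: "\<lbrakk>a \<in> carrier A; b \<in> carrier B\<rbrakk> \<Longrightarrow> pure a b \<in> carrier T"
  using cls_closed[of "(a, b)"] by simp

lemma pure_mult:
  "\<lbrakk>a \<in> carrier A; b \<in> carrier B; a' \<in> carrier A; b' \<in> carrier B\<rbrakk> \<Longrightarrow>
    pure a b \<otimes>\<^bsub>T\<^esub> pure a' b' = pure (a \<otimes>\<^bsub>A\<^esub> a') (b \<otimes>\<^bsub>B\<^esub> b')"
  using cls_mult[of "(a, b)" "(a', b')"] by simp

lemma pure_one: "\<one>\<^bsub>T\<^esub> = pure \<one>\<^bsub>A\<^esub> \<one>\<^bsub>B\<^esub>"
  using cls_one by simp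

lemma proj_pure:
  "\<lbrakk>a \<in> carrier A; b \<in> carrier B\<rbrakk> \<Longrightarrow> proj (Poly_Mapping.single (a, b) c) = c \<odot>\<^bsub>T\<^esub> pure a b"
  using proj_single[of "(a, b)" c] by simp

lemma proj_pure_add:
  assumes "a \<in> carrier A" "b \<in> carrier B" "a' \<in> carrier A" "b' \<in> carrier B"
  shows "proj (Poly_Mapping.single (a, b) 1 + Poly_Mapping.single (a', b') 1) = pure a b \<oplus>\<^bsub>T\<^esub> pure a' b'"
  using assms
  by (subst M.add_eq[symmetric], subst proj.add) (simp_all only: proj_pure, simp_all)

lemma add_closed: "\<lbrakk>f \<in> carrier (monoid_algebra (A \<times>\<times> B)); g \<in> carrier (monoid_algebra (A \<times>\<times> B))\<rbrakk>
    \<Longrightarrow> f + g \<in> carrier (monoid_algebra (A \<times>\<times> B))" for f g :: "'a \<times> 'b \<Rightarrow>\<^sub>0 'k"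
  using M.M.M.add.m_closed[of f g] by (simp add: M.add_eq)

lemma single_in: "\<lbrakk>a \<in> carrier A; b \<in> carrier B\<rbrakk> \<Longrightarrow>
    Poly_Mapping.single (a, b) c \<in> carrier (monoid_algebra (A \<times>\<times> B))" for c :: 'k
  by (rule M.single_closed) simp

lemma pure_add_left:
  assumes "a \<in> carrier A" "a' \<in> carrier A" "b \<in> carrier B"
  shows "pure (a \<oplus>\<^bsub>A\<^esub> a') b = pure a b \<oplus>\<^bsub>T\<^esub> pure a' b"
proof -
  let ?s = "\<lambda>a. Poly_Mapping.single (a, b) (1::'k)"
  have "proj (?s (a \<oplus>\<^bsub>A\<^esub> a')) = proj (?s a + ?s a')"
  proof (rule proj_eqI)
    show "?s (a \<oplus>\<^bsub>A\<^esub> a') - (?s a + ?s a') \<in> tensor_relations A B"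
      \<comment> \<open>The relation is written as two successive subtractions, whereas the goal
        subtracts a sum.\<close>
      using assms unfolding tensor_relations_def diff_diff_eq[symmetric] by blast
  qed (use assms in \<open>auto intro!: add_closed single_in\<close>)
  then show ?thesis
    using assms by (simp only: proj_pure_add proj_pure) (simp add: proj_pure)
qed

lemma pure_add_right:
  assumes "a \<in> carrier A" "b \<in> carrier B" "b' \<in> carrier B"
  shows "pure a (b \<oplus>\<^bsub>B\<^esub> b') = pure a b \<oplus>\<^bsub>T\<^esub> pure a b'"
proof -
  let ?s = "\<lambda>b. Poly_Mapping.single (a, b) (1::'k)"
  have "proj (?s (b \<oplus>\<^bsub>B\<^esub> b')) = proj (?s b + ?s b')"
  proof (rule proj_eqI)
    show "?s (b \<oplus>\<^bsub>B\<^esub> b') - (?s b + ?s b') \<in> tensor_relations A B"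
      using assms unfolding tensor_relations_def diff_diff_eq[symmetric] by blast
  qed (use assms in \<open>auto intro!: add_closed single_in\<close>)
  then show ?thesis
    using assms by (simp only: proj_pure_add proj_pure) (simp add: proj_pure)
qed

lemma pure_smult_left:
  assumes "a \<in> carrier A" "b \<in> carrier B"
  shows "pure (c \<odot>\<^bsub>A\<^esub> a) b = c \<odot>\<^bsub>T\<^esub> pure a b"
proof -
  have "proj (Poly_Mapping.single (c \<odot>\<^bsub>A\<^esub> a, b) 1) = proj (Poly_Mapping.single (a, b) c)"
  proof (rule proj_eqI)
    show "Poly_Mapping.single (c \<odot>\<^bsub>A\<^esub> a, b) 1 - Poly_Mapping.single (a, b) c \<in> tensor_relations A B"
      using assms unfolding tensor_relations_def by blast
  qed (use assms in \<open>auto intro!: single_in\<close>)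
  then show ?thesis
    using assms by (simp add: proj_pure)
qed

lemma pure_smult_right:
  assumes "a \<in> carrier A" "b \<in> carrier B"
  shows "pure a (c \<odot>\<^bsub>B\<^esub> b) = c \<odot>\<^bsub>T\<^esub> pure a b"
proof -
  have "proj (Poly_Mapping.single (a, c \<odot>\<^bsub>B\<^esub> b) 1) = proj (Poly_Mapping.single (a, b) c)"
  proof (rule proj_eqI)
    show "Poly_Mapping.single (a, c \<odot>\<^bsub>B\<^esub> b) 1 - Poly_Mapping.single (a, b) c \<in> tensor_relations A B"
      using assms unfolding tensor_relations_def by blast
  qed (use assms in \<open>auto intro!: single_in\<close>)
  then show ?thesis
    using assms by (simp add: proj_pure)
qed

section \<open>Universal property of the tensor product\<close>

context
  fixes C :: "('k, 'c, 'o) module_scheme" and \<beta> :: "'a \<Rightarrow> 'b \<Rightarrow> 'c"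
  assumes C: "k_algebra C" and \<beta>: "bilinear_map A B C \<beta>"
begin

interpretation C: k_algebra C by (rule C)

lemma bilinear_simps:
  assumes "a \<in> carrier A" "b \<in> carrier B"
  shows "\<beta> a b \<in> carrier C" "\<beta> (c \<odot>\<^bsub>A\<^esub> a) b = c \<odot>\<^bsub>C\<^esub> \<beta> a b" "\<beta> a (c \<odot>\<^bsub>B\<^esub> b) = c \<odot>\<^bsub>C\<^esub> \<beta> a b"
    and "a' \<in> carrier A \<Longrightarrow> \<beta> (a \<oplus>\<^bsub>A\<^esub> a') b = \<beta> a b \<oplus>\<^bsub>C\<^esub> \<beta> a' b"
    and "b' \<in> carrier B \<Longrightarrow> \<beta> a (b \<oplus>\<^bsub>B\<^esub> b') = \<beta> a b \<oplus>\<^bsub>C\<^esub> \<beta> a b'"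
proof -
  from \<beta> assms have l: "linear_map B C (\<beta> a)" and r: "linear_map A C (\<lambda>a. \<beta> a b)"
    by (auto simp: bilinear_map_def)
  show "\<beta> a b \<in> carrier C" "\<beta> a (c \<odot>\<^bsub>B\<^esub> b) = c \<odot>\<^bsub>C\<^esub> \<beta> a b"
    "b' \<in> carrier B \<Longrightarrow> \<beta> a (b \<oplus>\<^bsub>B\<^esub> b') = \<beta> a b \<oplus>\<^bsub>C\<^esub> \<beta> a b'"
    using linear_map.closed[OF l] linear_map.smult[OF l] linear_map.add[OF l] assms by auto
  show "\<beta> (c \<odot>\<^bsub>A\<^esub> a) b = c \<odot>\<^bsub>C\<^esub> \<beta> a b"
    "a' \<in> carrier A \<Longrightarrow> \<beta> (a \<oplus>\<^bsub>A\<^esub> a') b = \<beta> a b \<oplus>\<^bsub>C\<^esub> \<beta> a' b"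
    using linear_map.smult[OF r] linear_map.add[OF r] assms by auto
qed

text \<open>Multiplying a pair by pairs on both sides multiplies its components by fixed elements,
  so \<beta> remains bilinear in the pair in the middle and kills every bilinearity relation
  there.\<close>

lemma tensor_lift:
  shows linear_tensor_lift: "linear_map T C (tensor_lift C \<beta>)"
    and tensor_lift_pure: "\<lbrakk>a \<in> carrier A; b \<in> carrier B\<rbrakk> \<Longrightarrow> tensor_lift C \<beta> (pure a b) = \<beta> a b"
proof -
  let ?M = "monoid_algebra (A \<times>\<times> B) :: ('k, 'a \<times> 'b \<Rightarrow>\<^sub>0 'k) module"
  let ?ext = "linear_extension C (\<lambda>(a, b). \<beta> a b)"
  have lin: "linear_map ?M C ?ext"
    by (rule M.linear_extension[OF C]) (auto simp: bilinear_simps)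
  have kills: "?ext (Poly_Mapping.single s 1 \<otimes>\<^bsub>?M\<^esub> \<rho> \<otimes>\<^bsub>?M\<^esub> Poly_Mapping.single t 1) = \<zero>\<^bsub>C\<^esub>"
    if s: "s \<in> carrier (A \<times>\<times> B)" and t: "t \<in> carrier (A \<times>\<times> B)" and \<rho>: "\<rho> \<in> tensor_relations A B" for s t \<rho>
  proof -
    obtain a\<^sub>1 b\<^sub>1 a\<^sub>2 b\<^sub>2 where st: "s = (a\<^sub>1, b\<^sub>1)" "t = (a\<^sub>2, b\<^sub>2)"
      and carr: "a\<^sub>1 \<in> carrier A" "a\<^sub>2 \<in> carrier A" "b\<^sub>1 \<in> carrier B" "b\<^sub>2 \<in> carrier B"
      using s t by auto
    \<comment> \<open>As a linear function of the middle factor, \<open>L\<close> can be evaluated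
      on a relation term by term.\<close>
    define L where "L x = ?ext (Poly_Mapping.single s 1 \<otimes>\<^bsub>?M\<^esub> x \<otimes>\<^bsub>?M\<^esub> Poly_Mapping.single t 1)" for x
    have "linear_map ?M C L"
      unfolding L_def
      by (rule linear_map_comp[OF linear_map_comp[OF M.M.linear_mult_left M.M.linear_mult_right] lin])
         (use s t in auto)
    then interpret L: linear_map ?M C L .
    have L_single: "L (Poly_Mapping.single (a, b) c)
        = c \<odot>\<^bsub>C\<^esub> \<beta> (a\<^sub>1 \<otimes>\<^bsub>A\<^esub> a \<otimes>\<^bsub>A\<^esub> a\<^sub>2) (b\<^sub>1 \<otimes>\<^bsub>B\<^esub> b \<otimes>\<^bsub>B\<^esub> b\<^sub>2)"
      if "a \<in> carrier A" "b \<in> carrier B" for a b c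
      using that carr by (simp add: L_def st C.linear_extension_single bilinear_simps)
    have diff: "L (f - g) = L f \<ominus>\<^bsub>C\<^esub> L g" if "f \<in> carrier ?M" "g \<in> carrier ?M" for f g
      using that by (simp flip: M.diff_eq)
    have diff_single: "f - g \<in> carrier ?M" if "f \<in> carrier ?M" "g \<in> carrier ?M" for f g
      using that M.M.M.minus_closed[of f g] by (simp add: M.diff_eq)
    have "L \<rho> = \<zero>\<^bsub>C\<^esub>"
      using \<rho> carr unfolding tensor_relations_def
      by (auto simp: diff diff_single single_in L_single bilinear_simps A.M.l_distr A.M.r_distr B.M.l_distr B.M.r_distr
            C.M.minus_eq C.M.r_neg C.M.a_assoc C.M.minus_add[symmetric] C.M.a_comm C.M.r_neg1)
    then show ?thesis by (simp add: L_def)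
  qed
  interpret l: monoid_algebra_quotient_lift "A \<times>\<times> B" ?M "tensor_relations A B"
      T "\<lambda>(a, b). pure a b" C "\<lambda>(a, b). \<beta> a b"
    by unfold_locales (use kills in \<open>auto simp: bilinear_simps\<close>)
  have lift: "tensor_lift C \<beta> = l.lift"
    by (rule ext) (simp add: l.lift_def tensor_lift_def)
  show "linear_map T C (tensor_lift C \<beta>)"
    unfolding lift by (rule l.linear_lift)
  show "\<lbrakk>a \<in> carrier A; b \<in> carrier B\<rbrakk> \<Longrightarrow> tensor_lift C \<beta> (pure a b) = \<beta> a b"
    using l.lift_cls[of "(a, b)"] by (simp add: lift)
qed

end

end

context tensor_product
begin

lemma hom_left: "algebra_hom A T (\<lambda>a. pure a \<one>\<^bsub>B\<^esub>)"
  by unfold_locales (simp_all add: pure_add_left pure_smult_left pure_one pure_mult)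

lemma hom_right: "algebra_hom B T (\<lambda>b. pure \<one>\<^bsub>A\<^esub> b)"
  by unfold_locales (simp_all add: pure_add_right pure_smult_right pure_one pure_mult)

lemma pure_split: "\<lbrakk>a \<in> carrier A; b \<in> carrier B\<rbrakk> \<Longrightarrow> pure a b = pure a \<one>\<^bsub>B\<^esub> \<otimes>\<^bsub>T\<^esub> pure \<one>\<^bsub>A\<^esub> b"
  by (simp add: pure_mult)

text \<open>The coefficient in front of a pure tensor is absorbed into its left component, so no
  scalar is left in the step.\<close>

lemma pure_induct [consumes 1, case_names zero add]:
  assumes "t \<in> carrier T" and "Pr \<zero>\<^bsub>T\<^esub>"
    and "\<And>a b t. \<lbrakk>a \<in> carrier A; b \<in> carrier B; t \<in> carrier T; Pr t\<rbrakk> \<Longrightarrow> Pr (pure a b \<oplus>\<^bsub>T\<^esub> t)"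
  shows "Pr t"
  using assms(1)
proof (induct t rule: quotient_induct)
  case (add s c t)
  obtain a b where s: "s = (a, b)" "a \<in> carrier A" "b \<in> carrier B" using add by auto
  then show ?case
    using assms(3)[of "c \<odot>\<^bsub>A\<^esub> a" b t] add by (simp add: pure_smult_left)
qed (rule assms(2))

end

section \<open>Endomorphism algebras\<close>

text \<open>Operators are undefined outside the carrier: two of them that agree on the carrier are
  then equal, and the ring laws become genuine equations.\<close>

definition end_algebra :: "('k::field, 'a, 'm) module_scheme \<Rightarrow> ('k, 'a \<Rightarrow> 'a) module"
  where "end_algebra A =
    \<lparr>carrier = {f \<in> extensional (carrier A). linear_map A A f},
     monoid.mult = (\<lambda>f g. restrict (\<lambda>x. f (g x)) (carrier A)),
     one = restrict (\<lambda>x. x) (carrier A),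
     zero = restrict (\<lambda>x. \<zero>\<^bsub>A\<^esub>) (carrier A),
     add = (\<lambda>f g. restrict (\<lambda>x. f x \<oplus>\<^bsub>A\<^esub> g x) (carrier A)),
     module.smult = (\<lambda>c f. restrict (\<lambda>x. c \<odot>\<^bsub>A\<^esub> f x) (carrier A))\<rparr>"

context k_algebra
begin

abbreviation "\<E> \<equiv> end_algebra A"

lemma end_algebra_apply [simp]:
  assumes "x \<in> carrier A"
  shows "(f \<otimes>\<^bsub>\<E>\<^esub> g) x = f (g x)" "\<one>\<^bsub>\<E>\<^esub> x = x" "\<zero>\<^bsub>\<E>\<^esub> x = \<zero>" "(f \<oplus>\<^bsub>\<E>\<^esub> g) x = f x \<oplus> g x"
    "(c \<odot>\<^bsub>\<E>\<^esub> f) x = c \<odot> f x"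
  using assms by (simp_all add: end_algebra_def)

lemma end_algebra_linear: "f \<in> carrier \<E> \<Longrightarrow> linear_map A A f"
  by (simp add: end_algebra_def)

lemma end_algebra_simps [simp]:
  assumes "f \<in> carrier \<E>" "x \<in> carrier A"
  shows "f x \<in> carrier A" "f (c \<odot> x) = c \<odot> f x" "y \<in> carrier A \<Longrightarrow> f (x \<oplus> y) = f x \<oplus> f y"
    "f \<zero> = \<zero>"
proof -
  interpret f: linear_map A A f using assms by (rule_tac end_algebra_linear)
  show "f x \<in> carrier A" "f (c \<odot> x) = c \<odot> f x" "y \<in> carrier A \<Longrightarrow> f (x \<oplus> y) = f x \<oplus> f y"
    "f \<zero> = \<zero>"
    using assms f.closed f.smult f.add f.zero by blast+
qed

lemma end_algebra_eqI:
  assumes "f \<in> carrier \<E>" "g \<in> carrier \<E>" "\<And>x. x \<in> carrier A \<Longrightarrow> f x = g x"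
  shows "f = g"
  using assms by (auto simp: end_algebra_def intro: extensionalityI)

lemma restrict_in_end_algebra:
  assumes "linear_map A A f"
  shows "restrict f (carrier A) \<in> carrier \<E>"
proof -
  interpret f: linear_map A A f by fact
  have "linear_map A A (restrict f (carrier A))"
    by unfold_locales simp_all
  then show ?thesis by (simp add: end_algebra_def)
qed

lemma end_algebraI:
  assumes "f \<in> extensional (carrier A)" "\<And>x. x \<in> carrier A \<Longrightarrow> f x \<in> carrier A"
    "\<And>x c. x \<in> carrier A \<Longrightarrow> f (c \<odot> x) = c \<odot> f x"
    "\<And>x y. \<lbrakk>x \<in> carrier A; y \<in> carrier A\<rbrakk> \<Longrightarrow> f (x \<oplus> y) = f x \<oplus> f y"
  shows "f \<in> carrier \<E>"
proof -
  have "linear_map A A f" by unfold_locales (use assms in auto)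
  then show ?thesis using assms(1) by (simp add: end_algebra_def)
qed

lemma end_algebra_extensional:
  "f \<otimes>\<^bsub>\<E>\<^esub> g \<in> extensional (carrier A)" "\<one>\<^bsub>\<E>\<^esub> \<in> extensional (carrier A)" "\<zero>\<^bsub>\<E>\<^esub> \<in> extensional (carrier A)"
  "f \<oplus>\<^bsub>\<E>\<^esub> g \<in> extensional (carrier A)" "c \<odot>\<^bsub>\<E>\<^esub> f \<in> extensional (carrier A)"
  by (simp_all add: end_algebra_def)

lemma end_algebra_closed:
  "\<lbrakk>f \<in> carrier \<E>; g \<in> carrier \<E>\<rbrakk> \<Longrightarrow> f \<otimes>\<^bsub>\<E>\<^esub> g \<in> carrier \<E>" "\<one>\<^bsub>\<E>\<^esub> \<in> carrier \<E>" "\<zero>\<^bsub>\<E>\<^esub> \<in> carrier \<E>"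
  "\<lbrakk>f \<in> carrier \<E>; g \<in> carrier \<E>\<rbrakk> \<Longrightarrow> f \<oplus>\<^bsub>\<E>\<^esub> g \<in> carrier \<E>" "f \<in> carrier \<E> \<Longrightarrow> c \<odot>\<^bsub>\<E>\<^esub> f \<in> carrier \<E>"
  by (rule end_algebraI; simp add: end_algebra_extensional smult_add_right mult.commute M.a_ac)+

lemma k_algebra_end_algebra: "k_algebra \<E>"
proof (rule k_algebraI[OF ringI])
  show "abelian_group \<E>"
  proof (rule abelian_groupI, goal_cases)
    case (6 f)
    have "(- 1) \<odot>\<^bsub>\<E>\<^esub> f \<oplus>\<^bsub>\<E>\<^esub> f = \<zero>\<^bsub>\<E>\<^esub>"
      by (rule end_algebra_eqI) (use 6 in \<open>simp_all add: end_algebra_closed smult_minus M.l_neg\<close>)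
    with 6 show ?case using end_algebra_closed(5) by blast
  qed (auto intro!: end_algebra_eqI simp: end_algebra_closed M.a_ac)
  show "Group.monoid \<E>"
    by (rule monoidI) (auto intro!: end_algebra_eqI simp: end_algebra_closed)
qed (auto intro!: end_algebra_eqI simp: end_algebra_closed smult_add_left smult_add_right)

end

section \<open>Twisting elements\<close>

text \<open>Orthogonality of the characters of the cyclic group of order \<open>n\<close>. The
  summands are the powers of \<open>s = q^(a - i)\<close>; since \<open>s^n = 1\<close>, their sum
  is annihilated by \<open>s - 1\<close>, and \<open>s = 1\<close> holds exactly when
  \<open>i\<close> is the residue of \<open>a\<close>.\<close>

lemma root_of_unity_sum:
  fixes q :: "'k::field"
  assumes q: "primitive_root_of_unity n q" and i: "i < n"
  shows "(\<Sum>j<n. inverse (q ^ (i * j)) * q ^ (a * j)) = (if i = a mod n then of_nat n else 0)"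
proof -
  have q0: "q \<noteq> 0" and n: "n > 0" "q ^ n = 1"
    using q by (auto simp: primitive_root_of_unity_def power_0_left split: if_splits)
  define s where "s = inverse (q ^ i) * q ^ a"
  have "(\<Sum>j<n. inverse (q ^ (i * j)) * q ^ (a * j)) = (\<Sum>j<n. s ^ j)"
    by (simp add: s_def power_mult power_mult_distrib power_inverse)
  also have "\<dots> = (if s = 1 then of_nat n else 0)"
  proof -
    have "s ^ n = 1"
      using n by (simp add: s_def power_mult_distrib power_inverse flip: power_mult)
        (simp add: mult.commute[of _ n] power_mult)
    then have "(s - 1) * (\<Sum>j<n. s ^ j) = 0"
      by (simp add: power_diff_1_eq[symmetric])
    then show ?thesis by auto
  qed
  also have "s = 1 \<longleftrightarrow> i = a mod n"
  proof -
    have a: "q ^ a = q ^ (a mod n)"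
      by (metis n(2) mod_mult_div_eq mult.right_neutral power_add power_mult power_one)
    \<comment> \<open>The powers of \<open>q\<close> below \<open>n\<close> are distinct, since a
      coincidence would give \<open>q ^ (y - x) = 1\<close> with
      \<open>0 < y - x < n\<close>.\<close>
    have *: "x = y" if "q ^ x = q ^ y" "x \<le> y" "y < n" for x y
    proof (rule ccontr)
      assume "x \<noteq> y"
      have "q ^ x * q ^ (y - x) = q ^ y" using that(2) by (simp flip: power_add)
      then have "q ^ (y - x) = 1" using q0 that(1) by simp
      with that \<open>x \<noteq> y\<close> q show False by (auto simp: primitive_root_of_unity_def)
    qed
    have "s = 1 \<longleftrightarrow> q ^ i = q ^ (a mod n)"
      using q0 a by (auto simp: s_def field_simps)
    also have "\<dots> \<longleftrightarrow> i = a mod n"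
      using *[of i "a mod n"] *[of "a mod n" i] i n by (metis mod_less_divisor nle_le)
    finally show ?thesis .
  qed
  finally show ?thesis .
qed

text \<open>A bicharacter evaluated in an algebra: on a joint eigenvector of \<open>x\<close> and
  \<open>y\<close> with eigenvalues \<open>q^a\<close> and \<open>q^b\<close> it acts by
  \<open>q^(a * b)\<close>. Both \<open>z_k^2\<close> and the twisting factor of the coproduct of
  \<open>z_k\<close> have this form.\<close>

definition twist ::
    "nat \<Rightarrow> 'k::field \<Rightarrow> ('k, 'a, 'm) module_scheme \<Rightarrow> 'a \<Rightarrow> 'a \<Rightarrow> 'a"
  where "twist n q A x y = twist_sum n q A (\<lambda>i j. x [^]\<^bsub>A\<^esub> i \<otimes>\<^bsub>A\<^esub> y [^]\<^bsub>A\<^esub> j)"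

lemma (in algebra_hom) twist [simp]:
  "\<lbrakk>x \<in> carrier A; y \<in> carrier A\<rbrakk> \<Longrightarrow> f (twist n q A x y) = twist n q B (f x) (f y)"
  by (simp add: twist_def twist_sum)

context k_algebra
begin

lemma finsum_swap:
  assumes "finite I" "finite J" "\<And>i j. f i j \<in> carrier A"
  shows "(\<Oplus>i\<in>I. \<Oplus>j\<in>J. f i j) = (\<Oplus>j\<in>J. \<Oplus>i\<in>I. f i j)"
  using assms(1) by induct (simp_all add: assms M.finsum_addf)

lemma twist_closed [simp, intro]: "\<lbrakk>x \<in> carrier A; y \<in> carrier A\<rbrakk> \<Longrightarrow> twist n q A x y \<in> carrier A"
  by (simp add: twist_def)

lemma commute_pow:
  assumes "w \<otimes> x = x' \<otimes> w" "w \<in> carrier A" "x \<in> carrier A" "x' \<in> carrier A"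
  shows "w \<otimes> x [^] (i::nat) = x' [^] i \<otimes> w"
proof (induct i)
  case (Suc i)
  have "w \<otimes> x [^] Suc i = (w \<otimes> x [^] i) \<otimes> x" using assms by (simp add: M.m_assoc)
  also have "\<dots> = x' [^] i \<otimes> (w \<otimes> x)" using assms by (simp add: Suc M.m_assoc)
  also have "\<dots> = x' [^] Suc i \<otimes> w" using assms by (simp add: M.m_assoc)
  finally show ?case .
qed (use assms in simp)

text \<open>Used in two ways: to move a product of generators across a twist, whose indices are
  permuted thereby, and, for \<open>x' = x\<close> and \<open>y' = y\<close>, to see that an element
  commutes with a twist.\<close>

lemma twist_intertwine:
  assumes "w \<otimes> x = x' \<otimes> w" "w \<otimes> y = y' \<otimes> w"
    and carr: "w \<in> carrier A" "x \<in> carrier A" "x' \<in> carrier A" "y \<in> carrier A" "y' \<in> carrier A"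
  shows "w \<otimes> twist n q A x y = twist n q A x' y' \<otimes> w"
proof -
  interpret l: linear_map A A "\<lambda>x. w \<otimes> x" using carr by (rule_tac linear_mult_left)
  interpret r: linear_map A A "\<lambda>x. x \<otimes> w" using carr by (rule_tac linear_mult_right)
  have "w \<otimes> (x [^] i \<otimes> y [^] j) = x' [^] i \<otimes> y' [^] j \<otimes> w" for i j :: nat
  proof -
    have "w \<otimes> (x [^] i \<otimes> y [^] j) = (w \<otimes> x [^] i) \<otimes> y [^] j" using carr by (simp add: M.m_assoc)
    also have "\<dots> = x' [^] i \<otimes> (w \<otimes> y [^] j)" using assms by (simp add: M.m_assoc commute_pow[of w x x'])
    also have "\<dots> = x' [^] i \<otimes> y' [^] j \<otimes> w" using assms by (simp add: M.m_assoc commute_pow[of w y y'])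
    finally show ?thesis .
  qed
  then show ?thesis
    unfolding twist_def using carr by (subst l.twist_sum, simp, subst r.twist_sum) simp_all
qed

text \<open>The coefficients depend on \<open>i * j\<close> only, so the two summations can be
  interchanged.\<close>

lemma twist_commute:
  assumes "x \<otimes> y = y \<otimes> x" and carr: "x \<in> carrier A" "y \<in> carrier A"
  shows "twist n q A x y = twist n q A y x"
proof -
  have "x [^] i \<otimes> y [^] j = y [^] j \<otimes> x [^] i" for i j :: nat
    using assms commute_pow[OF commute_pow[of y x x i, symmetric], of j] by simp
  then show ?thesis
    unfolding twist_def twist_sum_def using carr
    by (subst finsum_swap) (simp_all add: mult.commute)
qed

text \<open>By orthogonality the sum over \<open>j\<close> vanishes unless
  \<open>i = b mod n\<close>, where it equals \<open>n\<close> and cancels the normalising factor.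
  What remains is \<open>q ^ (a * (b mod n))\<close>, and \<open>q ^ n = 1\<close> removes the
  residue.\<close>

lemma twist_sum_scalar:
  fixes q :: 'k
  assumes q: "primitive_root_of_unity n q" and n: "of_nat n \<noteq> (0::'k)" and x: "x \<in> carrier A"
  shows "twist_sum n q A (\<lambda>i j. (q ^ (a * i) * q ^ (b * j)) \<odot> x) = q ^ (a * b) \<odot> x"
proof -
  have n0: "n > 0" and qn: "q ^ n = 1" using q by (auto simp: primitive_root_of_unity_def)
  have "twist_sum n q A (\<lambda>i j. (q ^ (a * i) * q ^ (b * j)) \<odot> x) =
      (inverse (of_nat n) * (\<Sum>i<n. \<Sum>j<n. inverse (q ^ (i * j)) * (q ^ (a * i) * q ^ (b * j)))) \<odot> x"
    using x by (simp add: twist_sum_def finsum_smult)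
  also have "(\<Sum>i<n. \<Sum>j<n. inverse (q ^ (i * j)) * (q ^ (a * i) * q ^ (b * j)))
      = (\<Sum>i<n. q ^ (a * i) * (\<Sum>j<n. inverse (q ^ (i * j)) * q ^ (b * j)))"
    by (simp add: sum_distrib_left mult.left_commute)
  also have "\<dots> = (\<Sum>i<n. if i = b mod n then q ^ (a * i) * of_nat n else 0)"
    by (intro sum.cong) (simp_all add: root_of_unity_sum[OF q])
  also have "\<dots> = q ^ (a * (b mod n)) * of_nat n"
    using n0 by simp
  also have "q ^ (a * (b mod n)) = q ^ (a * b)"
  proof -
    have "q ^ (b mod n) = q ^ b"
      by (metis qn mod_mult_div_eq mult.right_neutral power_add power_mult power_one)
    then show ?thesis by (metis mult.commute power_mult)
  qed
  finally show ?thesis using n by (simp add: field_simps)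
qed

section \<open>Eigenprojections of an element whose \<open>n\<close>th power is the unit\<close>

context
  fixes n :: nat and q :: 'k and y :: 'a
  assumes q: "primitive_root_of_unity n q" and n: "of_nat n \<noteq> (0::'k)"
    and y: "y \<in> carrier A" "y [^] n = \<one>"
begin

text \<open>The projection to the eigenspace of \<open>y\<close> for the eigenvalue
  \<open>q^i\<close>, by Fourier inversion.\<close>

definition "idem i = inverse (of_nat n) \<odot> (\<Oplus>j\<in>{..<n}. inverse (q ^ (i * j)) \<odot> y [^] j)"

lemma idem_closed [simp, intro]: "idem i \<in> carrier A"
  using y by (simp add: idem_def)

text \<open>Multiplication by \<open>y\<close> shifts the summation index by one, and both
  \<open>y^n\<close> and \<open>q^n\<close> being units makes the shift cyclic.\<close>

lemma mult_idem: "y \<otimes> idem i = q ^ i \<odot> idem i"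
proof -
  have q0: "q \<noteq> 0" "q ^ n = 1"
    using q by (auto simp: primitive_root_of_unity_def power_0_left split: if_splits)
  define g where "g j = (q ^ i * inverse (q ^ (i * j))) \<odot> y [^] j" for j
  have g [simp]: "g j \<in> carrier A" for j using y by (simp add: g_def)
  have g_Suc: "g (Suc j) = inverse (q ^ (i * j)) \<odot> y [^] Suc j" for j
  proof -
    have "q ^ i * inverse (q ^ (i * Suc j)) = inverse (q ^ (i * j))"
      using q0 by (simp add: power_add field_simps)
    then show ?thesis by (simp only: g_def)
  qed
  \<comment> \<open>Both sides are the sum of \<open>g\<close> over \<open>{0..k}\<close>. For
    \<open>k = n\<close>, where \<open>g n = g 0\<close>, cancellation yields the cyclic
    shift.\<close>
  have "(\<Oplus>j\<in>{..<k}. g (Suc j)) \<oplus> g 0 = (\<Oplus>j\<in>{..<k}. g j) \<oplus> g k" for k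
  proof (induct k)
    case (Suc k)
    have "(\<Oplus>j\<in>{..<Suc k}. g (Suc j)) \<oplus> g 0 = g (Suc k) \<oplus> ((\<Oplus>j\<in>{..<k}. g (Suc j)) \<oplus> g 0)"
      by (simp add: lessThan_Suc M.a_assoc)
    then show ?case
      unfolding Suc by (simp add: lessThan_Suc M.a_ac)
  qed simp
  moreover have "g n = g 0"
    using y q0 by (simp add: g_def mult.commute[of i n] power_mult)
  ultimately have shift: "(\<Oplus>j\<in>{..<n}. g (Suc j)) = (\<Oplus>j\<in>{..<n}. g j)"
    by (metis M.add.r_cancel g M.finsum_closed Pi_I)
  have "y \<otimes> (\<Oplus>j\<in>{..<n}. inverse (q ^ (i * j)) \<odot> y [^] j)
      = (\<Oplus>j\<in>{..<n}. y \<otimes> (inverse (q ^ (i * j)) \<odot> y [^] j))"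
    using y by (intro M.finsum_rdistr) auto
  also have "\<dots> = (\<Oplus>j\<in>{..<n}. g (Suc j))"
    using y by (simp add: g_Suc M.nat_pow_Suc2[OF y(1), symmetric])
  also have "\<dots> = (\<Oplus>j\<in>{..<n}. q ^ i \<odot> (inverse (q ^ (i * j)) \<odot> y [^] j))"
    unfolding shift using y by (simp add: g_def[abs_def])
  also have "\<dots> = q ^ i \<odot> (\<Oplus>j\<in>{..<n}. inverse (q ^ (i * j)) \<odot> y [^] j)"
    using y by (intro smult_finsum[symmetric]) auto
  finally show ?thesis
    using y by (simp add: idem_def mult.commute)
qed

lemma pow_mult_idem: "y [^] (j::nat) \<otimes> idem i = q ^ (i * j) \<odot> idem i"
proof (induct j)
  case (Suc j)
  then show ?case
    using y by (simp add: M.m_assoc mult_idem power_add)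
qed simp

text \<open>The double sum is grouped by the exponent of \<open>x\<close>. It exhibits the twist as
  multiplication by \<open>x^i\<close> on the eigenspace of \<open>y\<close> for
  \<open>q^i\<close>.\<close>

lemma twist_eq_idem: "x \<in> carrier A \<Longrightarrow> twist n q A x y = (\<Oplus>i\<in>{..<n}. x [^] i \<otimes> idem i)"
  using y
  by (simp add: twist_def twist_sum_def idem_def M.finsum_rdistr smult_finsum)

text \<open>Powers of \<open>y\<close> next to \<open>idem i\<close> turn into powers of
  \<open>q\<close>, and orthogonality then singles out the summand with exponent
  \<open>i\<close>.\<close>

lemma twist_mult_idem:
  assumes x: "x \<in> carrier A" and i: "i < n"
  shows "twist n q A x y \<otimes> idem i = x [^] i \<otimes> idem i"
proof -
  interpret r: linear_map A A "\<lambda>x. x \<otimes> idem i" by (rule linear_mult_right) simp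
  have "twist n q A x y \<otimes> idem i = twist_sum n q A (\<lambda>i' j. q ^ (i * j) \<odot> (x [^] i' \<otimes> idem i))"
    unfolding twist_def using x y by (subst r.twist_sum) (simp_all add: M.m_assoc pow_mult_idem)
  also have "\<dots> = inverse (of_nat n) \<odot> (\<Oplus>i'\<in>{..<n}. if i = i' then of_nat n \<odot> (x [^] i' \<otimes> idem i') else \<zero>)"
  proof -
    have "(\<Oplus>j\<in>{..<n}. inverse (q ^ (i' * j)) \<odot> (q ^ (i * j) \<odot> (x [^] i' \<otimes> idem i)))
        = (if i = i' then of_nat n \<odot> (x [^] i' \<otimes> idem i') else \<zero>)" if "i' < n" for i'
      using x i that root_of_unity_sum[OF q that, of i] by (simp add: finsum_smult)
    then show ?thesis
      unfolding twist_sum_def using x by (intro arg_cong2[where f = "(\<odot>)"] refl M.finsum_cong') auto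
  qed
  also have "\<dots> = x [^] i \<otimes> idem i"
    using x i n by (subst M.add.finprod_singleton) auto
  finally show ?thesis .
qed

text \<open>On each eigenspace of \<open>y\<close> the factors are \<open>x^i\<close> and
  \<open>x'^i\<close>, and these multiply to the power of the product because \<open>x\<close> and
  \<open>x'\<close> commute.\<close>

lemma twist_mult_left:
  assumes "x \<otimes> y = y \<otimes> x" "x' \<otimes> y = y \<otimes> x'" "x \<otimes> x' = x' \<otimes> x"
    and x: "x \<in> carrier A" "x' \<in> carrier A"
  shows "twist n q A x y \<otimes> twist n q A x' y = twist n q A (x \<otimes> x') y"
proof -
  let ?E = "twist n q A x y"
  have "x' \<otimes> ?E = ?E \<otimes> x'"
    by (rule twist_intertwine) (use assms y in auto)
  then have pow: "?E \<otimes> x' [^] i = x' [^] i \<otimes> ?E" for i :: nat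
    using x y by (intro commute_pow) auto
  have "?E \<otimes> twist n q A x' y = (\<Oplus>i\<in>{..<n}. ?E \<otimes> (x' [^] i \<otimes> idem i))"
    using x y by (simp add: twist_eq_idem[of x'] M.finsum_rdistr)
  also have "\<dots> = (\<Oplus>i\<in>{..<n}. (x \<otimes> x') [^] i \<otimes> idem i)"
  proof (intro M.finsum_cong' refl)
    fix i assume "i \<in> {..<n}"
    then have i: "i < n" by simp
    have "?E \<otimes> (x' [^] i \<otimes> idem i) = (?E \<otimes> x' [^] i) \<otimes> idem i"
      using x y by (simp add: M.m_assoc)
    also have "\<dots> = x' [^] i \<otimes> (?E \<otimes> idem i)"
      unfolding pow using x y by (simp add: M.m_assoc)
    also have "\<dots> = x' [^] i \<otimes> x [^] i \<otimes> idem i"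
      using x y i by (simp add: twist_mult_idem M.m_assoc)
    also have "x' [^] i \<otimes> x [^] i = (x \<otimes> x') [^] i"
      using M.pow_mult_distrib[of x x' i] assms
      by (metis M.nat_pow_comm M.pow_mult_distrib)
    finally show "?E \<otimes> (x' [^] i \<otimes> idem i) = (x \<otimes> x') [^] i \<otimes> idem i" .
  qed (use x in auto)
  also have "\<dots> = twist n q A (x \<otimes> x') y"
    using x by (simp add: twist_eq_idem)
  finally show ?thesis .
qed

end

end

section \<open>Bimultiplicativity of the twist\<close>

context k_algebra
begin

lemma twist_twist_commute:
  assumes "x \<otimes> x' = x' \<otimes> x" "x \<otimes> y' = y' \<otimes> x" "y \<otimes> x' = x' \<otimes> y" "y \<otimes> y' = y' \<otimes> y"
    and carr: "x \<in> carrier A" "x' \<in> carrier A" "y \<in> carrier A" "y' \<in> carrier A"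
  shows "twist n q A x y \<otimes> twist n q A x' y' = twist n q A x' y' \<otimes> twist n q A x y"
proof -
  have "x' \<otimes> twist n q A x y = twist n q A x y \<otimes> x'" "y' \<otimes> twist n q A x y = twist n q A x y \<otimes> y'"
    by (rule twist_intertwine; simp add: assms)+
  then show ?thesis
    using carr by (intro twist_intertwine) auto
qed

text \<open>The identity behind compatibility of the coproduct with \<open>z_k^2\<close>. There
  \<open>a\<close>, \<open>c\<close> are \<open>x_k\<close>, \<open>x_(k+1)\<close> in the left
  tensor factor and \<open>b\<close>, \<open>d\<close> the same in the right one: the first two
  twists come from the squared twisting factor and the last two from \<open>z_k^2\<close> in each
  tensor factor, which explains their order.\<close>

lemma twist_bimultiplicative:
  fixes q :: 'k
  assumes q: "primitive_root_of_unity n q" and n: "of_nat n \<noteq> (0::'k)"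
    and carr: "a \<in> carrier A" "b \<in> carrier A" "c \<in> carrier A" "d \<in> carrier A"
    and pow: "a [^] n = \<one>" "b [^] n = \<one>" "c [^] n = \<one>" "d [^] n = \<one>"
    and comm: "a \<otimes> b = b \<otimes> a" "a \<otimes> c = c \<otimes> a" "a \<otimes> d = d \<otimes> a" "b \<otimes> c = c \<otimes> b" "b \<otimes> d = d \<otimes> b" "c \<otimes> d = d \<otimes> c"
  shows "twist n q A (a \<otimes> b) (c \<otimes> d)
    = twist n q A a d \<otimes> twist n q A c b \<otimes> (twist n q A a c \<otimes> twist n q A b d)"
proof -
  let ?t = "twist n q A"
  have comm_prod: "x \<otimes> (c \<otimes> d) = (c \<otimes> d) \<otimes> x" if "x \<in> {a, b}" for x
  proof -
    have x: "x \<in> carrier A" "x \<otimes> c = c \<otimes> x" "x \<otimes> d = d \<otimes> x" using that carr comm by auto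
    have "x \<otimes> (c \<otimes> d) = (x \<otimes> c) \<otimes> d" using x(1) carr by (simp add: M.m_assoc)
    also have "\<dots> = c \<otimes> (x \<otimes> d)" unfolding x(2) using x(1) carr by (simp add: M.m_assoc)
    also have "\<dots> = (c \<otimes> d) \<otimes> x" unfolding x(3) using x(1) carr by (simp add: M.m_assoc)
    finally show ?thesis .
  qed
  \<comment> \<open>Multiplicativity in the second argument is that in the first, carried over by
    the symmetry of the twist.\<close>
  have right: "?t x (c \<otimes> d) = ?t x c \<otimes> ?t x d" if "x \<in> {a, b}" for x
  proof -
    have x: "x \<in> carrier A" "x \<otimes> c = c \<otimes> x" "x \<otimes> d = d \<otimes> x" "x [^] n = \<one>" using that carr comm pow by auto
    have "?t x (c \<otimes> d) = ?t (c \<otimes> d) x"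
      using comm_prod[OF that] x(1) carr by (intro twist_commute) auto
    also have "\<dots> = ?t c x \<otimes> ?t d x"
      using x carr comm by (intro twist_mult_left[OF q n, symmetric]) auto
    also have "\<dots> = ?t x c \<otimes> ?t x d"
      using x carr by (simp add: twist_commute[of x])
    finally show ?thesis .
  qed
  have "(c \<otimes> d) [^] n = \<one>"
    using carr comm pow by (simp add: M.pow_mult_distrib)
  then have "?t (a \<otimes> b) (c \<otimes> d) = ?t a (c \<otimes> d) \<otimes> ?t b (c \<otimes> d)"
    using carr comm comm_prod by (intro twist_mult_left[OF q n, symmetric]) auto
  also have "\<dots> = (?t a c \<otimes> ?t a d) \<otimes> (?t b c \<otimes> ?t b d)"
    by (simp add: right)
  also have "\<dots> = (?t a d \<otimes> ?t a c) \<otimes> (?t b c \<otimes> ?t b d)"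
    using carr comm by (subst twist_twist_commute[of a a c d]) auto
  also have "\<dots> = ?t a d \<otimes> (?t a c \<otimes> ?t b c) \<otimes> ?t b d"
    using carr by (simp add: M.m_assoc)
  also have "\<dots> = ?t a d \<otimes> (?t b c \<otimes> ?t a c) \<otimes> ?t b d"
    using carr comm by (subst twist_twist_commute[of a b c c]) auto
  also have "\<dots> = ?t a d \<otimes> ?t c b \<otimes> (?t a c \<otimes> ?t b d)"
    using carr comm by (simp add: M.m_assoc twist_commute[of b c])
  finally show ?thesis .
qed

end

text \<open>The unit is an eigenvector of itself with eigenvalue \<open>q^0\<close>.\<close>

lemma (in k_algebra) twist_one:
  assumes "primitive_root_of_unity n q" and "of_nat n \<noteq> (0::'k)"
  shows "twist n q A \<one> \<one> = \<one>"
  using twist_sum_scalar[OF assms M.one_closed, of 0 0] by (simp add: twist_def)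

text \<open>Collecting \<open>u\<close>, \<open>v\<close>, \<open>w\<close> on the left turns either
  side into their product times the untwisted braid word. In the application \<open>u\<close>,
  \<open>v\<close>, \<open>w\<close> are the twisting elements for the index pairs
  \<open>(k, k+1)\<close>, \<open>(k, k+2)\<close>, \<open>(k+1, k+2)\<close>, which the two
  transpositions permute.\<close>

lemma (in Group.monoid) braid_twisted:
  assumes carr: "a \<in> carrier G" "b \<in> carrier G" "u \<in> carrier G" "v \<in> carrier G" "w \<in> carrier G"
    and ab: "a \<otimes> b \<otimes> a = b \<otimes> a \<otimes> b"
    and aw: "a \<otimes> w = v \<otimes> a" and av: "a \<otimes> v = w \<otimes> a"
    and bu: "b \<otimes> u = v \<otimes> b" and bv: "b \<otimes> v = u \<otimes> b"
    and comm: "u \<otimes> v = v \<otimes> u" "u \<otimes> w = w \<otimes> u" "v \<otimes> w = w \<otimes> v"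
  shows "(u \<otimes> a) \<otimes> (w \<otimes> b) \<otimes> (u \<otimes> a) = (w \<otimes> b) \<otimes> (u \<otimes> a) \<otimes> (w \<otimes> b)"
proof -
  have "(u \<otimes> a) \<otimes> (w \<otimes> b) \<otimes> (u \<otimes> a) = u \<otimes> (a \<otimes> w) \<otimes> (b \<otimes> u) \<otimes> a"
    using carr by (simp add: m_assoc)
  also have "\<dots> = u \<otimes> v \<otimes> (a \<otimes> v) \<otimes> b \<otimes> a"
    unfolding aw bu using carr by (simp add: m_assoc)
  also have "\<dots> = u \<otimes> v \<otimes> w \<otimes> (a \<otimes> b \<otimes> a)"
    unfolding av using carr by (simp add: m_assoc)
  finally have l: "(u \<otimes> a) \<otimes> (w \<otimes> b) \<otimes> (u \<otimes> a) = u \<otimes> v \<otimes> w \<otimes> (a \<otimes> b \<otimes> a)" .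
  have "(w \<otimes> b) \<otimes> (u \<otimes> a) \<otimes> (w \<otimes> b) = w \<otimes> (b \<otimes> u) \<otimes> (a \<otimes> w) \<otimes> b"
    using carr by (simp add: m_assoc)
  also have "\<dots> = w \<otimes> v \<otimes> (b \<otimes> v) \<otimes> a \<otimes> b"
    unfolding aw bu using carr by (simp add: m_assoc)
  also have "\<dots> = w \<otimes> v \<otimes> u \<otimes> (b \<otimes> a \<otimes> b)"
    unfolding bv using carr by (simp add: m_assoc)
  also have "w \<otimes> v \<otimes> u = u \<otimes> v \<otimes> w"
    using carr comm by (metis m_assoc)
  finally show ?thesis using l ab by simp
qed

section \<open>The relations of \<open>H\<^sub>n\<^sub>,\<^sub>m\<close>\<close>

text \<open>The relations as equations in an arbitrary algebra \<open>B\<close>. They are verified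
  in the tensor square, in the ground field and in an endomorphism algebra, each time to obtain a
  map out of the presented algebra.\<close>

definition hnm_satisfied ::
    "nat \<Rightarrow> nat \<Rightarrow> 'k::field \<Rightarrow> ('k, 'b, 'more) module_scheme \<Rightarrow> (nat \<Rightarrow> 'b) \<Rightarrow> (nat \<Rightarrow> 'b) \<Rightarrow> bool"
  where "hnm_satisfied n m q B x z \<longleftrightarrow>
    (\<forall>i\<in>{1..m}. x i \<in> carrier B) \<and> (\<forall>k\<in>{1..<m}. z k \<in> carrier B) \<and>
    (\<forall>i\<in>{1..m}. x i [^]\<^bsub>B\<^esub> n = \<one>\<^bsub>B\<^esub>) \<and>
    (\<forall>i\<in>{1..m}. \<forall>j\<in>{1..m}. x i \<otimes>\<^bsub>B\<^esub> x j = x j \<otimes>\<^bsub>B\<^esub> x i) \<and>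
    (\<forall>k\<in>{1..<m}. \<forall>i\<in>{1..m}. z k \<otimes>\<^bsub>B\<^esub> x i = x (Transposition.transpose k (k + 1) i) \<otimes>\<^bsub>B\<^esub> z k) \<and>
    (\<forall>k\<in>{1..<m}. \<forall>l\<in>{1..<m}. \<bar>int k - int l\<bar> > 1 \<longrightarrow> z k \<otimes>\<^bsub>B\<^esub> z l = z l \<otimes>\<^bsub>B\<^esub> z k) \<and>
    (\<forall>k\<in>{1..<m}. k + 1 \<in> {1..<m} \<longrightarrow>
      z k \<otimes>\<^bsub>B\<^esub> z (k + 1) \<otimes>\<^bsub>B\<^esub> z k = z (k + 1) \<otimes>\<^bsub>B\<^esub> z k \<otimes>\<^bsub>B\<^esub> z (k + 1)) \<and>
    (\<forall>k\<in>{1..<m}. z k \<otimes>\<^bsub>B\<^esub> z k = twist n q B (x k) (x (k + 1)))"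

lemma transpose_Suc_closed:
  "\<lbrakk>k \<in> {1..<m}; i \<in> {1..m}\<rbrakk> \<Longrightarrow> Transposition.transpose k (k + 1) i \<in> {1..m}"
  "\<lbrakk>k \<in> {1..<m}; i \<in> {1..m}\<rbrakk> \<Longrightarrow> Transposition.transpose k (Suc k) i \<in> {1..m}"
  by (auto simp: Transposition.transpose_def)

lemma hnm_letter_in:
  "LX i \<in> hnm_letters m \<longleftrightarrow> i \<in> {1..m}" "LZ k \<in> hnm_letters m \<longleftrightarrow> k \<in> {1..<m}"
  by (auto simp: hnm_letters_def)

lemma k_algebra_free_algebra: "k_algebra (free_algebra V :: ('k::field, 'g list \<Rightarrow>\<^sub>0 'k) module)"
  unfolding free_algebra_def by (rule monoid.k_algebra_monoid_algebra[OF monoid_word_monoid])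

lemma free_var_closed [simp]: "g \<in> V \<Longrightarrow> free_var g \<in> carrier (free_algebra V)"
  by (auto simp: free_var_def free_algebra_def monoid_algebra_simps)

context
  fixes n m :: nat and q :: "'k::field"
begin

interpretation F: k_algebra "free_algebra (hnm_letters m) :: ('k, hnm_letter list \<Rightarrow>\<^sub>0 'k) module"
  by (rule k_algebra_free_algebra)

lemma hnm_x_var [simp]: "i \<in> {1..m} \<Longrightarrow> free_var (LX i) \<in> carrier (free_algebra (hnm_letters m))"
  and hnm_z_var [simp]: "k \<in> {1..<m} \<Longrightarrow> free_var (LZ k) \<in> carrier (free_algebra (hnm_letters m))"
  by (simp_all add: hnm_letter_in)

lemma hnm_relations_subset: "hnm_relations n m q \<subseteq> carrier (free_algebra (hnm_letters m))"
  unfolding hnm_relations_def Let_def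
  by (auto simp del: One_nat_def simp: transpose_Suc_closed hnm_letter_in
      intro!: hnm_x_var transpose_Suc_closed F.M.minus_closed F.M.m_closed F.M.nat_pow_closed F.twist_sum_closed)

text \<open>Both directions matter: applied to the projection it yields the relations between the
  generators themselves, and applied to a free lift it shows that the lift factors through the
  quotient.\<close>

lemma hnm_relations_iff:
  assumes "algebra_hom (free_algebra (hnm_letters m)) B f"
  shows "(\<forall>\<rho>\<in>hnm_relations n m q. f \<rho> = \<zero>\<^bsub>B\<^esub>) \<longleftrightarrow>
    hnm_satisfied n m q B (\<lambda>i. f (free_var (LX i))) (\<lambda>k. f (free_var (LZ k)))"
proof -
  let ?F = "free_algebra (hnm_letters m) :: ('k, hnm_letter list \<Rightarrow>\<^sub>0 'k) module"
  interpret f: algebra_hom ?F B f by fact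
  define x where "x i = (free_var (LX i) :: hnm_letter list \<Rightarrow>\<^sub>0 'k)" for i
  define z where "z k = (free_var (LZ k) :: hnm_letter list \<Rightarrow>\<^sub>0 'k)" for k
  let ?s = "\<lambda>k i. Transposition.transpose k (k + 1) i"
  have x: "x i \<in> carrier ?F" if "i \<in> {1..m}" for i
    using that unfolding x_def by (rule hnm_x_var)
  have z: "z k \<in> carrier ?F" if "k \<in> {1..<m}" for k
    using that unfolding z_def by (rule hnm_z_var)
  have diff: "f (u \<ominus>\<^bsub>?F\<^esub> v) = \<zero>\<^bsub>B\<^esub> \<longleftrightarrow> f u = f v" if "u \<in> carrier ?F" "v \<in> carrier ?F" for u v
    using that by (simp add: f.B.M.r_right_minus_eq)
  have xpow: "f (x i [^]\<^bsub>?F\<^esub> n \<ominus>\<^bsub>?F\<^esub> \<one>\<^bsub>?F\<^esub>) = \<zero>\<^bsub>B\<^esub> \<longleftrightarrow> f (x i) [^]\<^bsub>B\<^esub> n = \<one>\<^bsub>B\<^esub>"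
    if "i \<in> {1..m}" for i
    using x[OF that] by (simp add: diff)
  have xx: "f (x i \<otimes>\<^bsub>?F\<^esub> x j \<ominus>\<^bsub>?F\<^esub> x j \<otimes>\<^bsub>?F\<^esub> x i) = \<zero>\<^bsub>B\<^esub>
      \<longleftrightarrow> f (x i) \<otimes>\<^bsub>B\<^esub> f (x j) = f (x j) \<otimes>\<^bsub>B\<^esub> f (x i)" if "i \<in> {1..m}" "j \<in> {1..m}" for i j
    using x[OF that(1)] x[OF that(2)] by (simp add: diff)
  have zx: "f (z k \<otimes>\<^bsub>?F\<^esub> x i \<ominus>\<^bsub>?F\<^esub> x (?s k i) \<otimes>\<^bsub>?F\<^esub> z k) = \<zero>\<^bsub>B\<^esub>
      \<longleftrightarrow> f (z k) \<otimes>\<^bsub>B\<^esub> f (x i) = f (x (?s k i)) \<otimes>\<^bsub>B\<^esub> f (z k)" if "k \<in> {1..<m}" "i \<in> {1..m}" for k i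
    using z[OF that(1)] x[OF that(2)] x[OF transpose_Suc_closed(1)[OF that]] by (simp add: diff)
  have zz: "f (z k \<otimes>\<^bsub>?F\<^esub> z l \<ominus>\<^bsub>?F\<^esub> z l \<otimes>\<^bsub>?F\<^esub> z k) = \<zero>\<^bsub>B\<^esub>
      \<longleftrightarrow> f (z k) \<otimes>\<^bsub>B\<^esub> f (z l) = f (z l) \<otimes>\<^bsub>B\<^esub> f (z k)" if "k \<in> {1..<m}" "l \<in> {1..<m}" for k l
    using z[OF that(1)] z[OF that(2)] by (simp add: diff)
  have zzz: "f (z k \<otimes>\<^bsub>?F\<^esub> z l \<otimes>\<^bsub>?F\<^esub> z k \<ominus>\<^bsub>?F\<^esub> z l \<otimes>\<^bsub>?F\<^esub> z k \<otimes>\<^bsub>?F\<^esub> z l) = \<zero>\<^bsub>B\<^esub>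
      \<longleftrightarrow> f (z k) \<otimes>\<^bsub>B\<^esub> f (z l) \<otimes>\<^bsub>B\<^esub> f (z k) = f (z l) \<otimes>\<^bsub>B\<^esub> f (z k) \<otimes>\<^bsub>B\<^esub> f (z l)"
    if "k \<in> {1..<m}" "l \<in> {1..<m}" for k l
    using z[OF that(1)] z[OF that(2)] by (simp add: diff)
  have sq: "f (z k [^]\<^bsub>?F\<^esub> (2::nat) \<ominus>\<^bsub>?F\<^esub> twist_sum n q ?F (\<lambda>i j. x k [^]\<^bsub>?F\<^esub> i \<otimes>\<^bsub>?F\<^esub> x (k + 1) [^]\<^bsub>?F\<^esub> j)) = \<zero>\<^bsub>B\<^esub>
      \<longleftrightarrow> f (z k) \<otimes>\<^bsub>B\<^esub> f (z k) = twist n q B (f (x k)) (f (x (k + 1)))" if k: "k \<in> {1..<m}" for k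
  proof -
    have "x k \<in> carrier ?F" "x (k + 1) \<in> carrier ?F" using k by (auto intro!: x)
    then show ?thesis
      using z[OF k] by (simp add: diff numeral_2_eq_2 flip: twist_def)
  qed
  have "(\<forall>\<rho>\<in>hnm_relations n m q. f \<rho> = \<zero>\<^bsub>B\<^esub>) \<longleftrightarrow>
      (\<forall>i\<in>{1..m}. f (x i [^]\<^bsub>?F\<^esub> n \<ominus>\<^bsub>?F\<^esub> \<one>\<^bsub>?F\<^esub>) = \<zero>\<^bsub>B\<^esub>) \<and>
      (\<forall>i\<in>{1..m}. \<forall>j\<in>{1..m}. f (x i \<otimes>\<^bsub>?F\<^esub> x j \<ominus>\<^bsub>?F\<^esub> x j \<otimes>\<^bsub>?F\<^esub> x i) = \<zero>\<^bsub>B\<^esub>) \<and>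
      (\<forall>k\<in>{1..<m}. \<forall>i\<in>{1..m}. f (z k \<otimes>\<^bsub>?F\<^esub> x i \<ominus>\<^bsub>?F\<^esub> x (?s k i) \<otimes>\<^bsub>?F\<^esub> z k) = \<zero>\<^bsub>B\<^esub>) \<and>
      (\<forall>k\<in>{1..<m}. \<forall>l\<in>{1..<m}. \<bar>int k - int l\<bar> > 1 \<longrightarrow> f (z k \<otimes>\<^bsub>?F\<^esub> z l \<ominus>\<^bsub>?F\<^esub> z l \<otimes>\<^bsub>?F\<^esub> z k) = \<zero>\<^bsub>B\<^esub>) \<and>
      (\<forall>k\<in>{1..<m}. k + 1 \<in> {1..<m} \<longrightarrow>
        f (z k \<otimes>\<^bsub>?F\<^esub> z (k + 1) \<otimes>\<^bsub>?F\<^esub> z k \<ominus>\<^bsub>?F\<^esub> z (k + 1) \<otimes>\<^bsub>?F\<^esub> z k \<otimes>\<^bsub>?F\<^esub> z (k + 1)) = \<zero>\<^bsub>B\<^esub>) \<and>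
      (\<forall>k\<in>{1..<m}. f (z k [^]\<^bsub>?F\<^esub> (2::nat) \<ominus>\<^bsub>?F\<^esub> twist_sum n q ?F (\<lambda>i j. x k [^]\<^bsub>?F\<^esub> i \<otimes>\<^bsub>?F\<^esub> x (k + 1) [^]\<^bsub>?F\<^esub> j)) = \<zero>\<^bsub>B\<^esub>)"
    unfolding hnm_relations_def Let_def x_def z_def by blast
  also have "\<dots> \<longleftrightarrow> hnm_satisfied n m q B (\<lambda>i. f (x i)) (\<lambda>k. f (z k))"
    unfolding hnm_satisfied_def using x z by (simp only: xpow xx zx zz zzz sq f.closed cong: ball_cong) simp
  finally show ?thesis
    by (simp add: x_def z_def)
qed

end

lemma hnm_satisfied_cong:
  assumes "\<And>i. i \<in> {1..m} \<Longrightarrow> x i = x' i" "\<And>k. k \<in> {1..<m} \<Longrightarrow> z k = z' k"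
  shows "hnm_satisfied n m q B x z \<longleftrightarrow> hnm_satisfied n m q B x' z'"
proof -
  have *: "x i = x' i \<and> x (Transposition.transpose k (k + 1) i) = x' (Transposition.transpose k (k + 1) i)"
    if "k \<in> {1..<m}" "i \<in> {1..m}" for i k
    using that assms transpose_Suc_closed(1) by blast
  have **: "x k = x' k \<and> x (k + 1) = x' (k + 1)" if "k \<in> {1..<m}" for k
    using that by (auto intro!: assms)
  show ?thesis
    unfolding hnm_satisfied_def by (simp only: * ** assms cong: ball_cong imp_cong)
qed

section \<open>The bialgebra structure of \<open>H\<^sub>n\<^sub>,\<^sub>m\<close>\<close>

locale hnm_bialgebra =
  fixes n m :: nat and q :: "'k::field_char_0"
  assumes q: "primitive_root_of_unity n q"
begin

abbreviation "P \<equiv> hnm_algebra n m q"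
abbreviation "x \<equiv> hnm_x n m q"
abbreviation "z \<equiv> hnm_z n m q"

sublocale pres: presentation "hnm_letters m" "hnm_relations n m q"
  rewrites "presented_algebra (hnm_letters m) (hnm_relations n m q) = hnm_algebra n m q"
  by unfold_locales (simp_all add: hnm_relations_subset hnm_algebra_def)

sublocale T: tensor_product P P
  by (intro tensor_product.intro pres.Q.k_algebra_axioms)

lemma gen_eq: "pres.gen (LX i) = x i" "pres.gen (LZ k) = z k"
  by (simp_all add: hnm_x_def hnm_z_def)

lemma of_nat_n: "of_nat n \<noteq> (0::'k)"
  using q by (simp add: primitive_root_of_unity_def)

lemma hnm_satisfied_hnm: "hnm_satisfied n m q P x z"
proof -
  have proj: "algebra_hom (free_algebra (hnm_letters m)) P pres.proj"
    by (rule pres.proj.algebra_hom_axioms)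
  have "\<forall>\<rho>\<in>hnm_relations n m q. pres.proj \<rho> = \<zero>\<^bsub>P\<^esub>"
    using pres.M.M.genideal_self[OF hnm_relations_subset] pres.proj_ideal by blast
  then show ?thesis
    unfolding hnm_relations_iff[OF proj] by (simp add: hnm_x_def[abs_def] hnm_z_def[abs_def] presented_gen_def)
qed

text \<open>The universal property from which coproduct, counit and action are all obtained.\<close>

lemma presented_lift_hnm:
  assumes B: "k_algebra B" and sat: "hnm_satisfied n m q B (\<lambda>i. \<phi> (LX i)) (\<lambda>k. \<phi> (LZ k))"
  shows "algebra_hom P B (presented_lift B \<phi>)"
    and "i \<in> {1..m} \<Longrightarrow> presented_lift B \<phi> (x i) = \<phi> (LX i)"
    and "k \<in> {1..<m} \<Longrightarrow> presented_lift B \<phi> (z k) = \<phi> (LZ k)"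
proof -
  interpret B: k_algebra B by (rule B)
  have \<phi>: "\<phi> g \<in> carrier B" if "g \<in> hnm_letters m" for g
    using that sat by (auto simp: hnm_letters_def hnm_satisfied_def)
  have free: "algebra_hom (free_algebra (hnm_letters m)) B (free_lift B \<phi>)"
    by (rule B.free_lift_hom[OF \<phi>])
  have var: "free_lift B \<phi> (free_var g) = \<phi> g" if "g \<in> hnm_letters m" for g
    using that \<phi> by (intro B.free_lift_var[where V = "hnm_letters m"]) auto
  have "hnm_satisfied n m q B (\<lambda>i. free_lift B \<phi> (free_var (LX i))) (\<lambda>k. free_lift B \<phi> (free_var (LZ k)))"
    using sat by (subst hnm_satisfied_cong) (simp_all add: var hnm_letter_in)
  then have kills: "free_lift B \<phi> \<rho> = \<zero>\<^bsub>B\<^esub>" if "\<rho> \<in> hnm_relations n m q" for \<rho>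
    using hnm_relations_iff[OF free, of n q] that by blast
  show "algebra_hom P B (presented_lift B \<phi>)"
    unfolding hnm_algebra_def by (rule B.presented_lift_hom[OF \<phi> hnm_relations_subset kills])
  show "i \<in> {1..m} \<Longrightarrow> presented_lift B \<phi> (x i) = \<phi> (LX i)" "k \<in> {1..<m} \<Longrightarrow> presented_lift B \<phi> (z k) = \<phi> (LZ k)"
    unfolding hnm_x_def hnm_z_def
    by (rule B.presented_lift_gen[OF \<phi> hnm_relations_subset kills], assumption, assumption, simp add: hnm_letter_in)+
qed

lemma x_closed [simp, intro]: "i \<in> {1..m} \<Longrightarrow> x i \<in> carrier P"
  and z_closed [simp, intro]: "k \<in> {1..<m} \<Longrightarrow> z k \<in> carrier P"
  and x_pow: "i \<in> {1..m} \<Longrightarrow> x i [^]\<^bsub>P\<^esub> n = \<one>\<^bsub>P\<^esub>"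
  and x_comm: "\<lbrakk>i \<in> {1..m}; j \<in> {1..m}\<rbrakk> \<Longrightarrow> x i \<otimes>\<^bsub>P\<^esub> x j = x j \<otimes>\<^bsub>P\<^esub> x i"
  and z_x: "\<lbrakk>k \<in> {1..<m}; i \<in> {1..m}\<rbrakk> \<Longrightarrow>
    z k \<otimes>\<^bsub>P\<^esub> x i = x (Transposition.transpose k (k + 1) i) \<otimes>\<^bsub>P\<^esub> z k"
  and z_z: "\<lbrakk>k \<in> {1..<m}; l \<in> {1..<m}; \<bar>int k - int l\<bar> > 1\<rbrakk> \<Longrightarrow> z k \<otimes>\<^bsub>P\<^esub> z l = z l \<otimes>\<^bsub>P\<^esub> z k"
  and z_braid: "\<lbrakk>k \<in> {1..<m}; k + 1 \<in> {1..<m}\<rbrakk> \<Longrightarrow>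
    z k \<otimes>\<^bsub>P\<^esub> z (k + 1) \<otimes>\<^bsub>P\<^esub> z k = z (k + 1) \<otimes>\<^bsub>P\<^esub> z k \<otimes>\<^bsub>P\<^esub> z (k + 1)"
  and z_sq: "k \<in> {1..<m} \<Longrightarrow> z k \<otimes>\<^bsub>P\<^esub> z k = twist n q P (x k) (x (k + 1))"
  using hnm_satisfied_hnm unfolding hnm_satisfied_def by blast+

section \<open>Generators of the tensor square and their relations\<close>

definition "xl i = pure_tensor P P (x i) \<one>\<^bsub>P\<^esub>"
definition "xr i = pure_tensor P P \<one>\<^bsub>P\<^esub> (x i)"
definition "zz k = pure_tensor P P (z k) (z k)"
text \<open>The coproduct of \<open>z_k\<close> contains \<open>J k (k + 1)\<close>; other index
  pairs, also the reversed one, appear when elements \<open>zz\<close> are moved across it.\<close>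

definition "J i j = twist n q T.T (xl i) (xr j)"

sublocale left: algebra_hom P T.T "\<lambda>a. pure_tensor P P a \<one>\<^bsub>P\<^esub>"
  by (rule T.hom_left)

sublocale right: algebra_hom P T.T "\<lambda>a. pure_tensor P P \<one>\<^bsub>P\<^esub> a"
  by (rule T.hom_right)

lemma tensor_gen_closed [simp, intro]:
  "i \<in> {1..m} \<Longrightarrow> xl i \<in> carrier T.T" "i \<in> {1..m} \<Longrightarrow> xr i \<in> carrier T.T"
  "k \<in> {1..<m} \<Longrightarrow> zz k \<in> carrier T.T"
  "\<lbrakk>i \<in> {1..m}; j \<in> {1..m}\<rbrakk> \<Longrightarrow> J i j \<in> carrier T.T"
  unfolding xl_def xr_def zz_def J_def by (auto intro!: T.Q.twist_closed T.pure_closed)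

lemma tensor_gen_commute:
  assumes "i \<in> {1..m}" "j \<in> {1..m}"
  shows "xl i \<otimes>\<^bsub>T.T\<^esub> xl j = xl j \<otimes>\<^bsub>T.T\<^esub> xl i" "xr i \<otimes>\<^bsub>T.T\<^esub> xr j = xr j \<otimes>\<^bsub>T.T\<^esub> xr i"
    "xl i \<otimes>\<^bsub>T.T\<^esub> xr j = xr j \<otimes>\<^bsub>T.T\<^esub> xl i"
  using x_closed[OF assms(1)] x_closed[OF assms(2)] x_comm[OF assms] by (simp_all add: xl_def xr_def T.pure_mult del: left.mult right.mult)

lemma tensor_gen_pow:
  assumes "i \<in> {1..m}"
  shows "xl i [^]\<^bsub>T.T\<^esub> n = \<one>\<^bsub>T.T\<^esub>" "xr i [^]\<^bsub>T.T\<^esub> n = \<one>\<^bsub>T.T\<^esub>"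
  unfolding xl_def xr_def left.pow[OF x_closed[OF assms], symmetric] right.pow[OF x_closed[OF assms], symmetric]
  by (simp_all only: x_pow[OF assms] left.one right.one)

lemma zz_x:
  assumes "k \<in> {1..<m}" "i \<in> {1..m}"
  shows "zz k \<otimes>\<^bsub>T.T\<^esub> xl i = xl (Transposition.transpose k (k + 1) i) \<otimes>\<^bsub>T.T\<^esub> zz k"
    "zz k \<otimes>\<^bsub>T.T\<^esub> xr i = xr (Transposition.transpose k (k + 1) i) \<otimes>\<^bsub>T.T\<^esub> zz k"
  using z_closed[OF assms(1)] x_closed[OF assms(2)] z_x[OF assms] x_closed[OF transpose_Suc_closed(1)[OF assms]]
  by (simp_all add: xl_def xr_def zz_def T.pure_mult del: left.mult right.mult)

lemma zz_J:
  assumes "k \<in> {1..<m}" "i \<in> {1..m}" "j \<in> {1..m}"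
  shows "zz k \<otimes>\<^bsub>T.T\<^esub> J i j
    = J (Transposition.transpose k (k + 1) i) (Transposition.transpose k (k + 1) j) \<otimes>\<^bsub>T.T\<^esub> zz k"
  unfolding J_def
  by (rule T.Q.twist_intertwine[OF zz_x(1)[OF assms(1,2)] zz_x(2)[OF assms(1,3)]])
     (use assms transpose_Suc_closed(1) in \<open>blast intro: tensor_gen_closed\<close>)+

lemma J_x:
  assumes "i \<in> {1..m}" "j \<in> {1..m}" "l \<in> {1..m}"
  shows "xl l \<otimes>\<^bsub>T.T\<^esub> J i j = J i j \<otimes>\<^bsub>T.T\<^esub> xl l" "xr l \<otimes>\<^bsub>T.T\<^esub> J i j = J i j \<otimes>\<^bsub>T.T\<^esub> xr l"
  unfolding J_def by (rule T.Q.twist_intertwine; use assms in \<open>simp add: tensor_gen_commute\<close>)+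

lemma J_J:
  assumes "i \<in> {1..m}" "j \<in> {1..m}" "i' \<in> {1..m}" "j' \<in> {1..m}"
  shows "J i j \<otimes>\<^bsub>T.T\<^esub> J i' j' = J i' j' \<otimes>\<^bsub>T.T\<^esub> J i j"
  unfolding J_def[of i' j']
  by (rule T.Q.twist_intertwine) (use assms in \<open>simp_all add: J_x\<close>)

definition "dx i = pure_tensor P P (x i) (x i)"
definition "dz k = J k (k + 1) \<otimes>\<^bsub>T.T\<^esub> zz k"

lemma dx_eq: "i \<in> {1..m} \<Longrightarrow> dx i = xl i \<otimes>\<^bsub>T.T\<^esub> xr i"
  using x_closed[of i] by (simp add: dx_def xl_def xr_def T.pure_mult del: left.mult right.mult)

text \<open>The tensor square of \<open>z_k^2\<close> is the product of its two one-sided copies,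
  and the embeddings \<open>a \<mapsto> a \<otimes> 1\<close> and
  \<open>a \<mapsto> 1 \<otimes> a\<close> are algebra maps, hence preserve twists.\<close>

lemma zz_sq:
  assumes "k \<in> {1..<m}"
  shows "zz k \<otimes>\<^bsub>T.T\<^esub> zz k = twist n q T.T (xl k) (xl (k + 1)) \<otimes>\<^bsub>T.T\<^esub> twist n q T.T (xr k) (xr (k + 1))"
proof -
  have x: "x k \<in> carrier P" "x (k + 1) \<in> carrier P" using assms by (auto intro!: x_closed)
  let ?t = "twist n q P (x k) (x (k + 1))"
  have t: "?t \<in> carrier P" using x by (rule pres.Q.twist_closed)
  have "zz k \<otimes>\<^bsub>T.T\<^esub> zz k = pure_tensor P P ?t ?t"
    using z_closed[OF assms] z_sq[OF assms] by (simp add: zz_def T.pure_mult)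
  also have "\<dots> = pure_tensor P P ?t \<one>\<^bsub>P\<^esub> \<otimes>\<^bsub>T.T\<^esub> pure_tensor P P \<one>\<^bsub>P\<^esub> ?t"
    by (rule T.pure_split[OF t t])
  also have "\<dots> = twist n q T.T (xl k) (xl (k + 1)) \<otimes>\<^bsub>T.T\<^esub> twist n q T.T (xr k) (xr (k + 1))"
    by (simp only: left.twist[OF x] right.twist[OF x] xl_def xr_def)
  finally show ?thesis .
qed

text \<open>Once the twisting elements are gathered on the left, each relation involving some
  \<open>dz\<close> splits in two: a relation between the elements \<open>zz\<close>, taken from the
  relations of \<open>P\<close> in both components, and an identity between twists.\<close>

lemma hnm_satisfied_comult: "hnm_satisfied n m q T.T dx dz"
proof -
  note assoc = T.Q.M.m_assoc
  let ?s = "\<lambda>k i. Transposition.transpose k (k + 1) i"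
  have J: "J k (k + 1) \<in> carrier T.T" if "k \<in> {1..<m}" for k
    using that by (intro tensor_gen_closed) auto
  have zz: "zz k \<in> carrier T.T" if "k \<in> {1..<m}" for k
    using that by (rule tensor_gen_closed)
  have xlr: "xl i \<in> carrier T.T" "xr i \<in> carrier T.T" if "i \<in> {1..m}" for i
    using that by (rule tensor_gen_closed)+
  have dx: "dx i \<in> carrier T.T" if "i \<in> {1..m}" for i
    using xlr[OF that] by (simp add: dx_eq[OF that])
  have dz: "dz k \<in> carrier T.T" if "k \<in> {1..<m}" for k
    using J[OF that] zz[OF that] by (simp add: dz_def)
  have pow: "dx i [^]\<^bsub>T.T\<^esub> n = \<one>\<^bsub>T.T\<^esub>" if "i \<in> {1..m}" for i
    using xlr[OF that] tensor_gen_commute(3)[OF that that] tensor_gen_pow[OF that]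
    by (simp add: dx_eq[OF that] T.Q.M.pow_mult_distrib)
  have xx: "dx i \<otimes>\<^bsub>T.T\<^esub> dx j = dx j \<otimes>\<^bsub>T.T\<^esub> dx i" if "i \<in> {1..m}" "j \<in> {1..m}" for i j
    using x_closed[OF that(1)] x_closed[OF that(2)] x_comm[OF that] by (simp add: dx_def T.pure_mult)
  have zx: "dz k \<otimes>\<^bsub>T.T\<^esub> dx i = dx (?s k i) \<otimes>\<^bsub>T.T\<^esub> dz k" if "k \<in> {1..<m}" "i \<in> {1..m}" for k i
  proof -
    have s: "?s k i \<in> {1..m}" using that by (rule transpose_Suc_closed)
    note carr = J[OF that(1)] zz[OF that(1)] xlr[OF that(2)] xlr[OF s]
    have kk: "k \<in> {1..m}" "k + 1 \<in> {1..m}" using that by auto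
    have "dz k \<otimes>\<^bsub>T.T\<^esub> dx i = J k (k + 1) \<otimes>\<^bsub>T.T\<^esub> (zz k \<otimes>\<^bsub>T.T\<^esub> xl i) \<otimes>\<^bsub>T.T\<^esub> xr i"
      unfolding dz_def dx_eq[OF that(2)] using carr by (simp add: assoc)
    also have "\<dots> = (J k (k + 1) \<otimes>\<^bsub>T.T\<^esub> xl (?s k i)) \<otimes>\<^bsub>T.T\<^esub> (zz k \<otimes>\<^bsub>T.T\<^esub> xr i)"
      unfolding zz_x(1)[OF that] using carr by (simp add: assoc)
    also have "\<dots> = xl (?s k i) \<otimes>\<^bsub>T.T\<^esub> (J k (k + 1) \<otimes>\<^bsub>T.T\<^esub> xr (?s k i)) \<otimes>\<^bsub>T.T\<^esub> zz k"
      unfolding zz_x(2)[OF that] J_x(1)[OF kk s, symmetric] using carr by (simp add: assoc)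
    also have "\<dots> = dx (?s k i) \<otimes>\<^bsub>T.T\<^esub> dz k"
      unfolding J_x(2)[OF kk s, symmetric] dz_def dx_eq[OF s] using carr by (simp add: assoc)
    finally show ?thesis .
  qed
  have zz_far: "dz k \<otimes>\<^bsub>T.T\<^esub> dz l = dz l \<otimes>\<^bsub>T.T\<^esub> dz k"
    if kl: "k \<in> {1..<m}" "l \<in> {1..<m}" "\<bar>int k - int l\<bar> > 1" for k l
  proof -
    have kk: "k \<in> {1..m}" "k + 1 \<in> {1..m}" "l \<in> {1..m}" "l + 1 \<in> {1..m}" using that by auto
    \<comment> \<open>Transpositions at distance greater than one fix each other's indices, so
      \<open>zz\<close> commutes with the foreign twisting element.\<close>
    have "?s k l = l" "?s k (l + 1) = l + 1" "?s l k = k" "?s l (k + 1) = k + 1"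
      using kl(3) by (auto simp: Transposition.transpose_def)
    then have zJ: "zz k \<otimes>\<^bsub>T.T\<^esub> J l (l + 1) = J l (l + 1) \<otimes>\<^bsub>T.T\<^esub> zz k"
      "zz l \<otimes>\<^bsub>T.T\<^esub> J k (k + 1) = J k (k + 1) \<otimes>\<^bsub>T.T\<^esub> zz l"
      using zz_J[OF kl(1) kk(3,4)] zz_J[OF kl(2) kk(1,2)] by simp_all
    have zz': "zz k \<otimes>\<^bsub>T.T\<^esub> zz l = zz l \<otimes>\<^bsub>T.T\<^esub> zz k"
      using z_closed[OF kl(1)] z_closed[OF kl(2)] z_z[OF kl] by (simp add: zz_def T.pure_mult)
    note carr = J[OF kl(1)] J[OF kl(2)] zz[OF kl(1)] zz[OF kl(2)]
    have "dz k \<otimes>\<^bsub>T.T\<^esub> dz l = J k (k + 1) \<otimes>\<^bsub>T.T\<^esub> (zz k \<otimes>\<^bsub>T.T\<^esub> J l (l + 1)) \<otimes>\<^bsub>T.T\<^esub> zz l"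
      unfolding dz_def using carr by (simp add: assoc)
    also have "\<dots> = (J k (k + 1) \<otimes>\<^bsub>T.T\<^esub> J l (l + 1)) \<otimes>\<^bsub>T.T\<^esub> (zz k \<otimes>\<^bsub>T.T\<^esub> zz l)"
      unfolding zJ using carr by (simp add: assoc)
    also have "\<dots> = (J l (l + 1) \<otimes>\<^bsub>T.T\<^esub> J k (k + 1)) \<otimes>\<^bsub>T.T\<^esub> (zz l \<otimes>\<^bsub>T.T\<^esub> zz k)"
      unfolding zz' J_J[OF kk] ..
    also have "\<dots> = J l (l + 1) \<otimes>\<^bsub>T.T\<^esub> (J k (k + 1) \<otimes>\<^bsub>T.T\<^esub> zz l) \<otimes>\<^bsub>T.T\<^esub> zz k"
      using carr by (simp add: assoc)
    also have "\<dots> = dz l \<otimes>\<^bsub>T.T\<^esub> dz k"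
      unfolding zJ[symmetric] dz_def using carr by (simp add: assoc)
    finally show ?thesis .
  qed
  have braid: "dz k \<otimes>\<^bsub>T.T\<^esub> dz (k + 1) \<otimes>\<^bsub>T.T\<^esub> dz k = dz (k + 1) \<otimes>\<^bsub>T.T\<^esub> dz k \<otimes>\<^bsub>T.T\<^esub> dz (k + 1)"
    if kl: "k \<in> {1..<m}" "k + 1 \<in> {1..<m}" for k
  proof -
    have kk: "k \<in> {1..m}" "k + 1 \<in> {1..m}" "k + 1 + 1 \<in> {1..m}" using that by auto
    have s: "?s k k = k + 1" "?s k (k + 1) = k" "?s k (k + 1 + 1) = k + 1 + 1"
      "?s (k + 1) k = k" "?s (k + 1) (k + 1) = k + 1 + 1" "?s (k + 1) (k + 1 + 1) = k + 1"
      by (simp_all add: Transposition.transpose_def)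
    show ?thesis
      unfolding dz_def
    proof (rule T.Q.M.braid_twisted)
      show "zz k \<otimes>\<^bsub>T.T\<^esub> zz (k + 1) \<otimes>\<^bsub>T.T\<^esub> zz k = zz (k + 1) \<otimes>\<^bsub>T.T\<^esub> zz k \<otimes>\<^bsub>T.T\<^esub> zz (k + 1)"
        using z_closed[OF kl(1)] z_closed[OF kl(2)] z_braid[OF kl] by (simp add: zz_def T.pure_mult)
      show "zz k \<otimes>\<^bsub>T.T\<^esub> J (k + 1) (k + 1 + 1) = J k (k + 1 + 1) \<otimes>\<^bsub>T.T\<^esub> zz k"
        using zz_J[OF kl(1) kk(2,3)] unfolding s .
      show "zz k \<otimes>\<^bsub>T.T\<^esub> J k (k + 1 + 1) = J (k + 1) (k + 1 + 1) \<otimes>\<^bsub>T.T\<^esub> zz k"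
        using zz_J[OF kl(1) kk(1,3)] unfolding s .
      show "zz (k + 1) \<otimes>\<^bsub>T.T\<^esub> J k (k + 1) = J k (k + 1 + 1) \<otimes>\<^bsub>T.T\<^esub> zz (k + 1)"
        using zz_J[OF kl(2) kk(1,2)] unfolding s .
      show "zz (k + 1) \<otimes>\<^bsub>T.T\<^esub> J k (k + 1 + 1) = J k (k + 1) \<otimes>\<^bsub>T.T\<^esub> zz (k + 1)"
        using zz_J[OF kl(2) kk(1,3)] unfolding s .
    qed (rule zz[OF kl(1)] zz[OF kl(2)] tensor_gen_closed(4)[OF kk(1,2)] tensor_gen_closed(4)[OF kk(1,3)]
        tensor_gen_closed(4)[OF kk(2,3)] J_J kk)+
  qed
  have sq: "dz k \<otimes>\<^bsub>T.T\<^esub> dz k = twist n q T.T (dx k) (dx (k + 1))" if k: "k \<in> {1..<m}" for k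
  proof -
    have kk: "k \<in> {1..m}" "k + 1 \<in> {1..m}" using that by auto
    have s: "?s k k = k + 1" "?s k (k + 1) = k"
      by (simp_all add: Transposition.transpose_def)
    note carr = zz[OF k] tensor_gen_closed(4)[OF kk] tensor_gen_closed(4)[OF kk(2,1)]
    have "dz k \<otimes>\<^bsub>T.T\<^esub> dz k = J k (k + 1) \<otimes>\<^bsub>T.T\<^esub> (zz k \<otimes>\<^bsub>T.T\<^esub> J k (k + 1)) \<otimes>\<^bsub>T.T\<^esub> zz k"
      unfolding dz_def using carr by (simp add: assoc)
    \<comment> \<open>Moving \<open>zz k\<close> across exchanges the two indices of the twist,
      which supplies the mixed factor of \<open>twist_bimultiplicative\<close>.\<close>
    also have "\<dots> = J k (k + 1) \<otimes>\<^bsub>T.T\<^esub> J (k + 1) k \<otimes>\<^bsub>T.T\<^esub> (zz k \<otimes>\<^bsub>T.T\<^esub> zz k)"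
      unfolding zz_J[OF k kk] s using carr by (simp add: assoc)
    also have "\<dots> = twist n q T.T (xl k \<otimes>\<^bsub>T.T\<^esub> xr k) (xl (k + 1) \<otimes>\<^bsub>T.T\<^esub> xr (k + 1))"
      unfolding J_def zz_sq[OF k]
      by (rule T.Q.twist_bimultiplicative[OF q of_nat_n, symmetric])
        (rule xlr kk tensor_gen_pow tensor_gen_commute tensor_gen_commute(3)[symmetric])+
    finally show ?thesis by (simp only: dx_eq[OF kk(1)] dx_eq[OF kk(2)])
  qed
  show ?thesis
    unfolding hnm_satisfied_def by (intro conjI ballI impI dx dz pow xx zx zz_far braid sq)
qed

text \<open>The sum in the coproduct of \<open>z_k\<close> is written with pure tensors of powers.
  It is a twist of the commuting elements \<open>xl k\<close> and \<open>xr (k + 1)\<close>, because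
  both embeddings preserve powers.\<close>

lemma comult_gen: "hnm_comult_gen n m q (LX i) = dx i"
  "k \<in> {1..<m} \<Longrightarrow> hnm_comult_gen n m q (LZ k) = dz k"
proof -
  show "hnm_comult_gen n m q (LX i) = dx i" by (simp add: dx_def Let_def)
  assume k: "k \<in> {1..<m}"
  then have x: "x k \<in> carrier P" "x (k + 1) \<in> carrier P" by (auto intro!: x_closed)
  have "pure_tensor P P (x k [^]\<^bsub>P\<^esub> i) (x (k + 1) [^]\<^bsub>P\<^esub> j) = xl k [^]\<^bsub>T.T\<^esub> i \<otimes>\<^bsub>T.T\<^esub> xr (k + 1) [^]\<^bsub>T.T\<^esub> j"
    for i j :: nat
    using T.pure_split[OF pres.Q.M.nat_pow_closed[OF x(1), of i] pres.Q.M.nat_pow_closed[OF x(2), of j]]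
    by (simp only: xl_def xr_def left.pow[OF x(1)] right.pow[OF x(2)])
  then show "hnm_comult_gen n m q (LZ k) = dz k"
    by (simp add: dz_def J_def zz_def twist_def Let_def)
qed

definition "\<Delta> = presented_lift T.T (hnm_comult_gen n m q)"

lemma comult:
  shows hom_comult: "algebra_hom P T.T \<Delta>"
    and comult_x: "i \<in> {1..m} \<Longrightarrow> \<Delta> (x i) = dx i"
    and comult_z: "k \<in> {1..<m} \<Longrightarrow> \<Delta> (z k) = dz k"
proof -
  have sat: "hnm_satisfied n m q T.T (\<lambda>i. hnm_comult_gen n m q (LX i)) (\<lambda>k. hnm_comult_gen n m q (LZ k))"
    by (rule hnm_satisfied_cong[THEN iffD1, OF _ _ hnm_satisfied_comult]) (simp_all only: comult_gen)
  note lift = presented_lift_hnm[OF T.Q.k_algebra_axioms sat]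
  show "algebra_hom P T.T \<Delta>" "i \<in> {1..m} \<Longrightarrow> \<Delta> (x i) = dx i" "k \<in> {1..<m} \<Longrightarrow> \<Delta> (z k) = dz k"
    unfolding \<Delta>_def using lift comult_gen by simp_all
qed

end

lemma ground_algebra_simps [simp]:
  "carrier (ground_algebra :: ('k::field, 'k) module) = UNIV"
  "c \<oplus>\<^bsub>(ground_algebra :: ('k, 'k) module)\<^esub> d = c + d"
  "c \<otimes>\<^bsub>(ground_algebra :: ('k, 'k) module)\<^esub> d = c * d"
  "\<one>\<^bsub>(ground_algebra :: ('k, 'k) module)\<^esub> = 1"
  "\<zero>\<^bsub>(ground_algebra :: ('k, 'k) module)\<^esub> = 0"
  "c \<odot>\<^bsub>(ground_algebra :: ('k, 'k) module)\<^esub> d = c * d"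
  by (simp_all add: ground_algebra_def ring.extend_def module.fields_def)

lemma k_algebra_ground_algebra: "k_algebra (ground_algebra :: ('k::field, 'k) module)"
proof (rule k_algebraI)
  show "ring (ground_algebra :: ('k, 'k) module)"
    by (rule ring_cong[OF cring.axioms(1)[OF cring_from_type_algebra]])
       (simp_all add: ground_algebra_def ring.extend_def)
qed (simp_all add: algebra_simps)

context hnm_bialgebra
begin

definition "\<epsilon> = presented_lift ground_algebra (\<lambda>_. 1 :: 'k)"

lemma counit:
  shows hom_counit: "algebra_hom P ground_algebra \<epsilon>"
    and counit_x: "i \<in> {1..m} \<Longrightarrow> \<epsilon> (x i) = 1"
    and counit_z: "k \<in> {1..<m} \<Longrightarrow> \<epsilon> (z k) = 1"
proof -
  interpret G: k_algebra "ground_algebra :: ('k, 'k) module" by (rule k_algebra_ground_algebra)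
  \<comment> \<open>With all generators sent to \<open>1\<close>, the only relation with content is
    that for \<open>z_k^2\<close>, and \<open>twist_one\<close> settles it.\<close>
  have "hnm_satisfied n m q ground_algebra (\<lambda>_. 1 :: 'k) (\<lambda>_. 1)"
    using G.twist_one[OF q of_nat_n] G.M.nat_pow_one[of n] by (simp add: hnm_satisfied_def)
  note lift = presented_lift_hnm[OF k_algebra_ground_algebra this]
  show "algebra_hom P ground_algebra \<epsilon>" "i \<in> {1..m} \<Longrightarrow> \<epsilon> (x i) = 1" "k \<in> {1..<m} \<Longrightarrow> \<epsilon> (z k) = 1"
    unfolding \<epsilon>_def using lift by simp_all
qed

end

section \<open>Weights of words\<close>

definition letter_weight :: "nat \<Rightarrow> nat \<Rightarrow> nat \<Rightarrow> nat \<Rightarrow> nat"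
  where "letter_weight a b i g = (if g = i then a else b)"

fun word_weight :: "nat \<Rightarrow> nat \<Rightarrow> nat \<Rightarrow> nat list \<Rightarrow> nat"
  where
    "word_weight a b i [] = 0"
  | "word_weight a b i (g # w) = letter_weight a b i g + word_weight a b i w"

text \<open>Exponents of \<open>p\<close>: the value \<open>2 * (a * b)\<close> stands for
  \<open>q^(a * b)\<close>, and \<open>b ^ 2\<close> is possible only because \<open>p\<close> is a
  square root of \<open>q\<close>.\<close>

definition letter_exponent :: "nat \<Rightarrow> nat \<Rightarrow> nat \<Rightarrow> nat \<Rightarrow> nat"
  where "letter_exponent a b k g = (if g = k then 2 * (a * b) else if g = Suc k then 0 else b ^ 2)"

text \<open>
  On a word \<open>w\<close>, the generator \<open>x\<^sub>i\<close> acts by \<open>q\<close> to the power \<open>word_weight a b i w\<close>, and \<open>z\<^sub>k\<close>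
  by \<open>p\<close> to the power \<open>word_exponent a b k w\<close> and the permutation \<open>s\<^sub>k\<close> of the letters.  The mixed term
  is the effect of the twist in \<open>\<Delta>(z\<^sub>k)\<close>.
\<close>

fun word_exponent :: "nat \<Rightarrow> nat \<Rightarrow> nat \<Rightarrow> nat list \<Rightarrow> nat"
  where
    "word_exponent a b k [] = 0"
  | "word_exponent a b k (g # w) = letter_exponent a b k g
      + 2 * (letter_weight a b (Suc k) g * word_weight a b k w) + word_exponent a b k w"

abbreviation swap :: "nat \<Rightarrow> nat \<Rightarrow> nat"
  where "swap k \<equiv> Transposition.transpose k (Suc k)"

lemma word_weight_append: "word_weight a b i (v @ w) = word_weight a b i v + word_weight a b i w"
  by (induct v) simp_all

lemma word_exponent_append:
  "word_exponent a b k (v @ w) = word_exponent a b k v + word_exponent a b k w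
    + 2 * (word_weight a b (Suc k) v * word_weight a b k w)"
  by (induct v) (simp_all add: word_weight_append algebra_simps)

text \<open>Exchanging two adjacent letters affects only the mixed term between these two;
  \<open>e\<close> collects everything else.\<close>

lemma word_exponent_pair:
  "\<exists>e. word_exponent a b k (s @ [i, j] @ t) = e + 2 * (letter_weight a b (Suc k) i * letter_weight a b k j)
    \<and> word_exponent a b k (s @ [j, i] @ t) = e + 2 * (letter_weight a b (Suc k) j * letter_weight a b k i)"
proof (intro exI conjI)
  let ?e = "word_exponent a b k s + word_exponent a b k t + letter_exponent a b k i + letter_exponent a b k j
    + 2 * (word_weight a b (Suc k) s * (letter_weight a b k i + letter_weight a b k j + word_weight a b k t))
    + 2 * ((letter_weight a b (Suc k) i + letter_weight a b (Suc k) j) * word_weight a b k t)"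
  show "word_exponent a b k (s @ [i, j] @ t) = ?e + 2 * (letter_weight a b (Suc k) i * letter_weight a b k j)"
    by (simp add: word_exponent_append word_weight_append algebra_simps)
  show "word_exponent a b k (s @ [j, i] @ t) = ?e + 2 * (letter_weight a b (Suc k) j * letter_weight a b k i)"
    by (simp add: word_exponent_append word_weight_append algebra_simps)
qed

lemma letter_weight_swap: "letter_weight a b i (swap k g) = letter_weight a b (swap k i) g"
  by (auto simp: letter_weight_def Transposition.transpose_def)

lemma word_weight_swap: "word_weight a b i (map (swap k) w) = word_weight a b (swap k i) w"
  by (induct w) (simp_all add: letter_weight_swap)

text \<open>The relation for \<open>z_k^2\<close> in exponents of \<open>p\<close>. On one letter it
  says that \<open>2ab + 0\<close> and \<open>b^2 + b^2\<close> are twice the product of the two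
  weights; the mixed terms supply the rest of the product for longer words.\<close>

lemma word_exponent_sq:
  "word_exponent a b k w + word_exponent a b k (map (swap k) w)
    = 2 * (word_weight a b k w * word_weight a b (Suc k) w)"
proof (induct w)
  case (Cons g w)
  have "letter_exponent a b k g + letter_exponent a b k (swap k g)
      = 2 * (letter_weight a b k g * letter_weight a b (Suc k) g)"
    by (auto simp: letter_exponent_def letter_weight_def Transposition.transpose_def power2_eq_square)
  with Cons show ?case
    by (simp add: word_weight_swap letter_weight_swap algebra_simps)
qed simp

text \<open>The exponent only registers where the letters \<open>k\<close> and \<open>k + 1\<close>
  occur, and the distant transposition moves neither of them.\<close>

lemma word_exponent_far:
  assumes "\<bar>int k - int l\<bar> > 1"
  shows "word_exponent a b k (map (swap l) w) = word_exponent a b k w"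
proof -
  have s: "swap l k = k" "swap l (Suc k) = Suc k"
    using assms by (auto simp: Transposition.transpose_def)
  have "letter_exponent a b k (swap l g) = letter_exponent a b k g" for g
    using assms by (auto simp: letter_exponent_def Transposition.transpose_def)
  then show ?thesis
    by (induct w) (simp_all add: word_weight_swap letter_weight_swap s)
qed

text \<open>The braid relation in exponents. On each side the three mixed terms pair the weights for
  the same index pairs \<open>(k+1, k)\<close>, \<open>(k+2, k)\<close>, \<open>(k+2, k+1)\<close>,
  in a different order.\<close>

lemma word_exponent_braid:
  "word_exponent a b k w + word_exponent a b (Suc k) (map (swap k) w)
      + word_exponent a b k (map (swap (Suc k)) (map (swap k) w))
    = word_exponent a b (Suc k) w + word_exponent a b k (map (swap (Suc k)) w)
      + word_exponent a b (Suc k) (map (swap k) (map (swap (Suc k)) w))"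
proof (induct w)
  case (Cons g w)
  have s: "swap k k = Suc k" "swap k (Suc k) = k" "swap k (Suc (Suc k)) = Suc (Suc k)"
    "swap (Suc k) k = k" "swap (Suc k) (Suc k) = Suc (Suc k)" "swap (Suc k) (Suc (Suc k)) = Suc k"
    by (simp_all add: Transposition.transpose_def)
  have "letter_exponent a b k g + letter_exponent a b (Suc k) (swap k g) + letter_exponent a b k (swap (Suc k) (swap k g))
      = letter_exponent a b (Suc k) g + letter_exponent a b k (swap (Suc k) g) + letter_exponent a b (Suc k) (swap k (swap (Suc k) g))"
    by (auto simp: letter_exponent_def Transposition.transpose_def)
  with Cons show ?case
    by (simp add: word_weight_swap letter_weight_swap s algebra_simps del: map_map)
qed simp

lemma map_swap_far:
  assumes "\<bar>int k - int l\<bar> > 1"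
  shows "map (swap k) (map (swap l) w) = map (swap l) (map (swap k) w)"
  using assms by (auto simp: Transposition.transpose_def)

lemma map_swap_braid:
  "map (swap k) (map (swap (Suc k)) (map (swap k) w)) = map (swap (Suc k)) (map (swap k) (map (swap (Suc k)) w))"
  by (auto simp: Transposition.transpose_def)

lemma map_swap_sq: "map (swap k) (map (swap k) w) = w"
  by (simp add: map_idI)

lemma map_swap_lists: "\<lbrakk>k \<in> {1..<m}; w \<in> lists {1..m}\<rbrakk> \<Longrightarrow> map (swap k) w \<in> lists {1..m}"
  using transpose_Suc_closed(2)[of k m] by (auto simp del: One_nat_def)

text \<open>This is the condition for \<open>z_k\<close> to respect the relation between
  \<open>u_i\<close> and \<open>u_j\<close>: the powers of \<open>q\<close> are the mixed terms of
  the words \<open>u_i u_j\<close> and \<open>u_j u_i\<close>.\<close>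

lemma quantum_matrix_swap:
  fixes p q lam mu :: "'k::field" and a b k i j :: nat
  assumes p0: "p \<noteq> 0" and pq: "p ^ 2 = q"
    and lam: "lam = q powi ((int b)^2 - int a * int b)"
    and mu: "mu = p powi ((int b)^2 - (int a)^2)"
  shows "q ^ (letter_weight a b (Suc k) i * letter_weight a b k j) * quantum_matrix lam mu (swap k i) (swap k j)
    = quantum_matrix lam mu i j * q ^ (letter_weight a b (Suc k) j * letter_weight a b k i)"
proof -
  have q0: "q \<noteq> 0" using p0 pq by auto
  have lam0: "lam \<noteq> 0" and mu0: "mu \<noteq> 0" using q0 p0 lam mu by auto
  \<comment> \<open>The integer exponents defining \<open>lam\<close> and \<open>mu\<close> may be
    negative, so they are cleared into equations between natural powers.\<close>
  have L: "lam * q ^ (a * b) = q ^ (b * b)"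
    unfolding lam using q0
    by (simp add: power_int_diff power2_eq_square flip: of_nat_mult power_int_of_nat)
  have "mu * p ^ (a * a) = p ^ (b * b)"
    unfolding mu using p0
    by (simp add: power_int_diff power2_eq_square flip: of_nat_mult power_int_of_nat)
  \<comment> \<open>The statement speaks of \<open>q = p^2\<close>, so the equation for
    \<open>mu\<close> is squared.\<close>
  then have "(mu * p ^ (a * a)) ^ 2 = (p ^ (b * b)) ^ 2" by simp
  then have M: "mu * mu * q ^ (a * a) = q ^ (b * b)"
    unfolding pq[symmetric] by (simp add: power2_eq_square power_mult_distrib algebra_simps)
  have less: "q ^ (letter_weight a b (Suc k) i * letter_weight a b k j) * quantum_matrix lam mu (swap k i) (swap k j)
    = quantum_matrix lam mu i j * q ^ (letter_weight a b (Suc k) j * letter_weight a b k i)" if "i < j" for i j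
  proof -
    \<comment> \<open>The pair \<open>k\<close>, \<open>Suc k\<close> is reversed by the swap and
      uses \<open>M\<close>. If exactly one index is \<open>k\<close> or \<open>Suc k\<close>, the
      distance \<open>j - i\<close> changes by one, which costs one factor \<open>lam\<close> and
      uses \<open>L\<close>. Otherwise nothing moves.\<close>
    have "i = k \<and> j = Suc k \<or> i = k \<and> j > Suc k \<or> i = Suc k \<and> j > Suc k
      \<or> i < k \<and> j = k \<or> i < k \<and> j = Suc k \<or> i \<noteq> k \<and> i \<noteq> Suc k \<and> j \<noteq> k \<and> j \<noteq> Suc k"
      using that by arith
    then consider "i = k" "j = Suc k" | "i = k" "j > Suc k" | "i = Suc k" "j > Suc k"
      | "i < k" "j = k" | "i < k" "j = Suc k" | "i \<noteq> k" "i \<noteq> Suc k" "j \<noteq> k" "j \<noteq> Suc k"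
      by blast
    then show ?thesis
    proof cases
      case 1
      then show ?thesis using M mu0
        by (simp add: quantum_matrix_def letter_weight_def Transposition.transpose_def field_simps)
    next
      case 2
      then obtain d where "j = Suc (Suc (k + d))" by (auto simp: less_iff_Suc_add)
      with 2 show ?thesis using L
        by (simp add: quantum_matrix_def letter_weight_def Transposition.transpose_def algebra_simps) 
    next
      case 3
      then obtain d where "j = Suc (Suc (k + d))" by (auto simp: less_iff_Suc_add)
      with 3 show ?thesis using L
        by (simp add: quantum_matrix_def letter_weight_def Transposition.transpose_def algebra_simps)
    next
      case 4
      then obtain d where "k = Suc (i + d)" by (auto simp: less_iff_Suc_add)
      with 4 show ?thesis using L
        by (simp add: quantum_matrix_def letter_weight_def Transposition.transpose_def algebra_simps)
    next
      case 5
      then obtain d where "k = Suc (i + d)" by (auto simp: less_iff_Suc_add)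
      with 5 show ?thesis using L
        by (simp add: quantum_matrix_def letter_weight_def Transposition.transpose_def algebra_simps)
    next
      case 6
      then show ?thesis
        by (simp add: quantum_matrix_def letter_weight_def Transposition.transpose_def)
    qed
  qed
  \<comment> \<open>The case \<open>j < i\<close> is the case \<open>i < j\<close> with roles
    exchanged and both matrix entries inverted.\<close>
  have inv: "quantum_matrix lam mu j i = inverse (quantum_matrix lam mu i j)" for i j
    by (simp add: quantum_matrix_def)
  have nz: "quantum_matrix lam mu i j \<noteq> 0" for i j
    using lam0 mu0 by (simp add: quantum_matrix_def)
  consider "i < j" | "i = j" | "j < i" by linarith
  then show ?thesis
  proof cases
    case 2
    then show ?thesis by (simp add: quantum_matrix_def)
  next
    case 3
    from less[OF this] show ?thesis
      using nz[of j i] nz[of "swap k j" "swap k i"]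
      unfolding inv[of i j] inv[of "swap k i" "swap k j"] by (simp add: field_simps)
  qed (rule less)
qed

section \<open>The action on quantum polynomials\<close>

text \<open>Keeps the simplifier from turning the \<open>1\<close> in \<open>{1..m}\<close> and
  \<open>{1..<m}\<close> into \<open>Suc 0\<close>, after which membership facts would no longer
  match.\<close>

declare One_nat_def [simp del]

lemma quantum_relations_subset: "quantum_relations m r \<subseteq> carrier (free_algebra {1..m})"
proof -
  interpret F: k_algebra "free_algebra {1..m} :: ('k::field, nat list \<Rightarrow>\<^sub>0 'k) module"
    by (rule k_algebra_free_algebra)
  show ?thesis
    unfolding quantum_relations_def Let_def
    by (auto intro!: F.M.minus_closed F.M.m_closed F.smult_closed')
qed

locale quantum_action = hnm_bialgebra n m q for n m :: nat and q :: "'k::field_char_0" +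
  fixes a b :: nat and p lam mu :: 'k and r :: "nat \<Rightarrow> nat \<Rightarrow> 'k"
  assumes pq: "p ^ 2 = q"
    and lam: "lam = q powi ((int b)^2 - int a * int b)"
    and mu: "mu = p powi ((int b)^2 - (int a)^2)"
    and r: "r = quantum_matrix lam mu"
begin

abbreviation "A \<equiv> quantum_polynomials m r"

sublocale qp: presentation "{1..m}" "quantum_relations m r"
  rewrites "presented_algebra {1..m} (quantum_relations m r) = quantum_polynomials m r"
  by unfold_locales (simp_all add: quantum_relations_subset quantum_polynomials_def)

abbreviation "word \<equiv> qp.word"

sublocale E: k_algebra "end_algebra A"
  by (rule qp.Q.k_algebra_end_algebra)

lemma word_append: "\<lbrakk>v \<in> lists {1..m}; w \<in> lists {1..m}\<rbrakk> \<Longrightarrow> word (v @ w) = word v \<otimes>\<^bsub>A\<^esub> word w"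
  by (rule qp.cls_mult[symmetric])

lemma word_closed [simp]: "w \<in> lists {1..m} \<Longrightarrow> word w \<in> carrier A"
  by (rule qp.cls_closed)

lemma word_swap:
  assumes "i \<in> {1..m}" "j \<in> {1..m}" "s \<in> lists {1..m}" "t \<in> lists {1..m}"
  shows "word (s @ [i, j] @ t) = r i j \<odot>\<^bsub>A\<^esub> word (s @ [j, i] @ t)"
proof -
  let ?F = "free_algebra {1..m} :: ('k, nat list \<Rightarrow>\<^sub>0 'k) module"
  have u: "free_var i \<in> carrier ?F" "free_var j \<in> carrier ?F" using assms by (auto intro: free_var_closed)
  have ij: "[i, j] \<in> lists {1..m}" "[j, i] \<in> lists {1..m}" using assms by auto
  have "free_var i \<otimes>\<^bsub>?F\<^esub> free_var j \<ominus>\<^bsub>?F\<^esub> r i j \<odot>\<^bsub>?F\<^esub> (free_var j \<otimes>\<^bsub>?F\<^esub> free_var i) \<in> quantum_relations m r"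
    using assms unfolding quantum_relations_def Let_def by blast
  then have "qp.proj (free_var i \<otimes>\<^bsub>?F\<^esub> free_var j \<ominus>\<^bsub>?F\<^esub> r i j \<odot>\<^bsub>?F\<^esub> (free_var j \<otimes>\<^bsub>?F\<^esub> free_var i)) = \<zero>\<^bsub>A\<^esub>"
    using qp.M.M.genideal_self[OF quantum_relations_subset] by (intro qp.proj_ideal) blast
  then have "qp.proj (free_var i \<otimes>\<^bsub>?F\<^esub> free_var j) = r i j \<odot>\<^bsub>A\<^esub> qp.proj (free_var j \<otimes>\<^bsub>?F\<^esub> free_var i)"
    using u by (simp add: qp.Q.M.r_right_minus_eq)
  then have "word [i, j] = r i j \<odot>\<^bsub>A\<^esub> word [j, i]"
    by (simp add: free_var_def)
  then have "word s \<otimes>\<^bsub>A\<^esub> word [i, j] \<otimes>\<^bsub>A\<^esub> word t = r i j \<odot>\<^bsub>A\<^esub> (word s \<otimes>\<^bsub>A\<^esub> word [j, i] \<otimes>\<^bsub>A\<^esub> word t)"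
    using ij assms(3,4) by simp
  moreover have "word (s @ v @ t) = word s \<otimes>\<^bsub>A\<^esub> word v \<otimes>\<^bsub>A\<^esub> word t" if "v \<in> lists {1..m}" for v
  proof -
    have "v @ t \<in> lists {1..m}" using that assms by simp
    then show ?thesis using that assms by (simp only: word_append qp.Q.M.m_assoc word_closed)
  qed
  ultimately show ?thesis using ij by (simp only:)
qed

section \<open>Monomial operators on quantum polynomials\<close>

definition "monomial_map c \<pi> = restrict
  (\<lambda>Y. the_elem (linear_extension A (\<lambda>w. c w \<odot>\<^bsub>A\<^esub> word (\<pi> w)) ` Y)) (carrier A)"

text \<open>The scalar \<open>c\<close> depends on the word as a whole, so the operator is only
  linear, and compatibility with a relation has to be asked for inside every pair of a prefix
  \<open>s\<close> and a suffix \<open>t\<close>.\<close>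

lemma monomial_map:
  assumes \<pi>: "\<And>w. w \<in> lists {1..m} \<Longrightarrow> \<pi> w \<in> lists {1..m}"
    and stable: "\<And>s t i j. \<lbrakk>s \<in> lists {1..m}; t \<in> lists {1..m}; i \<in> {1..m}; j \<in> {1..m}\<rbrakk> \<Longrightarrow>
      c (s @ [i, j] @ t) \<odot>\<^bsub>A\<^esub> word (\<pi> (s @ [i, j] @ t))
        = (r i j * c (s @ [j, i] @ t)) \<odot>\<^bsub>A\<^esub> word (\<pi> (s @ [j, i] @ t))"
  shows "monomial_map c \<pi> \<in> carrier (end_algebra A)"
    and "w \<in> lists {1..m} \<Longrightarrow> monomial_map c \<pi> (word w) = c w \<odot>\<^bsub>A\<^esub> word (\<pi> w)"
proof -
  let ?\<phi> = "\<lambda>w. c w \<odot>\<^bsub>A\<^esub> word (\<pi> w)"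
  let ?S = "word_monoid {1..m}"
  let ?F = "free_algebra {1..m} :: ('k, nat list \<Rightarrow>\<^sub>0 'k) module"
  have \<phi>: "?\<phi> w \<in> carrier A" if "w \<in> lists {1..m}" for w
    using \<pi>[OF that] by simp
  have lin: "linear_map ?F A (linear_extension A ?\<phi>)"
    by (rule qp.linear_extension[OF qp.Q.k_algebra_axioms]) (use \<phi> in auto)
  interpret l: linear_map ?F A "linear_extension A ?\<phi>" by (rule lin)
  have single: "linear_extension A ?\<phi> (Poly_Mapping.single w d) = d \<odot>\<^bsub>A\<^esub> ?\<phi> w" if "w \<in> lists {1..m}" for w d
    by (rule qp.Q.linear_extension_single) (rule \<phi>[OF that])
  have kills: "linear_extension A ?\<phi> (Poly_Mapping.single s 1 \<otimes>\<^bsub>?F\<^esub> \<rho> \<otimes>\<^bsub>?F\<^esub> Poly_Mapping.single t 1) = \<zero>\<^bsub>A\<^esub>"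
    if s: "s \<in> lists {1..m}" and t: "t \<in> lists {1..m}" and \<rho>: "\<rho> \<in> quantum_relations m r" for s t \<rho>
  proof -
    from \<rho> obtain i j where ij: "i \<in> {1..m}" "j \<in> {1..m}"
      and \<rho>: "\<rho> = free_var i \<otimes>\<^bsub>?F\<^esub> free_var j \<ominus>\<^bsub>?F\<^esub> r i j \<odot>\<^bsub>?F\<^esub> (free_var j \<otimes>\<^bsub>?F\<^esub> free_var i)"
      unfolding quantum_relations_def Let_def by blast
    have \<rho>': "\<rho> = Poly_Mapping.single [i, j] 1 \<ominus>\<^bsub>?F\<^esub> Poly_Mapping.single [j, i] (r i j)"
      by (simp add: \<rho> free_var_def)
    have words: "s @ [i, j] @ t \<in> lists {1..m}" "s @ [j, i] @ t \<in> lists {1..m}"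
      "[i, j] \<in> lists {1..m}" "[j, i] \<in> lists {1..m}"
      using s t ij by auto
    have F: "Poly_Mapping.single w d \<in> carrier ?F" if "w \<in> lists {1..m}" for w and d :: 'k
      using that by (rule qp.single_closed)
    have "linear_map ?F A (\<lambda>f. linear_extension A ?\<phi> (Poly_Mapping.single s 1 \<otimes>\<^bsub>?F\<^esub> f \<otimes>\<^bsub>?F\<^esub> Poly_Mapping.single t 1))"
      by (rule linear_map_comp[OF linear_map_comp[OF qp.M.linear_mult_left qp.M.linear_mult_right] lin])
         (use s t F in auto)
    then interpret L: linear_map ?F A "\<lambda>f. linear_extension A ?\<phi> (Poly_Mapping.single s 1 \<otimes>\<^bsub>?F\<^esub> f \<otimes>\<^bsub>?F\<^esub> Poly_Mapping.single t 1)" .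
    have "linear_extension A ?\<phi> (Poly_Mapping.single (s @ [i, j] @ t) 1)
        = linear_extension A ?\<phi> (Poly_Mapping.single (s @ [j, i] @ t) (r i j))"
      unfolding single[OF words(1)] single[OF words(2)] using \<pi>[OF words(1)] \<pi>[OF words(2)] stable[OF s t ij]
      by (simp del: append.simps)
    then show ?thesis
      unfolding \<rho>' L.diff[OF F[OF words(3)] F[OF words(4)]]
      using \<phi>[OF words(2)] single[OF words(2)] by (simp add: qp.Q.M.r_neg a_minus_def)
  qed
  interpret m: monoid_algebra_quotient_lift ?S ?F "quantum_relations m r" A word A ?\<phi>
    by unfold_locales
      (use \<phi> kills in \<open>auto simp: free_algebra_def quantum_polynomials_def presented_algebra_def\<close>)
  have op: "monomial_map c \<pi> = restrict m.lift (carrier A)"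
    by (simp add: monomial_map_def m.lift_def fun_eq_iff)
  show "monomial_map c \<pi> \<in> carrier (end_algebra A)"
    unfolding op by (rule qp.Q.restrict_in_end_algebra[OF m.linear_lift])
  show "w \<in> lists {1..m} \<Longrightarrow> monomial_map c \<pi> (word w) = c w \<odot>\<^bsub>A\<^esub> word (\<pi> w)"
    using m.lift_cls[of w] by (simp add: op)
qed

lemma p_nonzero: "p \<noteq> 0"
  using q pq by (auto simp: primitive_root_of_unity_def power_0_left split: if_splits)

lemma p_pow_even: "p ^ (2 * e) = q ^ e"
  by (simp add: power_mult pq)

definition "opx i = monomial_map (\<lambda>w. q ^ word_weight a b i w) (\<lambda>w. w)"
definition "opz k = monomial_map (\<lambda>w. p ^ word_exponent a b k w) (map (swap k))"

lemma opx:
  shows opx_closed: "opx i \<in> carrier (end_algebra A)"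
    and opx_word: "w \<in> lists {1..m} \<Longrightarrow> opx i (word w) = q ^ word_weight a b i w \<odot>\<^bsub>A\<^esub> word w"
proof -
  have *: "(q ^ word_weight a b i (s @ [l, j] @ t)) \<odot>\<^bsub>A\<^esub> word (s @ [l, j] @ t)
      = (r l j * q ^ word_weight a b i (s @ [j, l] @ t)) \<odot>\<^bsub>A\<^esub> word (s @ [j, l] @ t)"
    if "s \<in> lists {1..m}" "t \<in> lists {1..m}" "l \<in> {1..m}" "j \<in> {1..m}" for s t l j
  proof -
    have "s @ [j, l] @ t \<in> lists {1..m}" using that by auto
    then have "word (s @ [j, l] @ t) \<in> carrier A" by (rule word_closed)
    moreover have "word_weight a b i (s @ [l, j] @ t) = word_weight a b i (s @ [j, l] @ t)"
      by (simp add: word_weight_append)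
    ultimately show ?thesis
      unfolding word_swap[OF that(3,4,1,2)] by (simp add: mult.commute del: append.simps)
  qed
  show "opx i \<in> carrier (end_algebra A)"
    unfolding opx_def by (rule monomial_map(1)) (assumption, rule *)
  show "w \<in> lists {1..m} \<Longrightarrow> opx i (word w) = q ^ word_weight a b i w \<odot>\<^bsub>A\<^esub> word w"
    unfolding opx_def by (rule monomial_map(2)) (assumption, rule *)
qed

text \<open>Exchanging adjacent letters alters the exponent by their mixed term only, and
  \<open>quantum_matrix_swap\<close> states that the commutation factor of the permuted letters
  compensates for it.\<close>

lemma opz:
  assumes k: "k \<in> {1..<m}"
  shows opz_closed: "opz k \<in> carrier (end_algebra A)"
    and opz_word: "w \<in> lists {1..m} \<Longrightarrow> opz k (word w) = p ^ word_exponent a b k w \<odot>\<^bsub>A\<^esub> word (map (swap k) w)"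
proof -
  have *: "(p ^ word_exponent a b k (s @ [i, j] @ t)) \<odot>\<^bsub>A\<^esub> word (map (swap k) (s @ [i, j] @ t))
      = (r i j * p ^ word_exponent a b k (s @ [j, i] @ t)) \<odot>\<^bsub>A\<^esub> word (map (swap k) (s @ [j, i] @ t))"
    if st: "s \<in> lists {1..m}" "t \<in> lists {1..m}" "i \<in> {1..m}" "j \<in> {1..m}" for s t i j
  proof -
    let ?s = "map (swap k) s" and ?t = "map (swap k) t"
    have st': "swap k i \<in> {1..m}" "swap k j \<in> {1..m}" "?s \<in> lists {1..m}" "?t \<in> lists {1..m}"
      using st by (simp_all only: transpose_Suc_closed(2)[OF k] map_swap_lists[OF k])
    have w: "word (?s @ [swap k j, swap k i] @ ?t) \<in> carrier A"
      by (rule word_closed) (use st' in auto)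
    obtain e where e:
      "word_exponent a b k (s @ [i, j] @ t) = e + 2 * (letter_weight a b (Suc k) i * letter_weight a b k j)"
      "word_exponent a b k (s @ [j, i] @ t) = e + 2 * (letter_weight a b (Suc k) j * letter_weight a b k i)"
      using word_exponent_pair by blast
    have "p ^ word_exponent a b k (s @ [i, j] @ t) * r (swap k i) (swap k j)
        = r i j * p ^ word_exponent a b k (s @ [j, i] @ t)"
      using quantum_matrix_swap[OF p_nonzero pq lam mu, where k = k and i = i and j = j]
      unfolding e power_add p_pow_even r[symmetric] by (simp add: Suc_eq_plus1 algebra_simps)
    then show ?thesis
      using w by (simp add: word_swap[OF st', simplified])
  qed
  show "opz k \<in> carrier (end_algebra A)"
    unfolding opz_def by (rule monomial_map(1)) (erule map_swap_lists[OF k], rule *)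
  show "w \<in> lists {1..m} \<Longrightarrow> opz k (word w) = p ^ word_exponent a b k w \<odot>\<^bsub>A\<^esub> word (map (swap k) w)"
    unfolding opz_def by (rule monomial_map(2)) (erule map_swap_lists[OF k], rule *)
qed

lemma end_eqI:
  assumes "f \<in> carrier (end_algebra A)" "g \<in> carrier (end_algebra A)"
    and "\<And>w. w \<in> lists {1..m} \<Longrightarrow> f (word w) = g (word w)"
  shows "f = g"
  using assms(1,2)
proof (rule qp.Q.end_algebra_eqI)
  fix v assume "v \<in> carrier A"
  with assms show "f v = g v"
    by (intro qp.quotient_linear_map_eqI[of A f g v] qp.Q.end_algebra_linear)
qed

lemma opx_pow_word:
  assumes "w \<in> lists {1..m}"
  shows "(opx i [^]\<^bsub>end_algebra A\<^esub> (j::nat)) (word w) = q ^ (word_weight a b i w * j) \<odot>\<^bsub>A\<^esub> word w"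
proof (induct j)
  case (Suc j)
  then show ?case
    using assms opx_closed[of i] E.M.nat_pow_closed[OF opx_closed[of i], of j]
    by (simp add: opx_word power_add mult.commute)
qed (simp add: assms)

lemma q_pow_n: "q ^ (c * n) = 1"
  using q by (simp add: primitive_root_of_unity_def mult.commute[of c] power_mult)

lemma hnm_satisfied_end: "hnm_satisfied n m q (end_algebra A) opx opz"
proof -
  let ?E = "end_algebra A"
  note map_closed = map_swap_lists
  have pow: "opx i [^]\<^bsub>?E\<^esub> n = \<one>\<^bsub>?E\<^esub>" for i
    by (rule end_eqI) (simp_all add: opx_closed opx_pow_word q_pow_n)
  have xx: "opx i \<otimes>\<^bsub>?E\<^esub> opx j = opx j \<otimes>\<^bsub>?E\<^esub> opx i" for i j
    by (rule end_eqI) (simp_all add: opx_closed opx_word mult.commute)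
  have zx: "opz k \<otimes>\<^bsub>?E\<^esub> opx i = opx (swap k i) \<otimes>\<^bsub>?E\<^esub> opz k" if "k \<in> {1..<m}" for k i
    by (rule end_eqI)
      (simp_all add: opx_closed opz_closed[OF that] opx_word opz_word[OF that] map_closed[OF that]
        word_weight_swap mult.commute del: in_lists_conv_set)
  have zz: "opz k \<otimes>\<^bsub>?E\<^esub> opz l = opz l \<otimes>\<^bsub>?E\<^esub> opz k"
    if kl: "k \<in> {1..<m}" "l \<in> {1..<m}" and far: "\<bar>int k - int l\<bar> > 1" for k l
  proof -
    have far': "\<bar>int l - int k\<bar> > 1" using far by simp
    show ?thesis
      by (rule end_eqI)
        (simp_all add: opz_closed[OF kl(1)] opz_closed[OF kl(2)] opz_word[OF kl(1)] opz_word[OF kl(2)] map_closed[OF kl(1)] map_closed[OF kl(2)]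
          word_exponent_far[OF far] word_exponent_far[OF far']
          map_swap_far[OF far] mult.commute del: in_lists_conv_set map_map)
  qed
  have braid: "opz k \<otimes>\<^bsub>?E\<^esub> opz (Suc k) \<otimes>\<^bsub>?E\<^esub> opz k = opz (Suc k) \<otimes>\<^bsub>?E\<^esub> opz k \<otimes>\<^bsub>?E\<^esub> opz (Suc k)"
    if kl: "k \<in> {1..<m}" "Suc k \<in> {1..<m}" for k
  proof (rule end_eqI)
    fix w assume w: "w \<in> lists {1..m}"
    have "(opz k \<otimes>\<^bsub>?E\<^esub> opz (Suc k) \<otimes>\<^bsub>?E\<^esub> opz k) (word w)
        = p ^ (word_exponent a b k w + word_exponent a b (Suc k) (map (swap k) w)
            + word_exponent a b k (map (swap (Suc k)) (map (swap k) w)))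
          \<odot>\<^bsub>A\<^esub> word (map (swap k) (map (swap (Suc k)) (map (swap k) w)))"
      using w by (simp add: opz_closed[OF kl(1)] opz_closed[OF kl(2)] opz_word[OF kl(1)] opz_word[OF kl(2)] map_closed[OF kl(1)] map_closed[OF kl(2)]
          power_add mult.assoc del: in_lists_conv_set map_map)
    also have "\<dots> = p ^ (word_exponent a b (Suc k) w + word_exponent a b k (map (swap (Suc k)) w)
            + word_exponent a b (Suc k) (map (swap k) (map (swap (Suc k)) w)))
          \<odot>\<^bsub>A\<^esub> word (map (swap (Suc k)) (map (swap k) (map (swap (Suc k)) w)))"
      by (simp only: word_exponent_braid map_swap_braid)
    also have "\<dots> = (opz (Suc k) \<otimes>\<^bsub>?E\<^esub> opz k \<otimes>\<^bsub>?E\<^esub> opz (Suc k)) (word w)"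
      using w by (simp add: opz_closed[OF kl(1)] opz_closed[OF kl(2)] opz_word[OF kl(1)] opz_word[OF kl(2)] map_closed[OF kl(1)] map_closed[OF kl(2)]
          power_add mult.assoc del: in_lists_conv_set map_map)
    finally show "(opz k \<otimes>\<^bsub>?E\<^esub> opz (Suc k) \<otimes>\<^bsub>?E\<^esub> opz k) (word w)
        = (opz (Suc k) \<otimes>\<^bsub>?E\<^esub> opz k \<otimes>\<^bsub>?E\<^esub> opz (Suc k)) (word w)" .
  qed (simp_all add: opz_closed[OF kl(1)] opz_closed[OF kl(2)])
  have sq: "opz k \<otimes>\<^bsub>?E\<^esub> opz k = twist n q ?E (opx k) (opx (Suc k))" if k: "k \<in> {1..<m}" for k
  proof (rule end_eqI)
    fix w assume w: "w \<in> lists {1..m}"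
    then have v: "word w \<in> carrier A" by (rule word_closed)
    \<comment> \<open>Evaluation at a fixed word is linear, so the twist of operators becomes a sum
      of scalars, to which \<open>twist_sum_scalar\<close> applies with the two weights of the
      word.\<close>
    interpret ev: linear_map ?E A "\<lambda>f. f (word w)"
      by unfold_locales (simp_all add: v)
    have "twist n q ?E (opx k) (opx (Suc k)) (word w)
        = twist_sum n q A (\<lambda>i j. (q ^ (word_weight a b k w * i) * q ^ (word_weight a b (Suc k) w * j)) \<odot>\<^bsub>A\<^esub> word w)"
      unfolding twist_def
      by (subst ev.twist_sum) (simp_all add: opx_closed opx_pow_word[OF w] v mult.commute)
    also have "\<dots> = q ^ (word_weight a b k w * word_weight a b (Suc k) w) \<odot>\<^bsub>A\<^esub> word w"
      by (rule qp.Q.twist_sum_scalar[OF q of_nat_n v])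
    also have "\<dots> = (opz k \<otimes>\<^bsub>?E\<^esub> opz k) (word w)"
      using w v by (simp add: opz_closed[OF k] opz_word[OF k] map_closed[OF k] map_swap_sq p_pow_even word_exponent_sq
          del: in_lists_conv_set map_map flip: power_add)
    finally show "(opz k \<otimes>\<^bsub>?E\<^esub> opz k) (word w) = twist n q ?E (opx k) (opx (Suc k)) (word w)" ..
  qed (simp_all add: opx_closed opz_closed[OF k])
  show ?thesis
    unfolding hnm_satisfied_def Suc_eq_plus1[symmetric]
    by (intro conjI ballI impI opx_closed opz_closed pow xx zx zz braid sq)
qed

section \<open>The action and its compatibility with products\<close>

definition "action = presented_lift (end_algebra A) (case_hnm_letter opx opz)"

lemma action:
  shows hom_action: "algebra_hom P (end_algebra A) action"
    and action_x: "i \<in> {1..m} \<Longrightarrow> action (x i) = opx i"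
    and action_z: "k \<in> {1..<m} \<Longrightarrow> action (z k) = opz k"
proof -
  have "hnm_satisfied n m q (end_algebra A) (\<lambda>i. case_hnm_letter opx opz (LX i)) (\<lambda>k. case_hnm_letter opx opz (LZ k))"
    using hnm_satisfied_end by simp
  note lift = presented_lift_hnm[OF E.k_algebra_axioms this]
  show "algebra_hom P (end_algebra A) action" "i \<in> {1..m} \<Longrightarrow> action (x i) = opx i"
    "k \<in> {1..<m} \<Longrightarrow> action (z k) = opz k"
    unfolding action_def using lift by simp_all
qed

sublocale act: algebra_hom P "end_algebra A" action
  by (rule hom_action)

sublocale \<Delta>: algebra_hom P T.T \<Delta>
  by (rule hom_comult)

lemma action_simps':
  assumes "h \<in> carrier P" "u \<in> carrier A"
  shows "action h u \<in> carrier A" "action h (c \<odot>\<^bsub>A\<^esub> u) = c \<odot>\<^bsub>A\<^esub> action h u"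
    "v \<in> carrier A \<Longrightarrow> action h (u \<oplus>\<^bsub>A\<^esub> v) = action h u \<oplus>\<^bsub>A\<^esub> action h v"
    "action (c \<odot>\<^bsub>P\<^esub> h) u = c \<odot>\<^bsub>A\<^esub> action h u"
    "h' \<in> carrier P \<Longrightarrow> action (h \<oplus>\<^bsub>P\<^esub> h') u = action h u \<oplus>\<^bsub>A\<^esub> action h' u"
    "h' \<in> carrier P \<Longrightarrow> action (h \<otimes>\<^bsub>P\<^esub> h') u = action h (action h' u)"
  using assms by (simp_all add: qp.Q.end_algebra_simps[OF act.closed])

lemma action_zero: "h \<in> carrier P \<Longrightarrow> action h \<zero>\<^bsub>A\<^esub> = \<zero>\<^bsub>A\<^esub>"
  by (rule qp.Q.end_algebra_simps(4)[OF act.closed]) auto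

lemma action_unit: "u \<in> carrier A \<Longrightarrow> action \<one>\<^bsub>P\<^esub> u = u" "u \<in> carrier A \<Longrightarrow> action \<zero>\<^bsub>P\<^esub> u = \<zero>\<^bsub>A\<^esub>"
  by simp_all

lemmas action_simps = action_simps' action_zero action_unit

lemma linear_action: "h \<in> carrier P \<Longrightarrow> linear_map A A (action h)"
  by (rule qp.Q.end_algebra_linear[OF act.closed])

lemma action_x_pow_word:
  assumes "i \<in> {1..m}" "w \<in> lists {1..m}"
  shows "action (x i [^]\<^bsub>P\<^esub> (j::nat)) (word w) = q ^ (word_weight a b i w * j) \<odot>\<^bsub>A\<^esub> word w"
  unfolding act.pow[OF x_closed[OF assms(1)]] action_x[OF assms(1)] by (rule opx_pow_word[OF assms(2)])

text \<open>The right-hand side of the product axiom with an arbitrary tensor in place of the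
  coproduct of \<open>h\<close>, which makes it linear in the tensor and open to induction.\<close>

definition "diag u v = tensor_lift A (\<lambda>h\<^sub>1 h\<^sub>2. action h\<^sub>1 u \<otimes>\<^bsub>A\<^esub> action h\<^sub>2 v)"

lemma diag:
  assumes "u \<in> carrier A" "v \<in> carrier A"
  shows linear_diag: "linear_map T.T A (diag u v)"
    and diag_pure: "\<lbrakk>h \<in> carrier P; h' \<in> carrier P\<rbrakk> \<Longrightarrow>
      diag u v (pure_tensor P P h h') = action h u \<otimes>\<^bsub>A\<^esub> action h' v"
proof -
  have "bilinear_map P P A (\<lambda>h\<^sub>1 h\<^sub>2. action h\<^sub>1 u \<otimes>\<^bsub>A\<^esub> action h\<^sub>2 v)"
    unfolding bilinear_map_def
    by (intro conjI ballI linear_map.intro linear_map_axioms.intro pres.Q.k_algebra_axioms qp.Q.k_algebra_axioms)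
      (use assms in \<open>simp_all add: action_simps qp.Q.M.l_distr qp.Q.M.r_distr\<close>)
  note lift = T.tensor_lift[OF qp.Q.k_algebra_axioms this]
  show "linear_map T.T A (diag u v)"
    unfolding diag_def by (rule lift(1))
  show "\<lbrakk>h \<in> carrier P; h' \<in> carrier P\<rbrakk> \<Longrightarrow> diag u v (pure_tensor P P h h') = action h u \<otimes>\<^bsub>A\<^esub> action h' v"
    unfolding diag_def by (rule lift(2))
qed

lemma diag_simps':
  assumes "u \<in> carrier A" "v \<in> carrier A" "t \<in> carrier T.T"
  shows "diag u v t \<in> carrier A" "diag u v (c \<odot>\<^bsub>T.T\<^esub> t) = c \<odot>\<^bsub>A\<^esub> diag u v t"
    "t' \<in> carrier T.T \<Longrightarrow> diag u v (t \<oplus>\<^bsub>T.T\<^esub> t') = diag u v t \<oplus>\<^bsub>A\<^esub> diag u v t'"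
proof -
  interpret d: linear_map T.T A "diag u v" using assms(1,2) by (rule linear_diag)
  show "diag u v t \<in> carrier A" "diag u v (c \<odot>\<^bsub>T.T\<^esub> t) = c \<odot>\<^bsub>A\<^esub> diag u v t"
    "t' \<in> carrier T.T \<Longrightarrow> diag u v (t \<oplus>\<^bsub>T.T\<^esub> t') = diag u v t \<oplus>\<^bsub>A\<^esub> diag u v t'"
    using assms(3) by (simp_all add: d.closed d.smult d.add)
qed

lemma diag_zero: "\<lbrakk>u \<in> carrier A; v \<in> carrier A\<rbrakk> \<Longrightarrow> diag u v \<zero>\<^bsub>T.T\<^esub> = \<zero>\<^bsub>A\<^esub>"
  using linear_map.zero[OF linear_diag] by blast

lemmas diag_simps = diag_simps' diag_zero

text \<open>Both sides are additive in \<open>t\<close>, so pure tensors suffice; there it is the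
  linearity of each operator of the action.\<close>

lemma diag_add_smult:
  assumes "u \<in> carrier A" "u' \<in> carrier A" "v \<in> carrier A" "v' \<in> carrier A" "t \<in> carrier T.T"
  shows "diag (u \<oplus>\<^bsub>A\<^esub> u') v t = diag u v t \<oplus>\<^bsub>A\<^esub> diag u' v t"
    and "diag u (v \<oplus>\<^bsub>A\<^esub> v') t = diag u v t \<oplus>\<^bsub>A\<^esub> diag u v' t"
    and "diag (c \<odot>\<^bsub>A\<^esub> u) v t = c \<odot>\<^bsub>A\<^esub> diag u v t"
    and "diag u (c \<odot>\<^bsub>A\<^esub> v) t = c \<odot>\<^bsub>A\<^esub> diag u v t"
  using assms(5)
proof (induct t rule: T.pure_induct)
  case (add h h' t)
  note simps = assms(1-4) add(1-3) diag_simps diag_pure action_simps qp.Q.M.l_distr qp.Q.M.r_distr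
    qp.Q.smult_add_right qp.Q.M.a_ac T.pure_closed
  {
    case 1 show ?case using add(4) by (simp add: simps)
  next
    case 2 show ?case using add(5) by (simp add: simps)
  next
    case 3 show ?case using add(6) by (simp add: simps)
  next
    case 4 show ?case using add(7) by (simp add: simps)
  }
qed (simp_all add: assms diag_simps)

text \<open>The right factor of a product acts first, so it can be moved into the vectors.\<close>

lemma diag_mult_pure:
  assumes "u \<in> carrier A" "v \<in> carrier A" "h \<in> carrier P" "h' \<in> carrier P" "t \<in> carrier T.T"
  shows "diag u v (t \<otimes>\<^bsub>T.T\<^esub> pure_tensor P P h h') = diag (action h u) (action h' v) t"
  using assms(5)
proof (induct t rule: T.pure_induct)
  case (add g g' t)
  then show ?case
    using assms(1-4)
    by (simp add: T.Q.M.l_distr T.pure_mult diag_simps diag_pure action_simps T.pure_closed)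
qed (use assms(1-4) in \<open>simp add: diag_simps action_simps T.pure_closed\<close>)

definition "acts_diagonally h \<longleftrightarrow>
  (\<forall>u\<in>carrier A. \<forall>v\<in>carrier A. action h (u \<otimes>\<^bsub>A\<^esub> v) = diag u v (\<Delta> h))"

text \<open>The element \<open>h\<close> acts on the value of \<open>diag\<close> at any tensor by
  multiplying the tensor from the left by the coproduct of \<open>h\<close>. Taking the coproduct of
  \<open>h'\<close> for the tensor, multiplicativity of \<Delta> gives the claim.\<close>

lemma acts_diagonally_mult:
  assumes h: "h \<in> carrier P" "acts_diagonally h" and h': "h' \<in> carrier P" "acts_diagonally h'"
  shows "acts_diagonally (h \<otimes>\<^bsub>P\<^esub> h')"
  unfolding acts_diagonally_def
proof (intro ballI)
  fix u v assume uv: "u \<in> carrier A" "v \<in> carrier A"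
  \<comment> \<open>On a pure tensor, \<open>diag\<close> is a product of two vectors, so the
    hypothesis on \<open>h\<close> applies to these vectors.\<close>
  have "action h (diag u v t) = diag u v (\<Delta> h \<otimes>\<^bsub>T.T\<^esub> t)" if "t \<in> carrier T.T" for t
    using that
  proof (induct t rule: T.pure_induct)
    case (add g g' t)
    have "action h (diag u v (pure_tensor P P g g')) = diag u v (\<Delta> h \<otimes>\<^bsub>T.T\<^esub> pure_tensor P P g g')"
      using add(1,2) uv h by (simp add: diag_pure diag_mult_pure acts_diagonally_def action_simps)
    with add show ?case
      using uv h by (simp add: diag_simps action_simps T.Q.M.r_distr T.pure_closed)
  qed (use uv h in \<open>simp add: diag_simps action_simps\<close>)
  then show "action (h \<otimes>\<^bsub>P\<^esub> h') (u \<otimes>\<^bsub>A\<^esub> v) = diag u v (\<Delta> (h \<otimes>\<^bsub>P\<^esub> h'))"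
    using uv h h' by (simp add: action_simps acts_diagonally_def)
qed

text \<open>Both sides are bilinear in the two vectors, and words span; one argument is extended
  after the other.\<close>

lemma acts_diagonally_wordI:
  assumes h: "h \<in> carrier P"
    and words: "\<And>v w. \<lbrakk>v \<in> lists {1..m}; w \<in> lists {1..m}\<rbrakk> \<Longrightarrow>
      action h (word v \<otimes>\<^bsub>A\<^esub> word w) = diag (word v) (word w) (\<Delta> h)"
  shows "acts_diagonally h"
  unfolding acts_diagonally_def
proof (intro ballI)
  fix u v assume u: "u \<in> carrier A" and v: "v \<in> carrier A"
  have *: "action h (word w \<otimes>\<^bsub>A\<^esub> v) = diag (word w) v (\<Delta> h)" if w: "w \<in> lists {1..m}" for w
  proof (rule qp.quotient_linear_map_eqI[OF _ _ _ v])
    show "linear_map A A (\<lambda>v. action h (word w \<otimes>\<^bsub>A\<^esub> v))"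
      by (rule linear_map_comp[OF qp.Q.linear_mult_left linear_action]) (simp_all add: w h word_closed del: in_lists_conv_set)
    show "linear_map A A (\<lambda>v. diag (word w) v (\<Delta> h))"
      by (intro linear_map.intro linear_map_axioms.intro qp.Q.k_algebra_axioms)
        (use w h in \<open>simp_all add: diag_simps diag_add_smult word_closed del: in_lists_conv_set\<close>)
  qed (rule words[OF w])
  show "action h (u \<otimes>\<^bsub>A\<^esub> v) = diag u v (\<Delta> h)"
  proof (rule qp.quotient_linear_map_eqI[OF _ _ _ u])
    show "linear_map A A (\<lambda>u. action h (u \<otimes>\<^bsub>A\<^esub> v))"
      by (rule linear_map_comp[OF qp.Q.linear_mult_right linear_action]) (rule v, rule h)
    show "linear_map A A (\<lambda>u. diag u v (\<Delta> h))"
      by (intro linear_map.intro linear_map_axioms.intro qp.Q.k_algebra_axioms)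
        (use v h in \<open>simp_all add: diag_simps diag_add_smult\<close>)
  qed (rule *)
qed

lemma acts_diagonally_x:
  assumes i: "i \<in> {1..m}"
  shows "acts_diagonally (x i)"
proof (rule acts_diagonally_wordI)
  fix v w assume vw: "v \<in> lists {1..m}" "w \<in> lists {1..m}"
  then have "v @ w \<in> lists {1..m}" by simp
  then show "action (x i) (word v \<otimes>\<^bsub>A\<^esub> word w) = diag (word v) (word w) (\<Delta> (x i))"
    using vw x_closed[OF i]
    by (simp add: comult_x[OF i] dx_def diag_pure action_x[OF i] opx_word word_weight_append power_add
        mult.commute flip: word_append del: in_lists_conv_set)
qed (rule x_closed[OF i])

text \<open>First \<open>z_k\<close> acts on both words separately; then the twisting element
  multiplies the product of the permuted words by a power of \<open>q\<close>, which is exactly the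
  mixed term of \<open>word_exponent_append\<close>.\<close>

lemma acts_diagonally_z:
  assumes k: "k \<in> {1..<m}"
  shows "acts_diagonally (z k)"
proof (rule acts_diagonally_wordI)
  fix v w assume vw: "v \<in> lists {1..m}" "w \<in> lists {1..m}"
  let ?v = "map (swap k) v" and ?w = "map (swap k) w"
  have vw': "?v \<in> lists {1..m}" "?w \<in> lists {1..m}" using vw by (simp_all only: map_swap_lists[OF k])
  have app: "v @ w \<in> lists {1..m}" "?v @ ?w \<in> lists {1..m}" using vw vw' by simp_all
  note word = word_closed[OF vw(1)] word_closed[OF vw(2)] word_closed[OF vw'(1)] word_closed[OF vw'(2)]
  have kk: "k \<in> {1..m}" "k + 1 \<in> {1..m}" using k by auto
  interpret d: linear_map T.T A "diag (word ?v) (word ?w)" by (rule linear_diag[OF word(3,4)])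
  have J: "diag (word ?v) (word ?w) (J k (k + 1))
      = q ^ (word_weight a b k ?v * word_weight a b (k + 1) ?w) \<odot>\<^bsub>A\<^esub> (word ?v \<otimes>\<^bsub>A\<^esub> word ?w)"
  proof -
    have pow: "xl k [^]\<^bsub>T.T\<^esub> i \<otimes>\<^bsub>T.T\<^esub> xr (k + 1) [^]\<^bsub>T.T\<^esub> j
        = pure_tensor P P (x k [^]\<^bsub>P\<^esub> i) (x (k + 1) [^]\<^bsub>P\<^esub> j)" for i j :: nat
      by (simp only: xl_def xr_def left.pow[OF x_closed[OF kk(1)], symmetric] right.pow[OF x_closed[OF kk(2)], symmetric]
          T.pure_split[OF pres.Q.M.nat_pow_closed pres.Q.M.nat_pow_closed] x_closed[OF kk(1)] x_closed[OF kk(2)])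
    have diag_word: "diag (word ?v) (word ?w) (pure_tensor P P (x k [^]\<^bsub>P\<^esub> i) (x (k + 1) [^]\<^bsub>P\<^esub> j))
        = (q ^ (word_weight a b k ?v * i) * q ^ (word_weight a b (k + 1) ?w * j)) \<odot>\<^bsub>A\<^esub> (word ?v \<otimes>\<^bsub>A\<^esub> word ?w)"
      for i j :: nat
      unfolding diag_pure[OF word(3,4) pres.Q.M.nat_pow_closed[OF x_closed[OF kk(1)]] pres.Q.M.nat_pow_closed[OF x_closed[OF kk(2)]]]
        action_x_pow_word[OF kk(1) vw'(1)] action_x_pow_word[OF kk(2) vw'(2)]
      using word(3,4) by (simp add: mult.commute)
    have "diag (word ?v) (word ?w) (J k (k + 1))
        = twist_sum n q A (\<lambda>i j. diag (word ?v) (word ?w) (pure_tensor P P (x k [^]\<^bsub>P\<^esub> i) (x (k + 1) [^]\<^bsub>P\<^esub> j)))"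
      unfolding J_def twist_def pow
      by (rule d.twist_sum) (intro T.pure_closed pres.Q.M.nat_pow_closed x_closed kk)
    also have "\<dots> = twist_sum n q A (\<lambda>i j. (q ^ (word_weight a b k ?v * i) * q ^ (word_weight a b (k + 1) ?w * j))
        \<odot>\<^bsub>A\<^esub> (word ?v \<otimes>\<^bsub>A\<^esub> word ?w))"
      unfolding diag_word ..
    also have "\<dots> = q ^ (word_weight a b k ?v * word_weight a b (k + 1) ?w) \<odot>\<^bsub>A\<^esub> (word ?v \<otimes>\<^bsub>A\<^esub> word ?w)"
      by (rule qp.Q.twist_sum_scalar[OF q of_nat_n]) (rule qp.Q.M.m_closed[OF word(3,4)])
    finally show ?thesis .
  qed
  \<comment> \<open>The twist meets the words after the permutation, so its indices \<open>k\<close>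
    and \<open>k + 1\<close> read off the weights of \<open>v\<close> and \<open>w\<close> for
    \<open>k + 1\<close> and \<open>k\<close>.\<close>
  have weights: "word_weight a b k ?v = word_weight a b (Suc k) v" "word_weight a b (Suc k) ?w = word_weight a b k w"
    by (simp_all add: word_weight_swap)
  have scalar: "p ^ word_exponent a b k v * p ^ word_exponent a b k w * q ^ (word_weight a b k ?v * word_weight a b (k + 1) ?w)
      = p ^ word_exponent a b k (v @ w)"
    unfolding word_exponent_append power_add p_pow_even Suc_eq_plus1[symmetric] weights ..
  have Jc: "J k (k + 1) \<in> carrier T.T" by (rule tensor_gen_closed(4)[OF kk])
  have "diag (word v) (word w) (\<Delta> (z k)) = diag (action (z k) (word v)) (action (z k) (word w)) (J k (k + 1))"
    unfolding comult_z[OF k] dz_def zz_def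
    by (rule diag_mult_pure[OF word(1,2) z_closed[OF k] z_closed[OF k] Jc])
  also have "\<dots> = (p ^ word_exponent a b k v * p ^ word_exponent a b k w) \<odot>\<^bsub>A\<^esub> diag (word ?v) (word ?w) (J k (k + 1))"
    unfolding action_z[OF k] opz_word[OF k vw(1)] opz_word[OF k vw(2)]
    using word Jc by (simp add: diag_add_smult diag_simps mult.commute)
  also have "\<dots> = p ^ word_exponent a b k (v @ w) \<odot>\<^bsub>A\<^esub> word (?v @ ?w)"
    unfolding J word_append[OF vw'] scalar[symmetric] using word(3,4) by simp
  also have "\<dots> = action (z k) (word v \<otimes>\<^bsub>A\<^esub> word w)"
    unfolding action_z[OF k] word_append[OF vw, symmetric] opz_word[OF k app(1)] by (simp only: map_append)
  finally show "action (z k) (word v \<otimes>\<^bsub>A\<^esub> word w) = diag (word v) (word w) (\<Delta> (z k))" ..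
qed (rule z_closed[OF k])

lemma acts_diagonally_one: "acts_diagonally \<one>\<^bsub>P\<^esub>"
  unfolding acts_diagonally_def \<Delta>.one T.pure_one by (simp add: diag_pure action_simps del: left.one right.one)

lemma gen_cases:
  assumes "g \<in> hnm_letters m"
  obtains i where "i \<in> {1..m}" "pres.gen g = x i" | k where "k \<in> {1..<m}" "pres.gen g = z k"
proof (cases g)
  case (LX i)
  then show ?thesis
    using assms by (intro that(1)[of i]) (simp_all only: hnm_letter_in gen_eq)
next
  case (LZ k)
  then show ?thesis
    using assms by (intro that(2)[of k]) (simp_all only: hnm_letter_in gen_eq)
qed

text \<open>Words in the generators span \<open>P\<close>; a word is reached by products, a general
  element by linear combinations.\<close>

lemma generator_induct [consumes 1, case_names x z one mult zero add]:
  assumes "h \<in> carrier P"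
    and x: "\<And>i. i \<in> {1..m} \<Longrightarrow> Pr (x i)" and z: "\<And>k. k \<in> {1..<m} \<Longrightarrow> Pr (z k)" and one: "Pr \<one>\<^bsub>P\<^esub>"
    and mult: "\<And>h h'. \<lbrakk>h \<in> carrier P; h' \<in> carrier P; Pr h; Pr h'\<rbrakk> \<Longrightarrow> Pr (h \<otimes>\<^bsub>P\<^esub> h')"
    and zero: "Pr \<zero>\<^bsub>P\<^esub>"
    and add: "\<And>c h h'. \<lbrakk>h \<in> carrier P; h' \<in> carrier P; Pr h; Pr h'\<rbrakk> \<Longrightarrow> Pr (c \<odot>\<^bsub>P\<^esub> h \<oplus>\<^bsub>P\<^esub> h')"
  shows "Pr h"
proof -
  have word: "Pr (pres.word w)" if "w \<in> lists (hnm_letters m)" for w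
    using that
  proof (induct w)
    case Nil
    then show ?case using one by (simp only: pres.cls_one)
  next
    case (Cons g w)
    from Cons(1) have g: "Pr (pres.gen g)"
    proof (rule gen_cases)
      show "Pr (pres.gen g)" if "i \<in> {1..m}" "pres.gen g = x i" for i
        unfolding that(2) by (rule x[OF that(1)])
      show "Pr (pres.gen g)" if "k \<in> {1..<m}" "pres.gen g = z k" for k
        unfolding that(2) by (rule z[OF that(1)])
    qed
    show ?case
      unfolding pres.word_Cons[OF Cons(1,2)]
      by (rule mult[OF pres.gen_closed[OF Cons(1)] pres.cls_closed[OF Cons(2)] g Cons(3)])
  qed
  show ?thesis
    using assms(1)
  proof (induct h rule: pres.quotient_induct)
    case zero
    show ?case by (rule assms(6))
  next
    case (add w c h)
    show ?case by (rule assms(7)[OF pres.cls_closed[OF add(1)] add(2) word[OF add(1)] add(3)])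
  qed
qed

lemma all_act_diagonally: "h \<in> carrier P \<Longrightarrow> acts_diagonally h"
proof (induct h rule: generator_induct)
  case (add c h h')
  then show ?case
    by (simp add: acts_diagonally_def action_simps diag_simps)
qed (simp_all add: acts_diagonally_x acts_diagonally_z acts_diagonally_one acts_diagonally_mult,
  simp add: acts_diagonally_def action_simps diag_simps)

text \<open>The unit is the empty word, whose weights and exponents vanish, so every generator fixes
  it, in agreement with the counit. Both sides are compatible with products and linear
  combinations.\<close>

lemma action_one: "h \<in> carrier P \<Longrightarrow> action h \<one>\<^bsub>A\<^esub> = \<epsilon> h \<odot>\<^bsub>A\<^esub> \<one>\<^bsub>A\<^esub>"
proof (induct h rule: generator_induct)
  interpret \<epsilon>: algebra_hom P ground_algebra \<epsilon> by (rule hom_counit)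
  {
    case (x i)
    then show ?case using opx_word[of "[]" i] by (simp add: counit_x action_x qp.cls_one)
  next
    case (z k)
    then show ?case using opz_word[of k "[]"] by (simp add: counit_z action_z qp.cls_one)
  next
    case one
    show ?case using \<epsilon>.one by (simp add: action_simps)
  next
    case (mult h h')
    then show ?case by (simp add: action_simps mult.commute)
  next
    case zero
    show ?case using \<epsilon>.zero by simp
  next
    case (add c h h')
    then show ?case by (simp add: action_simps qp.Q.smult_add_left)
  }
qed

lemma hnm_simps:
  "carrier (hnm n m q) = carrier P" "monoid.mult (hnm n m q) = monoid.mult P"
  "one (hnm n m q) = one P" "zero (hnm n m q) = zero P" "add (hnm n m q) = add P"
  "module.smult (hnm n m q) = module.smult P"
  "comult (hnm n m q) = \<Delta>" "counit (hnm n m q) = \<epsilon>"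
  by (simp_all add: hnm_def Let_def module.extend_def hopf_data.fields_def \<Delta>_def \<epsilon>_def)

lemma module_algebra: "left_module_algebra (hnm n m q) A action"
proof (intro left_module_algebra.intro left_module_algebra_axioms.intro)
  show "assoc_algebra ring_of_type_algebra (hnm n m q)"
    by (rule k_algebra.axioms[OF pres.Q.cong]) (simp_all add: hnm_simps)
  show "assoc_algebra ring_of_type_algebra A"
    by (rule k_algebra.axioms[OF qp.Q.k_algebra_axioms])
qed (use all_act_diagonally in \<open>simp_all add: hnm_simps action_simps action_one acts_diagonally_def diag_def\<close>)

lemma quantum_var_eq: "quantum_var m r i = word [i]"
  by (simp add: quantum_var_def presented_gen_def free_var_def)

lemma action_x_var:
  assumes "i \<in> {1..m}" "j \<in> {1..m}"
  shows "action (x j) (quantum_var m r i) = q ^ (if i = j then a else b) \<odot>\<^bsub>A\<^esub> quantum_var m r i"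
  using assms by (simp add: quantum_var_eq action_x opx_word letter_weight_def)

lemma action_z_var:
  assumes k: "k \<in> {1..<m}" and j: "j \<in> {1..m}"
  shows "action (z k) (quantum_var m r j) = p ^ letter_exponent a b k j \<odot>\<^bsub>A\<^esub> quantum_var m r (swap k j)"
  using j by (simp add: quantum_var_eq action_z[OF k] opz_word[OF k])

end

theorem theorem18:
  fixes n m a b :: nat
    and q p lam mu :: "'k::field_char_0"
    and r :: "nat \<Rightarrow> nat \<Rightarrow> 'k"
  assumes "n \<ge> 2" and "m \<ge> 2"
    and "primitive_root_of_unity n q"
    and "p ^ 2 = q"
    and "a < n" and "b < n" and "\<not> [a = b] (mod n)"
    and "lam = q powi ((int b)^2 - int a * int b)"
    and "mu = p powi ((int b)^2 - (int a)^2)"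
    and "r = quantum_matrix lam mu"
  shows "\<exists>act. left_module_algebra (hnm n m q) (quantum_polynomials m r) act
    \<and> (\<forall>i\<in>{1..m}. act (hnm_x n m q i) (quantum_var m r i)
          = q ^ a \<odot>\<^bsub>quantum_polynomials m r\<^esub> quantum_var m r i)
    \<and> (\<forall>i\<in>{1..m}. \<forall>j\<in>{1..m}. i \<noteq> j \<longrightarrow>
        act (hnm_x n m q j) (quantum_var m r i)
          = q ^ b \<odot>\<^bsub>quantum_polynomials m r\<^esub> quantum_var m r i)
    \<and> (\<forall>i\<in>{1..<m}. act (hnm_z n m q i) (quantum_var m r i)
          = q ^ (a * b) \<odot>\<^bsub>quantum_polynomials m r\<^esub> quantum_var m r (i + 1))
    \<and> (\<forall>i\<in>{1..<m}. act (hnm_z n m q i) (quantum_var m r (i + 1)) = quantum_var m r i)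
    \<and> (\<forall>i\<in>{1..<m}. \<forall>j\<in>{1..m}. j \<notin> {i, i + 1} \<longrightarrow>
        act (hnm_z n m q i) (quantum_var m r j)
          = p ^ (b^2) \<odot>\<^bsub>quantum_polynomials m r\<^esub> quantum_var m r j)"
proof -
  interpret quantum_action n m q a b p lam mu r
    using assms by unfold_locales
  have z: "action (z i) (quantum_var m r i) = q ^ (a * b) \<odot>\<^bsub>A\<^esub> quantum_var m r (i + 1)"
    "action (z i) (quantum_var m r (i + 1)) = quantum_var m r i" if i: "i \<in> {1..<m}" for i
  proof -
    have ii: "i \<in> {1..m}" "i + 1 \<in> {1..m}" using i by auto
    show "action (z i) (quantum_var m r i) = q ^ (a * b) \<odot>\<^bsub>A\<^esub> quantum_var m r (i + 1)"
      \<comment> \<open>The exponent \<open>2 * (a * b)\<close> of \<open>p\<close> is turned back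
        into \<open>q ^ (a * b)\<close> by \<open>p_pow_even\<close>.\<close>
      unfolding action_z_var[OF i ii(1)] by (simp add: letter_exponent_def p_pow_even flip: Suc_eq_plus1)
    have "quantum_var m r i \<in> carrier A"
      unfolding quantum_var_eq by (rule word_closed) (use ii in simp)
    then show "action (z i) (quantum_var m r (i + 1)) = quantum_var m r i"
      unfolding action_z_var[OF i ii(2)] by (simp add: letter_exponent_def flip: Suc_eq_plus1)
  qed
  have z': "action (z i) (quantum_var m r j) = p ^ (b^2) \<odot>\<^bsub>A\<^esub> quantum_var m r j"
    if "i \<in> {1..<m}" "j \<in> {1..m}" "j \<notin> {i, i + 1}" for i j
    unfolding action_z_var[OF that(1,2)] using that(3) by (simp add: letter_exponent_def)
  show ?thesis
    by (intro exI[of _ action] conjI ballI impI module_algebra z z') (simp_all add: action_x_var)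
qed

end
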